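(* Let $1<\alpha<2$. Let $\{G(n)\}$ be a sequence of random intersection graphs $G(n)=G(n,m,P)$, $m=m(n)\to\infty$, $P=P(n)$, satisfying condition (A) and condition (PL) with this $\alpha$, some slowly varying function $L$ and some $\varepsilon_0\in(0,1/2)$. Suppose that for some $\beta>\max\{2-\alpha,\alpha-1\}$ we have $m(n)=\Omega(n^\beta)$. Then $$\omega(G(n))=(1+o_P(1))\,(1-\alpha/2)^{-\alpha/2}K(n),\qquad K(n)=L\big((n\ln n)^{1/2}\big)\,n^{1-\alpha/2}(\ln n)^{-\alpha/2}.$$
   Context: Random intersection graph: given positive integers $n,m$ and a probability measure $P$ on $\{0,1,\dots,m\}$, $G(n,m,P)$ has vertex set $V=[n]=\{1,\dots,n\}$ and attribute set $W=\{w_1,\dots,w_m\}$; independent random subsets $S_1,\dots,S_n\subseteq W$ are drawn with $\mathbb P(S_v=S)=P(|S|)/\binom{m}{|S|}$ for every $S\subseteq W$, and distinct $u,v$ are adjacent iff $S_u\cap S_v\neq\emptyset$. Write $X_v=|S_v|$. For a sequence $G(n)=G(n,m(n),P(n))$, $X(n)$ denotes a random variable with law $P(n)$ and $Y(n)=(n/m)^{1/2}X(n)$. All limits are as $n\to\infty$; $o_P,O_P$ are the usual stochastic order symbols; $\omega(G)$ is the clique number. Condition (A): $\mathbb E\,Y(n)=O(1)$. Condition (PL): for the given $\alpha>0$, slowly varying $L:\mathbb R_+\to\mathbb R_+$ (i.e. $L(tx)/L(x)\to1$ as $x\to\infty$ for each $t>0$) and $\varepsilon_0\in(0,1/2)$,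 for every sequence $x_n$ with $n^{1/2-\varepsilon_0}\le x_n\le n^{1/2+\varepsilon_0}$ one has $\mathbb P(Y(n)\ge x_n)\sim L(x_n)x_n^{-\alpha}$. *)

theory Defs
  imports "HOL-Probability.Probability" "HOL-Library.Landau_Symbols"
begin

text \<open>Law of one random attribute set: size k drawn from P, then a uniform
  subset of the attribute set {0..<m} of size k. This gives
  P(S_v = S) = P(|S|) / (m choose |S|).\<close>
definition attr_pmf :: "nat \<Rightarrow> nat pmf \<Rightarrow> nat set pmf" where
  "attr_pmf m P = bind_pmf P (\<lambda>k. pmf_of_set {S. S \<subseteq> {0..<m} \<and> card S = k})"

text \<open>Random intersection graph G(n,m,P), represented by the joint law of the
  independent attribute sets (S_1,...,S_n), vertex set {1..n}.\<close>
definition rig_pmf :: "nat \<Rightarrow> nat \<Rightarrow> nat pmf \<Rightarrow> (nat \<Rightarrow> nat set) pmf" where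
  "rig_pmf n m P = Pi_pmf {1..n} {} (\<lambda>_. attr_pmf m P)"

definition rig_adj :: "(nat \<Rightarrow> nat set) \<Rightarrow> nat \<Rightarrow> nat \<Rightarrow> bool" where
  "rig_adj S u v \<longleftrightarrow> u \<noteq> v \<and> S u \<inter> S v \<noteq> {}"

definition is_clique :: "(nat \<Rightarrow> nat set) \<Rightarrow> nat set \<Rightarrow> bool" where
  "is_clique S A \<longleftrightarrow> (\<forall>u\<in>A. \<forall>v\<in>A. u \<noteq> v \<longrightarrow> rig_adj S u v)"

definition clique_number :: "nat \<Rightarrow> (nat \<Rightarrow> nat set) \<Rightarrow> nat" where
  "clique_number n S = Max (card ` {A. A \<subseteq> {1..n} \<and> is_clique S A})"

definition slowly_varying :: "(real \<Rightarrow> real) \<Rightarrow> bool" where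
  "slowly_varying L \<longleftrightarrow> (\<forall>x>0. L x > 0) \<and>
     (\<forall>t>0. ((\<lambda>x. L (t * x) / L x) \<longlongrightarrow> 1) at_top)"

definition Yval :: "nat \<Rightarrow> nat \<Rightarrow> nat \<Rightarrow> real" where
  "Yval n m k = sqrt (real n / real m) * real k"

definition condA :: "(nat \<Rightarrow> nat) \<Rightarrow> (nat \<Rightarrow> nat pmf) \<Rightarrow> bool" where
  "condA m P \<longleftrightarrow>
     (\<lambda>n. measure_pmf.expectation (P n) (\<lambda>k. Yval n (m n) k)) \<in> O(\<lambda>_. 1)"

definition condPL :: "(nat \<Rightarrow> nat) \<Rightarrow> (nat \<Rightarrow> nat pmf) \<Rightarrow> real \<Rightarrow> (real \<Rightarrow> real) \<Rightarrow> real \<Rightarrow> bool" where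
  "condPL m P \<alpha> L \<epsilon>0 \<longleftrightarrow>
     (\<forall>x :: nat \<Rightarrow> real.
        (\<forall>n. real n powr (1/2 - \<epsilon>0) \<le> x n \<and> x n \<le> real n powr (1/2 + \<epsilon>0)) \<longrightarrow>
        (\<lambda>n. measure_pmf.prob (P n) {k. Yval n (m n) k \<ge> x n})
          \<sim>[at_top] (\<lambda>n. L (x n) * x n powr (- \<alpha>)))"

definition Kfun :: "(real \<Rightarrow> real) \<Rightarrow> real \<Rightarrow> nat \<Rightarrow> real" where
  "Kfun L \<alpha> n = L (sqrt (real n * ln (real n))) * real n powr (1 - \<alpha>/2) * ln (real n) powr (- \<alpha>/2)"

end

theory Submission
  imports Defs "HOL-Real_Asymp.Real_Asymp"
begin

text \<open>
  Put \<open>\<kappa> = 1 - \<alpha>/2\<close>, so that \<open>K n = n powr (\<kappa> + o(1))\<close>. About \<open>c powr (-\<alpha>) * K n\<close> vertices have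
  \<open>Y \<ge> c * sqrt (n * ln n)\<close>, and two of them are non-adjacent with probability at most
  \<open>n powr (-c\<^sup>2)\<close>. If \<open>c\<^sup>2 > \<kappa>\<close> there are only \<open>o(K n)\<close> non-adjacent pairs, and deleting a vertex
  of each pair leaves a clique.

  For \<open>c\<^sup>2 < \<kappa>\<close> the vertices below this threshold carry no clique of order \<open>K n\<close>. With high
  probability those with \<open>Y < n powr (1/2 - \<delta>)\<close> contain no rainbow clique on \<open>r\<close> vertices (all edges
  witnessed by distinct attributes) once \<open>\<delta> * (r - 2) \<ge> 1\<close>, by a first moment bound that uses only
  \<open>E Y = O(1)\<close>, while every attribute is shared by \<open>o(K n)\<close> vertices because \<open>\<beta> > \<alpha> - 1\<close>; a random
  \<open>r\<close>-tuple of a larger clique would be rainbow. A clique of medium vertices is cut into two halves.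
  Given the attribute sets of the first half, whose pairwise intersections are small in total, a
  second moment bound shows that a random set meets all of them with probability at most
  \<open>n powr (-a)\<close>, where \<open>a > 0\<close> does not depend on \<open>\<delta>\<close>, because \<open>\<beta> > 2 - \<alpha>\<close>. For small \<open>\<delta>\<close> this
  beats the expected number of candidate sets of medium vertices, \<open>n powr (O(\<delta>) * K n)\<close>.
\<close>

subsection \<open>Probability mass functions\<close>

text \<open>Both conditions on \<beta> compare exponents with \<kappa>. A given attribute lies in
  O(sqrt (n / m)) sets on average, hence in O(n powr ((1 - \<beta>) / 2)), and (1 - \<beta>) / 2 <
  \<kappa> says \<beta> > \<alpha> - 1. The other one, \<beta> > 2 - \<alpha>, says \<beta> / 2 >
  \<kappa> and enters through a variance. A random medium set misses each of about n powr \<kappa>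
  fixed medium sets with probability at least about n powr (-\<open>c\<^sup>2\<close>). The relative
  variance of the number missed has a diagonal part, of order n powr (\<open>c\<^sup>2\<close> -
  \<kappa>), and an overlap part: two medium sets share O(ln n) attributes on average, and each
  shared attribute changes their joint miss probability by a relative amount of about n powr
  (-\<beta> / 2) at most, so this part is of order n powr (\<open>c\<^sup>2\<close> - \<beta> / 2).
  Both tend to 0. The obstacle for medium vertices is the number of candidate sets. Given the first
  half of the clique, the sets of the second half are independent, so the gain n powr (-a) is raised
  to the size of that half, the same power as the entropy of choosing both halves.\<close>

lemma measure_bind_pmf_integral:
  "measure_pmf.prob (bind_pmf M f) X = measure_pmf.expectation M (\<lambda>x. measure_pmf.prob (f x) X)"
proof -
  have "ennreal (measure_pmf.prob (bind_pmf M f) X) = emeasure (bind_pmf M f) X"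
    by (simp add: measure_pmf.emeasure_eq_measure)
  also have "\<dots> = (\<integral>\<^sup>+x. ennreal (measure_pmf.prob (f x) X) \<partial>M)"
    by (simp only: emeasure_bind_pmf) (simp add: measure_pmf.emeasure_eq_measure)
  also have "\<dots> = ennreal (measure_pmf.expectation M (\<lambda>x. measure_pmf.prob (f x) X))"
    by (intro nn_integral_eq_integral measure_pmf.integrable_const_bound[where B=1]) auto
  finally show ?thesis by (simp add: integral_nonneg)
qed

lemma measure_bind_pmf_le:
  assumes "\<And>x. x \<in> set_pmf M \<Longrightarrow> measure_pmf.prob (f x) X \<le> c * indicator A x"
  shows "measure_pmf.prob (bind_pmf M f) X \<le> c * measure_pmf.prob M A"
proof -
  have "measure_pmf.prob (bind_pmf M f) X \<le> measure_pmf.expectation M (\<lambda>x. c * indicator A x)"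
    unfolding measure_bind_pmf_integral
  proof (rule integral_mono_AE)
    show "integrable (measure_pmf M) (\<lambda>x. measure_pmf.prob (f x) X)"
      by (intro measure_pmf.integrable_const_bound[where B=1]) auto
    show "integrable (measure_pmf M) (\<lambda>x. c * indicator A x)"
      by (intro measure_pmf.integrable_const_bound[where B="\<bar>c\<bar>"]) (auto split: split_indicator)
  qed (use assms in \<open>auto simp: AE_measure_pmf_iff\<close>)
  then show ?thesis by simp
qed

text \<open>Conditioning on the block \<open>A\<close> leaves the coordinates in \<open>B\<close>
  independent. \<open>G\<close> and \<open>M\<close> may depend on the sampled block but, by
  \<open>dep\<close>, on nothing else; this lets \<open>B\<close> be tested against the random sets
  drawn in \<open>A\<close>.\<close>

lemma two_block_bound:
  fixes I :: "'a set" and p :: "'b pmf"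
  assumes fin: "finite I" and sub: "A \<subseteq> I" "B \<subseteq> I" "A \<inter> B = {}" and r: "r \<ge> 0"
    and bound: "\<And>f. (\<forall>i\<in>A. f i \<in> U) \<Longrightarrow> G f \<Longrightarrow> measure_pmf.prob p (M f) \<le> r"
    and dep: "\<And>f g. (\<forall>i\<in>A. f i = g i) \<Longrightarrow> G f = G g \<and> M f = M g"
  shows "measure_pmf.prob (Pi_pmf I d (\<lambda>_. p))
           {f. (\<forall>i\<in>A. f i \<in> U) \<and> G f \<and> (\<forall>j\<in>B. f j \<in> M f)}
         \<le> measure_pmf.prob p U ^ card A * r ^ card B"
proof -
  define C where "C = I - A"
  have finA: "finite A" and finC: "finite C" using fin sub by (auto simp: C_def intro: finite_subset)
  have I: "I = A \<union> C" and disj: "A \<inter> C = {}" and BC: "B \<subseteq> C" using sub by (auto simp: C_def)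
  let ?E = "{f. (\<forall>i\<in>A. f i \<in> U) \<and> G f \<and> (\<forall>j\<in>B. f j \<in> M f)}"
  let ?PA = "Pi_pmf A d (\<lambda>_. p)" and ?PC = "Pi_pmf C d (\<lambda>_. p)"
  let ?j = "\<lambda>f g x. if x \<in> A then f x else g x"
  have eq: "Pi_pmf I d (\<lambda>_. p) = bind_pmf ?PA (\<lambda>f. map_pmf (?j f) ?PC)"
    unfolding I Pi_pmf_union[OF finA finC disj]
    by (simp add: pair_pmf_def map_bind_pmf map_pmf_def bind_assoc_pmf bind_return_pmf)
  have "measure_pmf.prob (Pi_pmf I d (\<lambda>_. p)) ?E \<le> r ^ card B * measure_pmf.prob ?PA (Pi A (\<lambda>_. U))"
    unfolding eq
  proof (rule measure_bind_pmf_le)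
    fix f
    have j: "(\<forall>i\<in>A. ?j f g i = f i)" for g :: "'a \<Rightarrow> 'b" by simp
    have GM: "G (?j f g) = G f" "M (?j f g) = M f" for g :: "'a \<Rightarrow> 'b" using dep[OF j] by auto
    show "measure_pmf.prob (map_pmf (?j f) ?PC) ?E \<le> r ^ card B * indicator (Pi A (\<lambda>_. U)) f"
    proof (cases "(\<forall>i\<in>A. f i \<in> U) \<and> G f")
      case True
      have "measure_pmf.prob (map_pmf (?j f) ?PC) ?E \<le> measure_pmf.prob ?PC (Pi C (\<lambda>j. if j \<in> B then M f else UNIV))"
        using BC disj GM by (auto intro!: measure_pmf.finite_measure_mono split: if_splits)
      also have "\<dots> = (\<Prod>x\<in>C. if x \<in> B then measure_pmf.prob p (M f) else 1)"
        by (subst measure_Pi_pmf_Pi[OF finC]) (auto intro!: prod.cong)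
      also have "\<dots> = measure_pmf.prob p (M f) ^ card B"
        using BC finC by (subst prod.If_cases) (auto simp: Int_absorb1)
      also have "\<dots> \<le> r ^ card B" using bound True by (intro power_mono) auto
      finally show ?thesis using True by auto
    next
      case False
      have "?j f -` ?E = {}" using False GM(1) by auto
      then have "measure_pmf.prob (map_pmf (?j f) ?PC) ?E = 0"
        by (metis measure_map_pmf measure_empty)
      then show ?thesis using r by simp
    qed
  qed
  also have "measure_pmf.prob ?PA (Pi A (\<lambda>_. U)) = measure_pmf.prob p U ^ card A"
    by (simp add: measure_Pi_pmf_Pi finA)
  finally show ?thesis by (simp add: mult.commute)
qed

lemma markov_count:
  assumes "finite I" "a > 0"
  shows "measure_pmf.prob M {S. real (card {x\<in>I. R x S}) \<ge> a} \<le> (\<Sum>x\<in>I. measure_pmf.prob M {S. R x S}) / a"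
proof -
  let ?u = "\<lambda>S. \<Sum>x\<in>I. indicator {S. R x S} S :: real"
  have u: "?u S = real (card {x\<in>I. R x S})" for S
    using assms by (simp add: indicator_def sum.If_cases Int_def)
  have int: "integrable M (indicator {S. R x S} :: _ \<Rightarrow> real)" for x
    by (intro measure_pmf.integrable_const_bound[where B=1]) auto
  have "measure_pmf.prob M {S\<in>space M. ?u S \<ge> a} \<le> measure_pmf.expectation M ?u / a"
    using assms int by (intro integral_Markov_inequality_measure[where A="UNIV"]) (auto intro!: sum_nonneg)
  also have "measure_pmf.expectation M ?u = (\<Sum>x\<in>I. measure_pmf.prob M {S. R x S})"
    using int by (subst Bochner_Integration.integral_sum) auto
  finally show ?thesis unfolding u by simp
qed

lemma union_count:
  assumes "finite I"
  shows "measure_pmf.prob M {S. \<exists>x\<in>I. R x S} \<le> (\<Sum>x\<in>I. measure_pmf.prob M {S. R x S})"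
proof -
  have "{S. \<exists>x\<in>I. R x S} = (\<Union>x\<in>I. {S. R x S})" by auto
  then show ?thesis using assms by (simp add: measure_pmf.finite_measure_subadditive_finite)
qed

text \<open>The variance is kept as a double sum of covariances. It serves independent events, where
  only the diagonal survives, as well as the dependent events of missing several fixed sets.\<close>

lemma weighted_chebyshev:
  fixes c :: "'a \<Rightarrow> real" and M :: "'b pmf" and R :: "'a \<Rightarrow> 'b \<Rightarrow> bool"
  assumes "finite I" "a > 0"
  defines "p \<equiv> \<lambda>x. measure_pmf.prob M {S. R x S}"
  shows "measure_pmf.prob M {S. \<bar>(\<Sum>x\<in>I. c x * of_bool (R x S)) - (\<Sum>x\<in>I. c x * p x)\<bar> \<ge> a}
     \<le> (\<Sum>x\<in>I. \<Sum>y\<in>I. c x * c y * (measure_pmf.prob M {S. R x S \<and> R y S} - p x * p y)) / a\<^sup>2"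
proof -
  let ?f = "\<lambda>x S. c x * (of_bool (R x S) - p x)"
  let ?g = "\<lambda>x y S. c x * c y * (of_bool (R x S \<and> R y S) - p x * of_bool (R y S) - p y * of_bool (R x S) + p x * p y)"
  have int: "integrable M (\<lambda>S. of_bool (Q S) :: real)" for Q
    by (intro measure_pmf.integrable_const_bound[where B=1]) auto
  have E: "measure_pmf.expectation M (\<lambda>S. of_bool (Q S) :: real) = measure_pmf.prob M {S. Q S}" for Q
  proof -
    have "(\<lambda>S. of_bool (Q S) :: real) = indicator {S. Q S}" by (auto simp: indicator_def)
    then show ?thesis by simp
  qed
  have intg: "integrable M (?g x y)" for x y
    by (intro integrable_mult_right Bochner_Integration.integrable_add Bochner_Integration.integrable_diff int) auto
  have sq: "((\<Sum>x\<in>I. c x * of_bool (R x S)) - (\<Sum>x\<in>I. c x * p x))\<^sup>2 = (\<Sum>x\<in>I. \<Sum>y\<in>I. ?g x y S)" for S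
  proof -
    have "((\<Sum>x\<in>I. c x * of_bool (R x S)) - (\<Sum>x\<in>I. c x * p x))\<^sup>2 = (\<Sum>x\<in>I. \<Sum>y\<in>I. ?f x S * ?f y S)"
      unfolding power2_eq_square sum_subtractf[symmetric] sum_product by (simp add: algebra_simps)
    also have "\<dots> = (\<Sum>x\<in>I. \<Sum>y\<in>I. ?g x y S)"
      by (intro sum.cong refl) (auto simp: algebra_simps)
    finally show ?thesis .
  qed
  have nn: "0 \<le> (\<Sum>x\<in>I. \<Sum>y\<in>I. ?g x y S)" for S unfolding sq[symmetric] by simp
  have "measure_pmf.prob M {S\<in>space M. (\<Sum>x\<in>I. \<Sum>y\<in>I. ?g x y S) \<ge> a\<^sup>2}
        \<le> measure_pmf.expectation M (\<lambda>S. \<Sum>x\<in>I. \<Sum>y\<in>I. ?g x y S) / a\<^sup>2"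
    using assms intg by (intro integral_Markov_inequality_measure[where A="UNIV"])
      (use nn in \<open>auto intro!: Bochner_Integration.integrable_sum simp del: of_bool_conj\<close>)
  also have "measure_pmf.expectation M (\<lambda>S. \<Sum>x\<in>I. \<Sum>y\<in>I. ?g x y S) =
      (\<Sum>x\<in>I. \<Sum>y\<in>I. c x * c y * (measure_pmf.prob M {S. R x S \<and> R y S} - p x * p y))"
    by (simp add: Bochner_Integration.integral_sum Bochner_Integration.integrable_sum intg
       Bochner_Integration.integral_add Bochner_Integration.integral_diff int E p_def[symmetric] del: of_bool_conj)
       (simp add: p_def algebra_simps)
  also have "{S\<in>space M. (\<Sum>x\<in>I. \<Sum>y\<in>I. ?g x y S) \<ge> a\<^sup>2} =
       {S. \<bar>(\<Sum>x\<in>I. c x * of_bool (R x S)) - (\<Sum>x\<in>I. c x * p x)\<bar> \<ge> a}"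
    unfolding sq[symmetric] using assms abs_le_square_iff[of a] by auto
  finally show ?thesis .
qed

lemma prob_Pi_pmf_inj:
  assumes fin: "finite I" "finite J" and f: "inj_on f J" "f ` J \<subseteq> I"
  shows "measure_pmf.prob (Pi_pmf I d (\<lambda>_. p)) {S. \<forall>j\<in>J. S (f j) \<in> B j} = (\<Prod>j\<in>J. measure_pmf.prob p (B j))"
proof -
  let ?g = "the_inv_into J f"
  have g: "?g (f j) = j" if "j \<in> J" for j using the_inv_into_f_f[OF f(1) that] .
  have "{S. \<forall>j\<in>J. S (f j) \<in> B j} = Pi I (\<lambda>v. if v \<in> f ` J then B (?g v) else UNIV)"
    using f(2) by (fastforce simp: Pi_def g)
  then have "measure_pmf.prob (Pi_pmf I d (\<lambda>_. p)) {S. \<forall>j\<in>J. S (f j) \<in> B j} =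
      (\<Prod>v\<in>I. measure_pmf.prob p (if v \<in> f ` J then B (?g v) else UNIV))"
    by (simp add: measure_Pi_pmf_Pi fin)
  also have "\<dots> = (\<Prod>v\<in>f ` J. measure_pmf.prob p (if v \<in> f ` J then B (?g v) else UNIV))"
    using fin f(2) by (intro prod.mono_neutral_right) auto
  also have "\<dots> = (\<Prod>j\<in>J. measure_pmf.prob p (B j))"
    using f(1) by (subst prod.reindex) (auto intro!: prod.cong simp: g)
  finally show ?thesis .
qed

subsection \<open>Uniformly random subsets of fixed size\<close>

definition ksub :: "nat \<Rightarrow> nat \<Rightarrow> nat set pmf" where
  "ksub m k = pmf_of_set {S. S \<subseteq> {0..<m} \<and> card S = k}"

lemma ksub_carrier:
  assumes "k \<le> m"
  shows "finite {S. S \<subseteq> {0..<m} \<and> card S = k}" "{S. S \<subseteq> {0..<m} \<and> card S = k} \<noteq> {}"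
proof -
  show fin: "finite {S. S \<subseteq> {0..<m} \<and> card S = k}" by (rule finite_subset[of _ "Pow {0..<m}"]) auto
  have "card {S. S \<subseteq> {0..<m} \<and> card S = k} = m choose k" by (subst n_subsets) auto
  moreover have "0 < m choose k" using assms by simp
  ultimately show "{S. S \<subseteq> {0..<m} \<and> card S = k} \<noteq> {}" by (metis card.empty less_irrefl)
qed

lemma prob_ksub:
  assumes "k \<le> m"
  shows "measure_pmf.prob (ksub m k) X = real (card {S. S \<subseteq> {0..<m} \<and> card S = k \<and> S \<in> X}) / real (m choose k)"
proof -
  have "{S. S \<subseteq> {0..<m} \<and> card S = k} \<inter> X = {S. S \<subseteq> {0..<m} \<and> card S = k \<and> S \<in> X}" by auto
  then show ?thesis
    unfolding ksub_def using ksub_carrier[OF assms] by (simp add: measure_pmf_of_set n_subsets)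
qed

lemma set_ksub: "k \<le> m \<Longrightarrow> set_pmf (ksub m k) = {S. S \<subseteq> {0..<m} \<and> card S = k}"
  unfolding ksub_def using ksub_carrier by simp

lemma choose_ratio_le:
  assumes "c \<le> k" "k \<le> m"
  shows "real (k choose c) / real (m choose c) \<le> (real k / real m) ^ c"
proof -
  have "real (k choose c) / real (m choose c) = (\<Prod>i=0..<c. real (k - i) / real (m - i))"
    using assms by (simp add: binomial_altdef_of_nat flip: prod_dividef)
  also have "\<dots> \<le> (\<Prod>i=0..<c. real k / real m)"
  proof (rule prod_mono, safe)
    fix i assume "i \<in> {0..<c}"
    then have i: "i < k" "i < m" using assms by auto
    have "(real k - real i) * real m \<le> real k * (real m - real i)"
      using assms by (simp add: algebra_simps mult_left_mono)
    then show "real (k - i) / real (m - i) \<le> real k / real m"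
      using i by (simp add: of_nat_diff divide_simps mult.commute)
  qed simp
  finally show ?thesis by simp
qed

lemma prob_ksub_contain:
  assumes "k \<le> m" "C \<subseteq> {0..<m}"
  shows "measure_pmf.prob (ksub m k) {S. C \<subseteq> S} \<le> (real k / real m) ^ card C"
proof (cases "card C \<le> k")
  case True
  have finC: "finite C" using assms finite_subset by blast
  have cm: "card C \<le> m" using card_mono[OF _ assms(2)] by simp
  let ?c = "card C"
  have "card {S. S \<subseteq> {0..<m} \<and> card S = k \<and> C \<subseteq> S} \<le> card {S. S \<subseteq> {0..<m} - C \<and> card S = k - ?c}"
  proof (rule card_inj_on_le[where f="\<lambda>S. S - C"])
    show "inj_on (\<lambda>S. S - C) {S. S \<subseteq> {0..<m} \<and> card S = k \<and> C \<subseteq> S}"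
      by (auto simp: inj_on_def)
    show "(\<lambda>S. S - C) ` {S. S \<subseteq> {0..<m} \<and> card S = k \<and> C \<subseteq> S} \<subseteq> {S. S \<subseteq> {0..<m} - C \<and> card S = k - ?c}"
      using finC by (auto simp: card_Diff_subset)
    show "finite {S. S \<subseteq> {0..<m} - C \<and> card S = k - ?c}"
      by (rule finite_subset[of _ "Pow {0..<m}"]) auto
  qed
  also have "\<dots> = (m - ?c) choose (k - ?c)"
    using assms finC by (subst n_subsets) (auto simp: card_Diff_subset)
  finally have "measure_pmf.prob (ksub m k) {S. C \<subseteq> S} \<le> real ((m - ?c) choose (k - ?c)) / real (m choose k)"
    unfolding prob_ksub[OF assms(1)] by (simp add: divide_right_mono)
  also have "\<dots> = real (k choose ?c) / real (m choose ?c)"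
  proof -
    have "(m choose k) * (k choose ?c) = (m choose ?c) * ((m - ?c) choose (k - ?c))"
      using choose_mult[of ?c k m] True assms by simp
    then have "real (m choose k) * real (k choose ?c) = real (m choose ?c) * real ((m - ?c) choose (k - ?c))"
      by (metis of_nat_mult)
    moreover have "real (m choose k) > 0" "real (m choose ?c) > 0" using assms cm by auto
    ultimately show ?thesis by (simp add: divide_simps mult.commute)
  qed
  also have "\<dots> \<le> (real k / real m) ^ ?c" using choose_ratio_le True assms by simp
  finally show ?thesis .
next
  case False
  have "{S. S \<subseteq> {0..<m} \<and> card S = k \<and> C \<subseteq> S} = {}"
    using False by (auto dest: card_mono[OF finite_subset[of _ "{0..<m}"]])
  then have "measure_pmf.prob (ksub m k) {S. C \<subseteq> S} = 0"
    unfolding prob_ksub[OF assms(1)] by simp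
  then show ?thesis by simp
qed

section \<open>Avoiding a fixed set\<close>

definition miss_prob :: "nat \<Rightarrow> nat \<Rightarrow> nat \<Rightarrow> real" where
  "miss_prob m k a = real ((m - a) choose k) / real (m choose k)"

lemma prob_ksub_miss:
  assumes "k \<le> m" "C \<subseteq> {0..<m}"
  shows "measure_pmf.prob (ksub m k) {S. S \<inter> C = {}} = miss_prob m k (card C)"
proof -
  have finC: "finite C" using assms finite_subset by blast
  have "{S. S \<subseteq> {0..<m} \<and> card S = k \<and> S \<in> {S. S \<inter> C = {}}} = {S. S \<subseteq> {0..<m} - C \<and> card S = k}" by auto
  then show ?thesis
    unfolding prob_ksub[OF assms(1)] miss_prob_def using assms finC
    by (simp add: n_subsets card_Diff_subset)
qed

lemma miss_prob_prod:
  assumes "a + k \<le> m"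
  shows "miss_prob m k a = (\<Prod>i=0..<k. (real m - real a - real i) / (real m - real i))"
  using assms unfolding miss_prob_def
  by (auto simp: binomial_altdef_of_nat simp flip: prod_dividef intro!: prod.cong)

lemma miss_prob_le_exp:
  assumes "k \<le> m" "a \<le> m"
  shows "miss_prob m k a \<le> exp (- (real a * real k / real m))"
proof (cases "a + k \<le> m \<and> m > 0")
  case True
  have "miss_prob m k a \<le> (\<Prod>i=0..<k. exp (- (real a / real m)))"
    unfolding miss_prob_prod[OF conjunct1[OF True]]
  proof (rule prod_mono, safe)
    fix i assume "i \<in> {0..<k}"
    then have i: "real a + real i < real m" using True by simp
    show "0 \<le> (real m - real a - real i) / (real m - real i)" using i by simp
    have "(real m - real a - real i) / (real m - real i) \<le> 1 - real a / real m"
      using i True by (simp add: divide_simps) (simp add: algebra_simps)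
    also have "\<dots> \<le> exp (- (real a / real m))" using exp_ge_add_one_self[of "- (real a / real m)"] by simp
    finally show "(real m - real a - real i) / (real m - real i) \<le> exp (- (real a / real m))" .
  qed
  also have "\<dots> = exp (- (real a * real k / real m))"
    by (simp add: mult.commute flip: exp_of_nat_mult)
  finally show ?thesis .
next
  case False
  then have "m = 0 \<or> m - a < k" using assms by linarith
  then show ?thesis using assms by (auto simp: miss_prob_def binomial_eq_0)
qed

lemma miss_prob_ge_exp:
  assumes "a \<le> b" "k \<le> b" "2 * b < m"
  shows "miss_prob m k a \<ge> exp (- (real b ^ 2 / (real m - 2 * real b)))"
proof -
  have pos: "real m - 2 * real b > 0" using assms by linarith
  have ak: "a + k \<le> m" using assms by linarith
  have "exp (- (real b ^ 2 / (real m - 2 * real b))) \<le> exp (real k * - (real b / (real m - 2 * real b)))"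
    using assms pos by (simp add: power2_eq_square divide_right_mono mult_right_mono)
  also have "\<dots> = (\<Prod>i=0..<k. exp (- (real b / (real m - 2 * real b))))"
    by (simp flip: exp_of_nat_mult)
  also have "\<dots> \<le> miss_prob m k a"
    unfolding miss_prob_prod[OF ak]
  proof (rule prod_mono, safe)
    fix i assume "i \<in> {0..<k}"
    then have i: "real i < real b" using assms by simp
    have ab: "real a \<le> real b" using assms by simp
    \<comment> \<open>With this \<open>u\<close>, 1 / (1 + u) is exactly 1 - b / (m - b), which lies
      below every factor of the product because \<open>a\<close> and \<open>i\<close> are at most
      \<open>b\<close>.\<close>
    define u where "u = real b / (real m - 2 * real b)"
    have u: "u \<ge> 0" using pos by (simp add: u_def)
    have "exp (- u) = 1 / exp u" by (simp add: exp_minus divide_inverse)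
    also have "\<dots> \<le> 1 / (1 + u)" using u exp_ge_add_one_self[of u] by (intro divide_left_mono) (auto intro: add_pos_nonneg)
    also have "\<dots> = 1 - real b / (real m - real b)" using pos by (simp add: u_def divide_simps)
    also have "\<dots> \<le> 1 - real a / (real m - real i)"
      using i ab pos by (simp add: frac_le)
    also have "\<dots> = (real m - real a - real i) / (real m - real i)"
      using i pos by (simp add: divide_simps)
    finally show "exp (- (real b / (real m - 2 * real b))) \<le> (real m - real a - real i) / (real m - real i)"
      unfolding u_def .
  qed simp
  finally show ?thesis .
qed

text \<open>Avoiding two disjoint sets is negatively correlated, so only the \<open>t\<close> common
  elements can push the joint probability above the product, each of the \<open>k\<close> factors
  gaining at most exp (2 * t / m).\<close>

lemma miss_prob_joint:
  assumes "a \<le> b" "a' \<le> b" "k \<le> b" "8 * b \<le> m" "t \<le> a" "t \<le> a'" "m > 0"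
  shows "miss_prob m k (a + a' - t) \<le> miss_prob m k a * miss_prob m k a' * exp (2 * real b * real t / real m)"
proof -
  have b: "real a \<le> real b" "real a' \<le> real b" "real k \<le> real b" "8 * real b \<le> real m" "real t \<le> real a"
    "real t \<le> real a'" "real m > 0"
    using assms by linarith+
  have le: "a + a' - t + k \<le> m" "a + k \<le> m" "a' + k \<le> m" using assms by linarith+
  have "miss_prob m k (a + a' - t) \<le> (\<Prod>i=0..<k. ((real m - real a - real i) / (real m - real i)) *
      ((real m - real a' - real i) / (real m - real i)) * exp (2 * real t / real m))"
    unfolding miss_prob_prod[OF le(1)]
  proof (rule prod_mono, safe)
    fix i assume "i \<in> {0..<k}"
    then have i: "real i \<le> real b" using assms by simp
    have aat: "real (a + a' - t) = real a + real a' - real t" using assms by (simp add: of_nat_diff)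
    show "0 \<le> (real m - real (a + a' - t) - real i) / (real m - real i)"
      unfolding aat using b i by (intro divide_nonneg_nonneg) linarith+
    define M where "M = real m - real i"
    have M: "M > 0" "M - real a \<ge> 3/4 * real m" "M - real a' \<ge> 3/4 * real m" "M \<le> real m"
      using b i unfolding M_def by linarith+
    have pos: "M - real a > 0" "M - real a' > 0" using M b by linarith+
    have "M * (M - real a - real a' + real t) \<le> (M - real a) * (M - real a') + M * real t"
      by (simp add: algebra_simps)
    \<comment> \<open>Since 8 * b \<le> m, both factors are at least 3/4 * m, and 2 * (3/4)^2 = 9/8
      exceeds 1; this is where the 2 in the exponent comes from.\<close>
    also have "M * real t \<le> (M - real a) * (M - real a') * (2 * real t / real m)"
    proof -
      have "(3/4 * real m) * (3/4 * real m) \<le> (M - real a) * (M - real a')"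
        using M b by (intro mult_mono) auto
      then have "(3/4 * real m) * (3/4 * real m) * (2 * real t / real m) \<le> (M - real a) * (M - real a') * (2 * real t / real m)"
        by (intro mult_right_mono) auto
      moreover have "(3/4 * real m) * (3/4 * real m) * (2 * real t / real m) = 9/8 * (real m * real t)"
        using b by (simp add: field_simps)
      moreover have "M * real t \<le> real m * real t" using M by (intro mult_right_mono) auto
      moreover have "0 \<le> real m * real t" by simp
      ultimately show ?thesis by linarith
    qed
    finally have "M * (M - real a - real a' + real t) \<le> (M - real a) * (M - real a') * (1 + 2 * real t / real m)"
      by (simp add: algebra_simps)
    also have "\<dots> \<le> (M - real a) * (M - real a') * exp (2 * real t / real m)"
      using pos exp_ge_add_one_self[of "2 * real t / real m"] by (intro mult_left_mono) auto
    finally have "(M - real a - real a' + real t) / M \<le> ((M - real a) / M) * ((M - real a') / M) * exp (2 * real t / real m)"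
      using M by (simp add: divide_simps mult_ac)
    then show "(real m - real (a + a' - t) - real i) / (real m - real i) \<le> ((real m - real a - real i) / (real m - real i)) *
      ((real m - real a' - real i) / (real m - real i)) * exp (2 * real t / real m)"
      unfolding aat M_def by (simp add: algebra_simps)
  qed
  also have "\<dots> = miss_prob m k a * miss_prob m k a' * exp (real k * (2 * real t / real m))"
    unfolding miss_prob_prod[OF le(2)] miss_prob_prod[OF le(3)] prod.distrib by (simp flip: exp_of_nat_mult)
  also have "\<dots> \<le> miss_prob m k a * miss_prob m k a' * exp (2 * real b * real t / real m)"
    using b by (intro mult_left_mono) (auto simp: miss_prob_def divide_right_mono mult_right_mono)
  finally show ?thesis .
qed

text \<open>Second moment bound for the weighted number of missed sets; the weights
  \<open>1 / miss_prob m k (card (f i))\<close> make the mean equal to \<open>card I\<close>.\<close>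
lemma prob_ksub_hit_all:
  assumes fin: "finite I" "I \<noteq> {}" and f: "\<And>i. i \<in> I \<Longrightarrow> f i \<subseteq> {0..<m} \<and> card (f i) \<le> b"
    and k: "k \<le> b" and m: "8 * b \<le> m" "m > 0"
    and B: "(\<Sum>i\<in>I. \<Sum>l\<in>I-{i}. real (card (f i \<inter> f l))) \<le> B"
    and q: "0 < q" "q \<le> exp (- (real b ^ 2 / (real m - 2 * real b)))"
  shows "measure_pmf.prob (ksub m k) {S. \<forall>i\<in>I. S \<inter> f i \<noteq> {}}
     \<le> 1 / (real (card I) * q) + 4 * real b * B / (real m * q * real (card I) ^ 2)"
proof -
  define h where "h = real (card I)"
  have h: "h > 0" using fin by (simp add: h_def card_gt_0_iff)
  have km: "k \<le> m" using k m by linarith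
  define p where "p = (\<lambda>i. measure_pmf.prob (ksub m k) {S. S \<inter> f i = {}})"
  have p_eq: "p i = miss_prob m k (card (f i))" if "i \<in> I" for i
    using prob_ksub_miss[OF km] f[OF that] by (simp add: p_def)
  have qp: "q \<le> p i" if "i \<in> I" for i
  proof -
    have "exp (- (real b ^ 2 / (real m - 2 * real b))) \<le> p i"
      unfolding p_eq[OF that] using f[OF that] k m by (intro miss_prob_ge_exp) auto
    then show ?thesis using q by simp
  qed
  have p_pos: "p i > 0" if "i \<in> I" for i using qp[OF that] q by simp
  define P2 where "P2 = (\<lambda>i l. measure_pmf.prob (ksub m k) {S. S \<inter> f i = {} \<and> S \<inter> f l = {}})"
  define t where "t = (\<lambda>i l. real (card (f i \<inter> f l)))"
  have P2_le: "P2 i l \<le> p i" "P2 i l \<le> p l" for i l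
    unfolding P2_def p_def by (auto intro!: measure_pmf.finite_measure_mono)
  have crude: "P2 i l / (p i * p l) \<le> 1 / q" if "i \<in> I" "l \<in> I" for i l
  proof -
    have "P2 i l / (p i * p l) \<le> p i / (p i * p l)"
      using P2_le p_pos[OF that(1)] p_pos[OF that(2)] by (intro divide_right_mono) auto
    also have "\<dots> = 1 / p l" using p_pos[OF that(1)] by simp
    also have "\<dots> \<le> 1 / q" using qp[OF that(2)] q by (simp add: frac_le)
    finally show ?thesis .
  qed
  \<comment> \<open>The joint bound exp z is linearised for z \<le> 1. For z > 1 the exponential is
    too weak, but then the crude bound 1 / q is already below 2 * z / q.\<close>
  have cov: "P2 i l / (p i * p l) - 1 \<le> 4 * real b / (real m * q) * t i l" if il: "i \<in> I" "l \<in> I" for i l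
  proof -
    define z where "z = 2 * real b * t i l / real m"
    have z0: "z \<ge> 0" by (simp add: z_def t_def)
    have q1: "q \<le> 1" using qp[OF il(1)] measure_pmf.prob_le_1 unfolding p_def by (meson order_trans)
    have finf: "finite (f i)" "finite (f l)" using f il finite_subset by blast+
    have "{S. S \<inter> f i = {} \<and> S \<inter> f l = {}} = {S. S \<inter> (f i \<union> f l) = {}}" by auto
    then have "P2 i l = miss_prob m k (card (f i \<union> f l))"
      using prob_ksub_miss[OF km, of "f i \<union> f l"] f il by (simp add: P2_def)
    also have "card (f i \<union> f l) = card (f i) + card (f l) - card (f i \<inter> f l)"
      using card_Un_Int[OF finf] by simp
    also have "miss_prob m k \<dots> \<le> p i * p l * exp z"
      unfolding p_eq[OF il(1)] p_eq[OF il(2)] z_def t_def using f il k m finf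
      by (intro miss_prob_joint) (auto intro: card_mono)
    finally have "P2 i l / (p i * p l) \<le> exp z"
      using p_pos[OF il(1)] p_pos[OF il(2)] by (simp add: divide_simps mult_ac)
    moreover have "P2 i l / (p i * p l) \<le> 1 / q" using crude il by blast
    moreover have "exp z \<le> 1 + 2 * z" if "z \<le> 1"
    proof -
      have "exp z \<le> 1 + z + z\<^sup>2" using z0 that by (intro exp_bound)
      moreover have "z\<^sup>2 \<le> z" unfolding power2_eq_square by (rule mult_left_le[OF that z0])
      ultimately show ?thesis by linarith
    qed
    moreover have "2 * z \<le> 2 * z / q" using q q1 z0 by (simp add: le_divide_eq mult_left_le)
    moreover have "1 / q \<le> 2 * z / q" if "z > 1" using that q by (intro divide_right_mono) auto
    ultimately have "P2 i l / (p i * p l) - 1 \<le> 2 * z / q" by (cases "z \<le> 1") linarith+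
    then show ?thesis by (simp add: z_def mult_ac)
  qed
  let ?c = "\<lambda>i. 1 / p i"
  have mean: "(\<Sum>i\<in>I. ?c i * p i) = h" using p_pos by (simp add: h_def less_imp_neq[symmetric])
  \<comment> \<open>A set that hits every \<open>f i\<close> makes the weighted count 0, so it
    deviates from its mean \<open>h\<close> by the full amount \<open>h\<close>.\<close>
  have "measure_pmf.prob (ksub m k) {S. \<forall>i\<in>I. S \<inter> f i \<noteq> {}}
    \<le> measure_pmf.prob (ksub m k) {S. \<bar>(\<Sum>i\<in>I. ?c i * of_bool (S \<inter> f i = {})) - (\<Sum>i\<in>I. ?c i * p i)\<bar> \<ge> h}"
    unfolding mean using h by (intro measure_pmf.finite_measure_mono) auto
  also have "\<dots> \<le> (\<Sum>i\<in>I. \<Sum>l\<in>I. ?c i * ?c l * (P2 i l - p i * p l)) / h\<^sup>2"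
    unfolding P2_def p_def by (rule weighted_chebyshev[OF fin(1) h])
  also have "(\<Sum>i\<in>I. \<Sum>l\<in>I. ?c i * ?c l * (P2 i l - p i * p l)) \<le>
      (\<Sum>i\<in>I. 1 / q + (\<Sum>l\<in>I-{i}. 4 * real b / (real m * q) * t i l))"
  proof (rule sum_mono)
    fix i assume i: "i \<in> I"
    have eq: "?c i * ?c l * (P2 i l - p i * p l) = P2 i l / (p i * p l) - 1" if "l \<in> I" for l
      using p_pos[OF i] p_pos[OF that] by (simp add: divide_simps)
    have "(\<Sum>l\<in>I. ?c i * ?c l * (P2 i l - p i * p l)) = (\<Sum>l\<in>I. P2 i l / (p i * p l) - 1)"
      using eq by (intro sum.cong) auto
    also have "\<dots> = (P2 i i / (p i * p i) - 1) + (\<Sum>l\<in>I-{i}. P2 i l / (p i * p l) - 1)"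
      using fin i by (simp add: sum.remove)
    also have "\<dots> \<le> 1 / q + (\<Sum>l\<in>I-{i}. 4 * real b / (real m * q) * t i l)"
      using crude[OF i i] cov[OF i] by (intro add_mono sum_mono) auto
    finally show "(\<Sum>l\<in>I. ?c i * ?c l * (P2 i l - p i * p l)) \<le> 1 / q + (\<Sum>l\<in>I-{i}. 4 * real b / (real m * q) * t i l)" .
  qed
  also have "\<dots> = h / q + 4 * real b / (real m * q) * (\<Sum>i\<in>I. \<Sum>l\<in>I-{i}. t i l)"
    by (simp add: sum.distrib h_def sum_distrib_left)
  also have "\<dots> \<le> h / q + 4 * real b / (real m * q) * B"
    using B q by (intro add_left_mono mult_left_mono) (auto simp: t_def)
  finally have "measure_pmf.prob (ksub m k) {S. \<forall>i\<in>I. S \<inter> f i \<noteq> {}} \<le> (h / q + 4 * real b / (real m * q) * B) / h\<^sup>2"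
    by (simp add: divide_right_mono)
  also have "\<dots> = 1 / (h * q) + 4 * real b * B / (real m * q * h\<^sup>2)"
    using h by (simp add: add_divide_distrib power2_eq_square mult_ac)
  finally show ?thesis unfolding h_def .
qed

section \<open>Law of a single attribute set\<close>

lemma attr_pmf_ksub: "attr_pmf m P = bind_pmf P (ksub m)"
  by (simp add: attr_pmf_def ksub_def[abs_def])

text \<open>The size condition stays inside the event so that the factor
  \<open>measure_pmf.prob P K\<close> survives next to the conditional bound \<open>c\<close>; the
  union bounds over vertex sets need one such factor for each vertex.\<close>

lemma prob_attr_le:
  assumes supp: "set_pmf P \<subseteq> {0..m}"
    and c: "\<And>k. k \<in> K \<Longrightarrow> k \<le> m \<Longrightarrow> measure_pmf.prob (ksub m k) X \<le> c"
  shows "measure_pmf.prob (attr_pmf m P) {S. S \<subseteq> {0..<m} \<and> card S \<in> K \<and> S \<in> X} \<le> c * measure_pmf.prob P K"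
  unfolding attr_pmf_ksub
proof (rule measure_bind_pmf_le)
  fix k assume "k \<in> set_pmf P"
  then have km: "k \<le> m" using supp by auto
  let ?E = "{S. S \<subseteq> {0..<m} \<and> card S \<in> K \<and> S \<in> X}"
  show "measure_pmf.prob (ksub m k) ?E \<le> c * indicator K k"
  proof (cases "k \<in> K")
    case True
    have "measure_pmf.prob (ksub m k) ?E \<le> measure_pmf.prob (ksub m k) X"
      by (rule measure_pmf.finite_measure_mono) auto
    then show ?thesis using c[OF True km] True by simp
  next
    case False
    have "measure_pmf.prob (ksub m k) ?E = 0"
      unfolding measure_pmf_zero_iff using set_ksub[OF km] False by auto
    then show ?thesis using False by simp
  qed
qed

lemma prob_attr_card:
  assumes supp: "set_pmf P \<subseteq> {0..m}"
  shows "measure_pmf.prob (attr_pmf m P) {S. S \<subseteq> {0..<m} \<and> card S \<in> K} = measure_pmf.prob P K"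
proof -
  have "measure_pmf.prob (attr_pmf m P) {S. S \<subseteq> {0..<m} \<and> card S \<in> K} = measure_pmf.expectation P (indicator K)"
    unfolding attr_pmf_ksub measure_bind_pmf_integral
  proof (rule integral_cong_AE, simp, simp, unfold AE_measure_pmf_iff, rule ballI)
    fix k assume "k \<in> set_pmf P"
    then have km: "k \<le> m" using supp by auto
    show "measure_pmf.prob (ksub m k) {S. S \<subseteq> {0..<m} \<and> card S \<in> K} = indicator K k"
    proof (cases "k \<in> K")
      case True
      then have "measure_pmf.prob (ksub m k) {S. S \<subseteq> {0..<m} \<and> card S \<in> K} = 1"
        using set_ksub[OF km]
        by (subst measure_pmf.prob_eq_1) (auto simp: AE_measure_pmf_iff)
      then show ?thesis using True by simp
    next
      case False
      then have "measure_pmf.prob (ksub m k) {S. S \<subseteq> {0..<m} \<and> card S \<in> K} = 0"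
        unfolding measure_pmf_zero_iff using set_ksub[OF km] by auto
      then show ?thesis using False by simp
    qed
  qed
  then show ?thesis by simp
qed

lemma prob_attr_contain:
  assumes supp: "set_pmf P \<subseteq> {0..m}" and C: "C \<subseteq> {0..<m}"
  shows "measure_pmf.prob (attr_pmf m P) {S. C \<subseteq> S \<and> card S \<in> K}
    \<le> measure_pmf.expectation P (\<lambda>k. (real k / real m) ^ card C * indicator K k)"
  unfolding attr_pmf_ksub measure_bind_pmf_integral
proof (rule integral_mono_AE)
  have "finite (set_pmf P)" using supp finite_subset by blast
  then show "integrable P (\<lambda>k. measure_pmf.prob (ksub m k) {S. C \<subseteq> S \<and> card S \<in> K})"
    "integrable P (\<lambda>k. (real k / real m) ^ card C * indicator K k)"
    by (auto intro: integrable_measure_pmf_finite)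
  show "AE k in P. measure_pmf.prob (ksub m k) {S. C \<subseteq> S \<and> card S \<in> K} \<le> (real k / real m) ^ card C * indicator K k"
    unfolding AE_measure_pmf_iff
  proof
    fix k assume "k \<in> set_pmf P"
    then have km: "k \<le> m" using supp by auto
    show "measure_pmf.prob (ksub m k) {S. C \<subseteq> S \<and> card S \<in> K} \<le> (real k / real m) ^ card C * indicator K k"
    proof (cases "k \<in> K")
      case True
      have "measure_pmf.prob (ksub m k) {S. C \<subseteq> S \<and> card S \<in> K} \<le> measure_pmf.prob (ksub m k) {S. C \<subseteq> S}"
        by (rule measure_pmf.finite_measure_mono) auto
      also have "\<dots> \<le> (real k / real m) ^ card C" by (rule prob_ksub_contain[OF km C])
      finally show ?thesis using True by simp
    next
      case False
      then have "measure_pmf.prob (ksub m k) {S. C \<subseteq> S \<and> card S \<in> K} = 0"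
        unfolding measure_pmf_zero_iff using set_ksub[OF km] by auto
      then show ?thesis using False by simp
    qed
  qed
qed

subsection \<open>Cliques and rainbow cliques\<close>

lemma clique_subset: "is_clique S A \<Longrightarrow> B \<subseteq> A \<Longrightarrow> is_clique S B"
  by (auto simp: is_clique_def)

lemma
  shows clique_number_ge: "A \<subseteq> {1..n} \<Longrightarrow> is_clique S A \<Longrightarrow> card A \<le> clique_number n S"
    and clique_number_attained: "\<exists>A. A \<subseteq> {1..n} \<and> is_clique S A \<and> card A = clique_number n S"
proof -
  let ?C = "{A. A \<subseteq> {1..n} \<and> is_clique S A}"
  have fin: "finite ?C" by (rule finite_subset[of _ "Pow {1..n}"]) auto
  have "{} \<in> ?C" by (simp add: is_clique_def)
  then have "clique_number n S \<in> card ` ?C"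
    unfolding clique_number_def using fin by (intro Max_in) auto
  then show "\<exists>A. A \<subseteq> {1..n} \<and> is_clique S A \<and> card A = clique_number n S" by auto
  show "card A \<le> clique_number n S" if "A \<subseteq> {1..n}" "is_clique S A"
    unfolding clique_number_def using fin that by (intro Max_ge) auto
qed

lemma clique_number_ge_delete:
  assumes H: "H \<subseteq> {1..n}"
  shows "card H \<le> clique_number n S + card {(u, v) \<in> H \<times> H. u < v \<and> S u \<inter> S v = {}}"
proof -
  let ?Q = "{(u, v) \<in> H \<times> H. u < v \<and> S u \<inter> S v = {}}"
  have finH: "finite H" by (rule finite_subset[OF H]) simp
  have finQ: "finite ?Q" by (rule finite_subset[of _ "H \<times> H"]) (use finH in auto)
  have clq: "is_clique S (H - fst ` ?Q)"
    unfolding is_clique_def rig_adj_def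
  proof (intro ballI impI conjI)
    fix u v assume uv: "u \<in> H - fst ` ?Q" "v \<in> H - fst ` ?Q" "u \<noteq> v"
    show "S u \<inter> S v \<noteq> {}"
    proof
      assume emp: "S u \<inter> S v = {}"
      have "(u, v) \<in> ?Q \<or> (v, u) \<in> ?Q" using uv emp by (cases "u < v") (simp_all add: Int_commute)
      then have "u \<in> fst ` ?Q \<or> v \<in> fst ` ?Q" using imageI[of "(u, v)" ?Q fst] imageI[of "(v, u)" ?Q fst] unfolding fst_conv by blast
      then show False using uv by simp
    qed
  qed
  have "card (H - fst ` ?Q) \<le> clique_number n S" by (rule clique_number_ge[OF _ clq]) (use H in blast)
  moreover have "card H - card (fst ` ?Q) \<le> card (H - fst ` ?Q)" using finQ by (intro diff_card_le_card_Diff) simp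
  moreover have "card (fst ` ?Q) \<le> card ?Q" using finQ by (rule card_image_le)
  ultimately show ?thesis by linarith
qed

lemma card_PiE_constrained:
  assumes fin: "finite I" "finite A" and l: "l \<in> I"
    and C: "\<And>f. f \<in> (I \<rightarrow>\<^sub>E A) \<Longrightarrow> card (C f) \<le> D \<and> finite (C f)"
    and indep: "\<And>f g. (\<forall>i\<in>I-{l}. f i = g i) \<Longrightarrow> C f = C g"
  shows "card {f \<in> I \<rightarrow>\<^sub>E A. f l \<in> C f} \<le> D * card A ^ (card I - 1)"
proof (cases "A = {}")
  case True
  then have "I \<rightarrow>\<^sub>E A = {}" using l by auto
  then show ?thesis by simp
next
  case False
  then obtain a where a: "a \<in> A" by auto
  let ?J = "I - {l}"
  let ?X = "{f \<in> I \<rightarrow>\<^sub>E A. f l \<in> C f}"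
  \<comment> \<open>\<open>a\<close> is only a placeholder at \<open>l\<close>: \<open>C\<close>
    ignores that coordinate, so \<open>C (g(l := a))\<close> is the set that every extension of
    \<open>g\<close> has to hit.\<close>
  let ?T = "SIGMA g : ?J \<rightarrow>\<^sub>E A. C (g(l := a))"
  have ext: "g(l := a) \<in> I \<rightarrow>\<^sub>E A" if "g \<in> ?J \<rightarrow>\<^sub>E A" for g
    using that a l by (auto simp: PiE_def Pi_def extensional_def)
  have finT: "finite ?T" using C ext fin by (intro finite_SigmaI finite_PiE) auto
  have "card ?X \<le> card ?T"
  proof (rule card_inj_on_le[where f="\<lambda>f. (restrict f ?J, f l)"])
    show "inj_on (\<lambda>f. (restrict f ?J, f l)) ?X"
    proof (rule inj_onI, clarsimp)
      fix f g assume fg: "f \<in> I \<rightarrow>\<^sub>E A" "g \<in> I \<rightarrow>\<^sub>E A" "restrict f ?J = restrict g ?J" "f l = g l"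
      show "f = g"
      proof (rule PiE_ext[OF fg(1,2)])
        fix i assume "i \<in> I"
        then show "f i = g i" using fg(3,4) by (cases "i = l") (auto dest: fun_cong[of _ _ i])
      qed
    qed
    show "(\<lambda>f. (restrict f ?J, f l)) ` ?X \<subseteq> ?T"
    proof (rule image_subsetI)
      fix f assume f: "f \<in> ?X"
      have "C ((restrict f ?J)(l := a)) = C f" by (rule indep) auto
      moreover have "restrict f ?J \<in> ?J \<rightarrow>\<^sub>E A" using f by (auto simp: PiE_def Pi_def)
      ultimately show "(restrict f ?J, f l) \<in> ?T" using f by simp
    qed
  qed (rule finT)
  also have "\<dots> = (\<Sum>g\<in>?J \<rightarrow>\<^sub>E A. card (C (g(l := a))))"
    using C ext fin by (intro card_SigmaI finite_PiE) auto
  also have "\<dots> \<le> (\<Sum>g\<in>?J \<rightarrow>\<^sub>E A. D)" using C ext by (intro sum_mono) auto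
  also have "\<dots> = D * card A ^ (card I - 1)" using fin l by (simp add: card_PiE)
  finally show ?thesis .
qed

text \<open>Edges of the complete graph on \<open>{..<r}\<close>, each listed once with its smaller
  end first, so that a colouring is a function on this set.\<close>

definition pairs :: "nat \<Rightarrow> (nat \<times> nat) set" where
  "pairs r = {(i, j). i < j \<and> j < r}"

lemma finite_pairs [simp]: "finite (pairs r)"
  unfolding pairs_def by (rule finite_subset[of _ "{..<r} \<times> {..<r}"]) auto

lemma card_pairs: "2 * card (pairs r) = r * (r - 1)"
proof (induction r)
  case 0
  then show ?case by (simp add: pairs_def)
next
  case (Suc r)
  have "pairs (Suc r) = pairs r \<union> (\<lambda>i. (i, r)) ` {..<r}" by (auto simp: pairs_def)
  moreover have "card (pairs r \<union> (\<lambda>i. (i, r)) ` {..<r}) = card (pairs r) + r"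
    using finite_pairs[of r] by (subst card_Un_disjoint) (auto simp: pairs_def card_image inj_on_def)
  ultimately show ?case using Suc by (cases r) auto
qed

text \<open>A uniformly random \<open>r\<close>-tuple of members of the clique is rainbow with positive
  probability: each coincidence of vertices or of colours forces one coordinate into a set of
  at most \<open>D\<close> vertices that is determined by the other coordinates.\<close>
lemma clique_contains_rainbow:
  fixes S :: "nat \<Rightarrow> nat set"
  assumes fin: "finite A" and clq: "is_clique S A"
    and D: "\<And>w. card {v \<in> A. w \<in> S v} \<le> D" "D > 0"
    and big: "(r ^ 2 + r ^ 4) * D < card A" and r: "r > 0"
  shows "\<exists>f c. f \<in> {..<r} \<rightarrow>\<^sub>E A \<and> inj_on f {..<r} \<and> inj_on c (pairs r) \<and> c \<in> extensional (pairs r) \<and>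
     (\<forall>(i, j)\<in>pairs r. c (i, j) \<in> S (f i) \<and> c (i, j) \<in> S (f j))"
proof -
  define w where "w = (\<lambda>u v. SOME x. x \<in> S u \<inter> S v)"
  have w_comm: "w u v = w v u" for u v unfolding w_def by (subst Int_commute) (rule refl)
  have w_in: "w u v \<in> S u" "w u v \<in> S v" if "u \<in> A" "v \<in> A" "u \<noteq> v" for u v
  proof -
    have "\<exists>x. x \<in> S u \<inter> S v" using clq that by (auto simp: is_clique_def rig_adj_def)
    from someI_ex[OF this] show "w u v \<in> S u" "w u v \<in> S v" unfolding w_def by auto
  qed
  let ?T = "{..<r} \<rightarrow>\<^sub>E A"
  let ?k = "card A"
  have finT: "finite ?T" using fin by (intro finite_PiE) auto
  define B1 where "B1 = (\<lambda>(i, j). {f \<in> ?T. f i \<in> {f j}})"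
  define I1 where "I1 = {(i, j) \<in> {..<r} \<times> {..<r}. i \<noteq> j}"
  \<comment> \<open>Instead of comparing the colours of two edges, the bad event is that a third
    vertex owns the colour of an edge. This single condition covers disjoint and adjacent edges
    alike and constrains just one coordinate.\<close>
  define cls where "cls = (\<lambda>e (f :: nat \<Rightarrow> nat). {v \<in> A. w (f (fst e :: nat)) (f (snd e)) \<in> S v})"
  define B2 where "B2 = (\<lambda>(l, e). {f \<in> ?T. f l \<in> cls e f})"
  define I2 where "I2 = {(l, e) \<in> {..<r} \<times> pairs r. l \<noteq> fst e \<and> l \<noteq> snd e}"
  have B1: "card (B1 e) \<le> D * ?k ^ (r - 1)" if e0: "e \<in> I1" for e
  proof -
    obtain i j where e: "e = (i, j)" "i < r" "j < r" "i \<noteq> j" using e0 unfolding I1_def by blast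
    have "card {f \<in> ?T. f i \<in> {f j}} \<le> D * ?k ^ (card {..<r} - 1)"
      using e D by (intro card_PiE_constrained fin) auto
    then show ?thesis by (simp add: B1_def e)
  qed
  have B2: "card (B2 e) \<le> D * ?k ^ (r - 1)" if e0: "e \<in> I2" for e
  proof -
    obtain l i j where e: "e = (l, (i, j))" "l < r" "i < j" "j < r" "l \<noteq> i" "l \<noteq> j"
      using e0 by (cases e) (auto simp: I2_def pairs_def)
    have "card {f \<in> ?T. f l \<in> cls (i, j) f} \<le> D * ?k ^ (card {..<r} - 1)"
      using e D fin by (intro card_PiE_constrained) (auto simp: cls_def)
    then show ?thesis by (simp add: B2_def e)
  qed
  have finI: "finite I1" "finite I2"
    unfolding I1_def I2_def by (rule finite_subset[of _ "{..<r} \<times> {..<r}"], auto)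
      (rule finite_subset[of _ "{..<r} \<times> pairs r"], auto)
  have "card I1 \<le> card ({..<r} \<times> {..<r})" unfolding I1_def by (intro card_mono) auto
  then have cI1: "card I1 \<le> r ^ 2" by (simp add: power2_eq_square)
  have "card I2 \<le> card ({..<r} \<times> ({..<r} \<times> {..<r}))" unfolding I2_def by (intro card_mono) (auto simp: pairs_def)
  also have "\<dots> \<le> r ^ 4" using r by (simp add: power4_eq_xxxx)
  finally have cI2: "card I2 \<le> r ^ 4" .
  have finB: "finite (B1 e)" "finite (B2 e')" for e e'
    unfolding B1_def B2_def using finT by (auto split: prod.split)
  have "card ((\<Union>e\<in>I1. B1 e) \<union> (\<Union>e\<in>I2. B2 e)) \<le> card (\<Union>e\<in>I1. B1 e) + card (\<Union>e\<in>I2. B2 e)"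
    by (rule card_Un_le)
  also have "\<dots> \<le> (\<Sum>e\<in>I1. card (B1 e)) + (\<Sum>e\<in>I2. card (B2 e))"
    using finI by (intro add_mono card_UN_le)
  also have "\<dots> \<le> (\<Sum>e\<in>I1. D * ?k ^ (r - 1)) + (\<Sum>e\<in>I2. D * ?k ^ (r - 1))"
    by (intro add_mono sum_mono B1 B2)
  also have "\<dots> = (card I1 + card I2) * (D * ?k ^ (r - 1))" by (simp add: algebra_simps)
  also have "\<dots> \<le> (r ^ 2 + r ^ 4) * (D * ?k ^ (r - 1))" using cI1 cI2 by (intro mult_right_mono) auto
  also have "\<dots> = ((r ^ 2 + r ^ 4) * D) * ?k ^ (r - 1)" by simp
  also have "\<dots> < ?k * ?k ^ (r - 1)" using big by (intro mult_strict_right_mono) auto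
  also have "\<dots> = ?k ^ r" using r by (cases r) auto
  also have "\<dots> = card ?T" using fin by (simp add: card_PiE)
  finally have "card ((\<Union>e\<in>I1. B1 e) \<union> (\<Union>e\<in>I2. B2 e)) < card ?T" .
  then have "\<not> ?T \<subseteq> (\<Union>e\<in>I1. B1 e) \<union> (\<Union>e\<in>I2. B2 e)"
    using finI finB by (meson card_mono finite_UN_I finite_UnI not_less)
  then obtain f where f: "f \<in> ?T" and n1: "\<forall>e\<in>I1. f \<notin> B1 e" and n2: "\<forall>e\<in>I2. f \<notin> B2 e" by blast
  have fA: "f i \<in> A" if "i < r" for i using f that by auto
  have ne: "f i \<noteq> f j" if "i < r" "j < r" "i \<noteq> j" for i j
    using n1 that f by (auto simp: I1_def B1_def)
  have inj: "inj_on f {..<r}" using ne by (auto simp: inj_on_def)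
  have key: "w (f i) (f j) \<notin> S (f l)" if "i < j" "j < r" "l < r" "l \<noteq> i" "l \<noteq> j" for i j l
    using n2 that f fA[of l] by (auto simp: I2_def B2_def cls_def pairs_def)
  define c where "c = restrict (\<lambda>(i, j). w (f i) (f j)) (pairs r)"
  have "inj_on c (pairs r)"
  proof (rule inj_onI, clarsimp)
    fix i j i' j' assume p: "(i, j) \<in> pairs r" "(i', j') \<in> pairs r" "c (i, j) = c (i', j')"
    then have ij: "i < j" "j < r" "i' < j'" "j' < r" and eq: "w (f i) (f j) = w (f i') (f j')"
      by (auto simp: c_def pairs_def)
    have m: "w (f i) (f j) \<in> S (f i)" "w (f i) (f j) \<in> S (f j)"
      using w_in[OF fA[of i] fA[of j] ne[of i j]] ij by auto
    \<comment> \<open>Within the tuple, only the ends of an edge own its colour. A colour shared by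
      two edges is owned by all their ends, hence the two edges have the same ends.\<close>
    have "i = i' \<or> i = j'" using key[of i' j' i] m eq ij by auto
    moreover have "j = i' \<or> j = j'" using key[of i' j' j] m eq ij by auto
    ultimately show "i = i' \<and> j = j'" using ij by auto
  qed
  moreover have "c \<in> extensional (pairs r)" by (simp add: c_def)
  moreover have "\<forall>(i, j)\<in>pairs r. c (i, j) \<in> S (f i) \<and> c (i, j) \<in> S (f j)"
  proof safe
    fix i j assume p: "(i, j) \<in> pairs r"
    then have ij: "i < j" "j < r" by (auto simp: pairs_def)
    then show "c (i, j) \<in> S (f i)" "c (i, j) \<in> S (f j)"
      using p w_in[OF fA[of i] fA[of j] ne[of i j]] by (auto simp: c_def)
  qed
  ultimately show ?thesis using f inj by blast
qed

text \<open>h^h / h! is one term of the series of exp h, while the binomial coefficient is at most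
  n^h / h!.\<close>

lemma choose_le_exp_pow:
  assumes "h > 0"
  shows "real (n choose h) \<le> (exp 1 * real n / real h) ^ h"
proof (cases "h \<le> n")
  case True
  have "real h ^ h / fact h = real h ^ h /\<^sub>R fact h" by (simp add: field_simps)
  also have "\<dots> \<le> (\<Sum>k<Suc h. (real h) ^ k /\<^sub>R fact k)"
    by (rule member_le_sum) auto
  also have "\<dots> \<le> exp (real h)"
    unfolding exp_def by (intro sum_le_suminf summable_exp_generic) auto
  also have "\<dots> = exp 1 ^ h" by (simp flip: exp_of_nat_mult)
  finally have fa: "real h ^ h \<le> exp 1 ^ h * fact h" by (simp add: divide_simps)
  have "fact h * fact (n - h) * (n choose h) = (fact n :: nat)" using binomial_fact_lemma[OF True] .
  moreover have "(fact n :: nat) \<le> n ^ h * fact (n - h)"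
    using fact_div_fact_le_pow[OF True] True
    by (metis dvd_div_mult_self fact_dvd diff_le_self mult_le_mono1)
  ultimately have "fact (n - h) * (fact h * (n choose h)) \<le> fact (n - h) * n ^ h"
    by (simp add: mult_ac)
  then have "fact h * (n choose h) \<le> n ^ h" by simp
  then have le: "fact h * real (n choose h) \<le> real n ^ h" by (metis of_nat_fact of_nat_le_iff of_nat_mult of_nat_power)
  have "real h ^ h * real (n choose h) \<le> exp 1 ^ h * fact h * real (n choose h)"
    using fa by (intro mult_right_mono) auto
  also have "\<dots> \<le> exp 1 ^ h * real n ^ h" using le by (simp add: mult.assoc)
  finally show ?thesis using assms by (simp add: power_divide power_mult_distrib divide_simps mult.commute)
next
  case False
  then show ?thesis by (simp add: binomial_eq_0)
qed

lemma card_incident_pairs: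
  assumes "i < r"
  shows "card {e \<in> pairs r. i = fst e \<or> i = snd e} = r - 1"
proof -
  have eq: "{e \<in> pairs r. i = fst e \<or> i = snd e} = (\<lambda>j. (min i j, max i j)) ` ({..<r} - {i})"
  proof (intro set_eqI iffI)
    fix e assume "e \<in> {e \<in> pairs r. i = fst e \<or> i = snd e}"
    then have "e \<in> pairs r" "i = fst e \<or> i = snd e" by auto
    then show "e \<in> (\<lambda>j. (min i j, max i j)) ` ({..<r} - {i})"
      by (intro image_eqI[of _ _ "if i = fst e then snd e else fst e"])
         (auto simp: pairs_def min_def max_def prod_eq_iff)
  qed (use assms in \<open>auto simp: pairs_def min_def max_def split: if_splits\<close>)
  have "inj_on (\<lambda>j. (min i j, max i j)) ({..<r} - {i})"
    by (auto simp: inj_on_def min_def max_def split: if_splits)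
  then show ?thesis unfolding eq using assms by (simp add: card_image)
qed

subsection \<open>Power-law tails\<close>

text \<open>\<beta> \<le> 1 is a normalisation: a growth bound for a larger exponent implies the one
  for exponent 1, and 1 still exceeds 2 - \<alpha> and \<alpha> - 1. It is what makes 2 * \<gamma>
  \<le> \<kappa> below.\<close>

locale rig_sequence =
  fixes \<alpha> \<beta> \<epsilon>0 :: real and L :: "real \<Rightarrow> real"
    and m :: "nat \<Rightarrow> nat" and P :: "nat \<Rightarrow> nat pmf"
  assumes alpha: "1 < \<alpha>" "\<alpha> < 2"
    and m_pos: "\<And>n. 0 < m n"
    and P_supp: "\<And>n. set_pmf (P n) \<subseteq> {0..m n}"
    and A: "condA m P"
    and L: "slowly_varying L"
    and eps0: "0 < \<epsilon>0" "\<epsilon>0 < 1/2"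
    and PL: "condPL m P \<alpha> L \<epsilon>0"
    and beta: "2 - \<alpha> < \<beta>" "\<alpha> - 1 < \<beta>" "\<beta> \<le> 1"
    and m_growth: "(\<lambda>n. real (m n)) \<in> \<Omega>(\<lambda>n. real n powr \<beta>)"
begin

definition F :: "nat \<Rightarrow> real \<Rightarrow> real" where
  "F n x = measure_pmf.prob (P n) {k. Yval n (m n) k \<ge> x}"

definition \<kappa> :: real where "\<kappa> = 1 - \<alpha> / 2"

definition thr :: "nat \<Rightarrow> real" where "thr n = sqrt (real n * ln (real n))"

abbreviation K :: "nat \<Rightarrow> real" where "K \<equiv> Kfun L \<alpha>"

lemma \<kappa>: "0 < \<kappa>" "\<kappa> < 1/2"
  using alpha by (auto simp: \<kappa>_def)

lemma L_pos: "x > 0 \<Longrightarrow> L x > 0"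
  using L by (auto simp: slowly_varying_def)

lemma F_antimono: "x \<le> y \<Longrightarrow> F n y \<le> F n x"
  unfolding F_def by (intro measure_pmf.finite_measure_mono) auto

lemma F_nonneg: "0 \<le> F n x"
  by (simp add: F_def)

text \<open>A condition on all sequences is a uniform one: \<open>s\<close> follows a violating
  point of the window whenever there is one, and the hypothesis applied to this single sequence
  excludes violations for all large \<open>n\<close>.\<close>

lemma PL_uniform:
  assumes "e > 0"
  obtains N where "\<And>n x. n \<ge> N \<Longrightarrow> real n powr (1/2 - \<epsilon>0) \<le> x \<Longrightarrow> x \<le> real n powr (1/2 + \<epsilon>0) \<Longrightarrow>
     \<bar>F n x / (L x * x powr (- \<alpha>)) - 1\<bar> < e"
proof -
  define bad where "bad = (\<lambda>n x. real n powr (1/2 - \<epsilon>0) \<le> x \<and> x \<le> real n powr (1/2 + \<epsilon>0) \<and>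
     \<not> \<bar>F n x / (L x * x powr (- \<alpha>)) - 1\<bar> < e)"
  define s where "s = (\<lambda>n. if \<exists>x. bad n x then SOME x. bad n x else real n powr (1/2))"
  have bad_s: "bad n (s n)" if "bad n x" for n x
    using that someI_ex[of "bad n"] by (auto simp: s_def)
  have "real n powr (1/2 - \<epsilon>0) \<le> s n \<and> s n \<le> real n powr (1/2 + \<epsilon>0)" for n
  proof (cases "\<exists>x. bad n x")
    case True
    then show ?thesis using bad_s by (auto simp: bad_def)
  next
    case False
    then have "s n = real n powr (1/2)" unfolding s_def by (simp only: if_False)
    then show ?thesis using eps0 by (cases "n = 0") (auto intro!: powr_mono)
  qed
  then have "(\<lambda>n. F n (s n)) \<sim>[at_top] (\<lambda>n. L (s n) * s n powr (- \<alpha>))"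
    and s_low: "\<And>n. real n powr (1/2 - \<epsilon>0) \<le> s n"
    using PL unfolding condPL_def F_def by blast+
  then have "eventually (\<lambda>n. dist (if F n (s n) = 0 \<and> L (s n) * s n powr (- \<alpha>) = 0 then 1
      else F n (s n) / (L (s n) * s n powr (- \<alpha>))) 1 < e) at_top"
    unfolding asymp_equiv_def using assms by (blast dest: tendstoD)
  then have "eventually (\<lambda>n. \<not> bad n (s n)) at_top"
    using eventually_gt_at_top[of 0]
  proof eventually_elim
    case (elim n)
    \<comment> \<open>Asymptotic equivalence reads 0 / 0 as 1; positivity of \<open>s n\<close>,
      hence of \<open>L (s n)\<close>, shows that the quotient is a genuine one.\<close>
    have "s n > 0" using s_low[of n] elim(2) by (smt (verit) of_nat_0_less_iff powr_gt_zero)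
    then have "L (s n) * s n powr (- \<alpha>) > 0" using L_pos by simp
    then have "F n (s n) / (L (s n) * s n powr (- \<alpha>)) = (if F n (s n) = 0 \<and> L (s n) * s n powr (- \<alpha>) = 0 then 1
      else F n (s n) / (L (s n) * s n powr (- \<alpha>)))" by auto
    then show ?case using elim(1) unfolding bad_def dist_real_def by simp
  qed
  then obtain N where "\<And>n. n \<ge> N \<Longrightarrow> \<not> bad n (s n)" by (auto simp: eventually_at_top_linorder)
  then show ?thesis using bad_s that[of N] unfolding bad_def by blast
qed

lemma F_bounds:
  obtains N where "N > 0" "\<And>n x. n \<ge> N \<Longrightarrow> real n powr (1/2 - \<epsilon>0) \<le> x \<Longrightarrow> x \<le> real n powr (1/2 + \<epsilon>0) \<Longrightarrow>
     F n x \<le> 3/2 * (L x * x powr (- \<alpha>)) \<and> F n x \<ge> 1/2 * (L x * x powr (- \<alpha>))"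
proof -
  obtain N where N: "\<And>n x. n \<ge> N \<Longrightarrow> real n powr (1/2 - \<epsilon>0) \<le> x \<Longrightarrow> x \<le> real n powr (1/2 + \<epsilon>0) \<Longrightarrow>
     \<bar>F n x / (L x * x powr (- \<alpha>)) - 1\<bar> < 1/2" using PL_uniform[of "1/2"] by auto
  show ?thesis
  proof (rule that[of "Suc N"])
    fix n x assume nx: "n \<ge> Suc N" "real n powr (1/2 - \<epsilon>0) \<le> x" "x \<le> real n powr (1/2 + \<epsilon>0)"
    have "real n powr (1/2 - \<epsilon>0) > 0" using nx by simp
    then have "x > 0" using nx(2) by linarith
    define R where "R = L x * x powr (- \<alpha>)"
    have R: "R > 0" using L_pos \<open>x > 0\<close> by (simp add: R_def)
    have "\<bar>F n x / R - 1\<bar> < 1/2" using N[of n x] nx by (simp add: R_def)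
    then have "F n x / R < 3/2" "F n x / R > 1/2" by linarith+
    then have "F n x < 3/2 * R" "F n x > 1/2 * R" using R by (simp_all add: field_simps)
    then show "F n x \<le> 3/2 * (L x * x powr (- \<alpha>)) \<and> F n x \<ge> 1/2 * (L x * x powr (- \<alpha>))"
      by (simp add: R_def)
  qed simp
qed

text \<open>\<open>L\<close> is not assumed measurable, so the uniform convergence theorem for slowly varying
  functions is unavailable; local boundedness comes from monotonicity of the tails instead.\<close>
lemma L_locally_comparable:
  obtains C x0 where "C \<ge> 1" "x0 \<ge> 1"
    "\<And>x y. x0 \<le> x \<Longrightarrow> x \<le> y \<Longrightarrow> y \<le> 2 * x \<Longrightarrow> L y \<le> C * L x \<and> L x \<le> C * L y"
proof -
  obtain N where N: "N > 0" "\<And>n x. n \<ge> N \<Longrightarrow> real n powr (1/2 - \<epsilon>0) \<le> x \<Longrightarrow> x \<le> real n powr (1/2 + \<epsilon>0) \<Longrightarrow>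
     F n x \<le> 3/2 * (L x * x powr (- \<alpha>)) \<and> F n x \<ge> 1/2 * (L x * x powr (- \<alpha>))" using F_bounds by blast
  have ev1: "eventually (\<lambda>x::real. (x\<^sup>2 + 1) powr (1/2 - \<epsilon>0) \<le> x) at_top" using eps0 by real_asymp
  have ev2: "eventually (\<lambda>x::real. 2 * x \<le> (x\<^sup>2) powr (1/2 + \<epsilon>0)) at_top" using eps0 by real_asymp
  have ev3: "eventually (\<lambda>x::real. real N \<le> x\<^sup>2) at_top" by real_asymp
  have "((\<lambda>x. L (2 * x) / L x) \<longlongrightarrow> 1) at_top" using L by (auto simp: slowly_varying_def)
  then have ev4: "eventually (\<lambda>x. L (2 * x) / L x > 1/2) at_top" by (rule order_tendstoD) simp
  obtain x0 where x0: "x0 \<ge> 1" "\<And>x. x \<ge> x0 \<Longrightarrow> (x\<^sup>2 + 1) powr (1/2 - \<epsilon>0) \<le> x \<and> 2 * x \<le> (x\<^sup>2) powr (1/2 + \<epsilon>0) \<and>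
      real N \<le> x\<^sup>2 \<and> L (2 * x) / L x > 1/2"
  proof -
    obtain x1 where "\<And>x. x \<ge> x1 \<Longrightarrow> (x\<^sup>2 + 1) powr (1/2 - \<epsilon>0) \<le> x \<and> 2 * x \<le> (x\<^sup>2) powr (1/2 + \<epsilon>0) \<and>
      real N \<le> x\<^sup>2 \<and> L (2 * x) / L x > 1/2"
      using eventually_conj[OF ev1 eventually_conj[OF ev2 eventually_conj[OF ev3 ev4]]]
      unfolding eventually_at_top_linorder by blast
    then show ?thesis using that[of "max x1 1"] by simp
  qed
  \<comment> \<open>3 is the ratio of the constants 3/2 and 1/2 in \<open>F_bounds\<close>; the
    power of 2 pays for y \<le> 2 * x.\<close>
  define C1 where "C1 = 3 * 2 powr \<alpha>"
  have C1: "C1 \<ge> 1" using alpha ge_one_powr_ge_zero[of 2 \<alpha>] by (simp add: C1_def)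
  have up: "L y \<le> C1 * L x" if xy: "x0 \<le> x" "x \<le> y" "y \<le> 2 * x" for x y
  proof -
    \<comment> \<open>This places \<open>x\<close> near the square root of \<open>n\<close>, so that
      all of [x, 2 * x] lies in the window of one and the same tail function
      \<open>F n\<close>.\<close>
    define n where "n = nat \<lceil>x\<^sup>2\<rceil>"
    have x: "x \<ge> 1" using x0 xy by simp
    have n1: "x\<^sup>2 \<le> real n" unfolding n_def by linarith
    have n2: "real n \<le> x\<^sup>2 + 1" unfolding n_def by (smt (verit) of_int_ceiling_le_add_one of_nat_nat zero_le_ceiling zero_le_power2)
    have nN: "n \<ge> N" using x0(2)[OF xy(1)] n1 by linarith
    have lo: "real n powr (1/2 - \<epsilon>0) \<le> x"
      using x0(2)[OF xy(1)] powr_mono2[of "1/2 - \<epsilon>0" "real n" "x\<^sup>2 + 1"] n2 eps0 by simp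
    have hi: "2 * x \<le> real n powr (1/2 + \<epsilon>0)"
      using x0(2)[OF xy(1)] powr_mono2[of "1/2 + \<epsilon>0" "x\<^sup>2" "real n"] n1 eps0 by simp
    have "1/2 * (L y * y powr (- \<alpha>)) \<le> F n y" using N(2)[of n y] nN lo hi xy by auto
    also have "\<dots> \<le> F n x" by (rule F_antimono[OF xy(2)])
    also have "\<dots> \<le> 3/2 * (L x * x powr (- \<alpha>))" using N(2)[of n x] nN lo hi xy x by auto
    finally have "L y * y powr (- \<alpha>) \<le> 3 * L x * x powr (- \<alpha>)" by simp
    then have "L y * y powr (- \<alpha>) * y powr \<alpha> \<le> 3 * L x * x powr (- \<alpha>) * y powr \<alpha>"
      by (rule mult_right_mono) simp
    also have "L y * y powr (- \<alpha>) * y powr \<alpha> = L y" using x xy by (simp add: powr_minus)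
    also have "3 * L x * x powr (- \<alpha>) * y powr \<alpha> \<le> 3 * L x * x powr (- \<alpha>) * (2 * x) powr \<alpha>"
      using x xy alpha L_pos[of x] by (intro mult_left_mono powr_mono2) auto
    also have "\<dots> = C1 * L x" using x by (simp add: C1_def powr_mult powr_minus)
    finally show ?thesis .
  qed
  show ?thesis
  proof (rule that[of "2 * C1" x0])
    fix x y assume xy: "x0 \<le> x" "x \<le> y" "y \<le> 2 * x"
    have Lp: "L x > 0" "L y > 0" using x0 xy by (auto intro!: L_pos)
    \<comment> \<open>Monotone tails only bound \<open>L\<close> at the larger point by
      \<open>L\<close> at the smaller one. The converse goes around through 2 * x: slow variation
      with factor 2 compares \<open>L x\<close> with \<open>L (2 * x)\<close>, and \<open>up\<close>
      compares the latter with \<open>L y\<close>.\<close>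
    have "L (2 * x) / L x > 1/2" using x0(2)[OF xy(1)] by blast
    then have "L x \<le> 2 * L (2 * x)" using Lp by (simp add: field_simps)
    moreover have "L (2 * x) \<le> C1 * L y" using up[of y "2 * x"] xy x0 by simp
    moreover have "L y \<le> C1 * L x" using up xy by simp
    moreover have "C1 * L x \<le> 2 * C1 * L x" using C1 Lp by simp
    ultimately show "L y \<le> 2 * C1 * L x \<and> L x \<le> 2 * C1 * L y" by linarith
  qed (use C1 x0 in auto)
qed

text \<open>A Potter-type bound. Doubling the argument eventually changes \<open>L\<close> by a
  factor between 2 powr (-\<theta>) and 2 powr \<theta>; iterating over dyadic scales reduces to
  [x1, 2 * x1], where local comparability with \<open>L x1\<close> takes over.\<close>

lemma L_powr_bounds:
  assumes "\<eta> > 0"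
  shows "eventually (\<lambda>x. x powr (- \<eta>) \<le> L x \<and> L x \<le> x powr \<eta>) at_top"
proof -
  obtain C x0 where C: "C \<ge> 1" "x0 \<ge> 1"
    "\<And>x y. x0 \<le> x \<Longrightarrow> x \<le> y \<Longrightarrow> y \<le> 2 * x \<Longrightarrow> L y \<le> C * L x \<and> L x \<le> C * L y"
    using L_locally_comparable by blast
  \<comment> \<open>The other half of \<eta> absorbs the constants \<open>M\<close> and
    \<open>M'\<close>.\<close>
  define \<theta> where "\<theta> = \<eta> / 2"
  have \<theta>: "\<theta> > 0" using assms by (simp add: \<theta>_def)
  have lim: "((\<lambda>x. L (2 * x) / L x) \<longlongrightarrow> 1) at_top" using L by (auto simp: slowly_varying_def)
  have p2: "(2::real) powr \<theta> > 1" "(2::real) powr (- \<theta>) < 1" using \<theta> powr_less_mono[of "- \<theta>" 0 2] by auto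
  have "eventually (\<lambda>x. L (2 * x) / L x < 2 powr \<theta> \<and> L (2 * x) / L x > 2 powr (- \<theta>)) at_top"
    using order_tendstoD[OF lim] p2 by (intro eventually_conj) auto
  then obtain x1 where x1: "x1 \<ge> x0"
     "\<And>x. x \<ge> x1 \<Longrightarrow> L (2 * x) / L x < 2 powr \<theta> \<and> L (2 * x) / L x > 2 powr (- \<theta>)"
    unfolding eventually_at_top_linorder by (metis max.cobounded1 max.cobounded2 max.bounded_iff)
  have x1p: "x1 \<ge> 1" using x1 C by simp
  define M where "M = C * L x1"
  define M' where "M' = L x1 / C"
  have Mp: "M > 0" "M' > 0" using C x1p L_pos[of x1] by (auto simp: M_def M'_def)
  have main: "\<forall>x. x1 \<le> x \<and> x \<le> 2 ^ Suc j * x1 \<longrightarrow> M' * x powr (- \<theta>) \<le> L x \<and> L x \<le> M * x powr \<theta>" for j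
  proof (induction j)
    case 0
    show ?case
    proof (intro allI impI)
      fix x assume x: "x1 \<le> x \<and> x \<le> 2 ^ Suc 0 * x1"
      then have c: "L x \<le> M" "L x1 \<le> C * L x" using C(3)[of x1 x] x1 by (auto simp: M_def)
      have x': "x \<ge> 1" using x x1p by simp
      have "M * 1 \<le> M * x powr \<theta>" using x' \<theta> Mp by (intro mult_left_mono ge_one_powr_ge_zero) auto
      moreover have "M' \<le> L x" using c C by (simp add: M'_def divide_le_eq mult.commute)
      moreover have "M' * x powr (- \<theta>) \<le> M' * 1"
        using x' \<theta> Mp powr_mono[of "- \<theta>" 0 x] by (intro mult_left_mono) auto
      ultimately show "M' * x powr (- \<theta>) \<le> L x \<and> L x \<le> M * x powr \<theta>" using c by simp
    qed
  next
    case (Suc j)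
    show ?case
    proof (intro allI impI)
      fix x assume x: "x1 \<le> x \<and> x \<le> 2 ^ Suc (Suc j) * x1"
      show "M' * x powr (- \<theta>) \<le> L x \<and> L x \<le> M * x powr \<theta>"
      proof (cases "x \<le> 2 ^ Suc j * x1")
        case True
        then show ?thesis using Suc x by blast
      next
        case False
        have "2 * x1 \<le> 2 ^ Suc j * x1" using x1p by simp
        then have h: "x1 \<le> x / 2" "x / 2 \<le> 2 ^ Suc j * x1" using False x by auto
        have IH: "M' * (x/2) powr (- \<theta>) \<le> L (x/2)" "L (x/2) \<le> M * (x/2) powr \<theta>" using Suc h by blast+
        have hp: "L (x/2) > 0" using h x1p by (intro L_pos) auto
        have r: "L x < 2 powr \<theta> * L (x/2)" "L x > 2 powr (- \<theta>) * L (x/2)"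
          using x1(2)[OF h(1)] hp by (auto simp: field_simps)
        have xp: "x / 2 > 0" using h x1p by simp
        have "2 powr \<theta> * L (x/2) \<le> 2 powr \<theta> * (M * (x/2) powr \<theta>)" using IH by (intro mult_left_mono) auto
        also have "\<dots> = M * (2 * (x/2)) powr \<theta>" using xp by (subst powr_mult) auto
        finally have u: "L x \<le> M * x powr \<theta>" using r by simp
        have "2 powr (- \<theta>) * L (x/2) \<ge> 2 powr (- \<theta>) * (M' * (x/2) powr (- \<theta>))" using IH by (intro mult_left_mono) auto
        moreover have "2 powr (- \<theta>) * (M' * (x/2) powr (- \<theta>)) = M' * (2 * (x/2)) powr (- \<theta>)" using xp by (subst powr_mult) auto
        ultimately show ?thesis using u r by simp
      qed
    qed
  qed
  have all: "M' * x powr (- \<theta>) \<le> L x \<and> L x \<le> M * x powr \<theta>" if "x \<ge> x1" for x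
  proof -
    obtain j where "x / x1 < 2 ^ j" using real_arch_pow[of 2 "x / x1"] by auto
    then have "x < 2 ^ j * x1" using x1p by (simp add: field_simps)
    also have "\<dots> \<le> 2 ^ Suc j * x1" using x1p by simp
    finally show ?thesis using main[of j] that by simp
  qed
  have "eventually (\<lambda>x::real. M \<le> x powr \<theta>) at_top" "eventually (\<lambda>x::real. x powr (- \<theta>) \<le> M') at_top"
    using \<theta> Mp by real_asymp+
  then show ?thesis using eventually_ge_at_top[of x1]
  proof eventually_elim
    case (elim x)
    have b: "M' * x powr (- \<theta>) \<le> L x" "L x \<le> M * x powr \<theta>" using all elim by auto
    have "M * x powr \<theta> \<le> x powr \<theta> * x powr \<theta>" using elim by (intro mult_right_mono) auto
    moreover have "x powr (- \<theta>) * x powr (- \<theta>) \<le> M' * x powr (- \<theta>)" using elim by (intro mult_right_mono) auto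
    ultimately show ?case using b by (simp add: \<theta>_def flip: powr_add)
  qed
qed

section \<open>Growth of \<open>K\<close> and expected numbers of vertices\<close>

lemma thr_at_top: "filterlim thr at_top at_top"
  unfolding thr_def by real_asymp

lemma K_eq: "K n = L (thr n) * (real n powr \<kappa> * ln (real n) powr (- \<alpha> / 2))"
  by (simp add: Kfun_def thr_def \<kappa>_def mult.assoc)

lemma K_lower:
  assumes "d > 0"
  shows "eventually (\<lambda>n. real n powr (\<kappa> - d) \<le> K n) at_top"
proof -
  have "eventually (\<lambda>n. thr n powr (- d) \<le> L (thr n) \<and> L (thr n) \<le> thr n powr d) at_top"
    using filterlim_iff[THEN iffD1, OF thr_at_top] L_powr_bounds[OF assms] by blast
  moreover have "eventually (\<lambda>n. real n powr (\<kappa> - d) \<le> thr n powr (- d) * (real n powr \<kappa> * ln (real n) powr (- \<alpha> / 2))) at_top"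
    unfolding thr_def using assms alpha \<kappa> by real_asymp
  ultimately show ?thesis
  proof eventually_elim
    case (elim n)
    have "thr n powr (- d) * (real n powr \<kappa> * ln (real n) powr (- \<alpha> / 2)) \<le> K n"
      unfolding K_eq using elim by (intro mult_right_mono) auto
    then show ?case using elim by simp
  qed
qed

lemma K_upper:
  assumes "d > 0"
  shows "eventually (\<lambda>n. K n \<le> real n powr (\<kappa> + d)) at_top"
proof -
  have "eventually (\<lambda>n. thr n powr (- d) \<le> L (thr n) \<and> L (thr n) \<le> thr n powr d) at_top"
    using filterlim_iff[THEN iffD1, OF thr_at_top] L_powr_bounds[OF assms] by blast
  moreover have "eventually (\<lambda>n. thr n powr d * (real n powr \<kappa> * ln (real n) powr (- \<alpha> / 2)) \<le> real n powr (\<kappa> + d)) at_top"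
    unfolding thr_def using assms alpha \<kappa> by real_asymp
  ultimately show ?thesis
  proof eventually_elim
    case (elim n)
    have "K n \<le> thr n powr d * (real n powr \<kappa> * ln (real n) powr (- \<alpha> / 2))"
      unfolding K_eq using elim by (intro mult_right_mono) auto
    then show ?case using elim by simp
  qed
qed

lemma K_pos: "eventually (\<lambda>n. K n > 0) at_top"
  using K_lower[of 1, simplified] eventually_gt_at_top[of 0]
proof eventually_elim
  case (elim n)
  have "real n powr (\<kappa> - 1) > 0" using elim by simp
  then show ?case using elim by linarith
qed

lemma K_at_top: "filterlim K at_top at_top"
proof (rule filterlim_at_top_mono)
  show "eventually (\<lambda>n. real n powr (\<kappa> - \<kappa>/2) \<le> K n) at_top" by (rule K_lower) (use \<kappa> in simp)
  show "filterlim (\<lambda>n. real n powr (\<kappa> - \<kappa>/2)) at_top at_top" using \<kappa> by real_asymp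
qed

text \<open>The excess over \<kappa> in the exponent is \<delta>/2 for the constant 3/2, at most
  \<delta>/2 for the slowly varying factor, and \<alpha> * \<delta> \<le> 2 * \<delta> for lowering
  the threshold from n powr (1/2).\<close>

lemma medium_count:
  assumes "0 < \<delta>" "\<delta> < \<epsilon>0"
  shows "eventually (\<lambda>n. real n * F n (real n powr (1/2 - \<delta>)) \<le> real n powr (\<kappa> + 3 * \<delta>)) at_top"
proof -
  obtain N where N: "N > 0" "\<And>n x. n \<ge> N \<Longrightarrow> real n powr (1/2 - \<epsilon>0) \<le> x \<Longrightarrow> x \<le> real n powr (1/2 + \<epsilon>0) \<Longrightarrow>
     F n x \<le> 3/2 * (L x * x powr (- \<alpha>)) \<and> F n x \<ge> 1/2 * (L x * x powr (- \<alpha>))" using F_bounds by blast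
  let ?x = "\<lambda>n. real n powr (1/2 - \<delta>)"
  have "filterlim ?x at_top at_top" using assms eps0 by real_asymp
  then have "eventually (\<lambda>n. ?x n powr (- \<delta>) \<le> L (?x n) \<and> L (?x n) \<le> ?x n powr \<delta>) at_top"
    using filterlim_iff[THEN iffD1] L_powr_bounds[OF assms(1)] by blast
  moreover have "eventually (\<lambda>n. real n * (3/2 * (?x n powr \<delta> * ?x n powr (- \<alpha>))) \<le> real n powr (\<kappa> + 3 * \<delta>)) at_top"
  proof -
    have "eventually (\<lambda>n. 3/2 \<le> real n powr (\<delta>/2)) at_top" using assms by real_asymp
    then show ?thesis using eventually_gt_at_top[of 0]
    proof eventually_elim
      case (elim n)
      have "real n * (3/2 * (?x n powr \<delta> * ?x n powr (- \<alpha>))) \<le> real n powr 1 * (real n powr (\<delta>/2) * (?x n powr \<delta> * ?x n powr (- \<alpha>)))"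
        using elim by (intro mult_mono) auto
      also have "\<dots> = real n powr (1 + \<delta>/2 + (1/2 - \<delta>) * (\<delta> - \<alpha>))"
        unfolding powr_powr powr_add[symmetric] by (rule arg_cong[where f = "\<lambda>u. real n powr u"]) (simp add: field_simps)
      also have "\<dots> \<le> real n powr (\<kappa> + 3 * \<delta>)"
      proof (rule powr_mono)
        have "\<delta> * \<alpha> \<le> \<delta> * 2" "\<delta> * \<delta> \<ge> 0" using assms alpha by (auto intro!: mult_left_mono)
        moreover have "(1/2 - \<delta>) * (\<delta> - \<alpha>) = \<delta>/2 - \<alpha>/2 - \<delta> * \<delta> + \<delta> * \<alpha>" by (simp add: field_simps)
        ultimately show "1 + \<delta>/2 + (1/2 - \<delta>) * (\<delta> - \<alpha>) \<le> \<kappa> + 3 * \<delta>"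
          unfolding \<kappa>_def by linarith
      qed (use elim in simp)
      finally show ?case .
    qed
  qed
  ultimately show ?thesis using eventually_ge_at_top[of N]
  proof eventually_elim
    case (elim n)
    have n: "n \<ge> 1" using N elim by simp
    have "F n (?x n) \<le> 3/2 * (L (?x n) * ?x n powr (- \<alpha>))"
    proof -
      have "real n powr (1/2 - \<epsilon>0) \<le> ?x n" using assms n by (intro powr_mono) auto
      moreover have "?x n \<le> real n powr (1/2 + \<epsilon>0)" using assms eps0 n by (intro powr_mono) auto
      ultimately show ?thesis using N(2)[OF elim(3)] by blast
    qed
    also have "\<dots> \<le> 3/2 * (?x n powr \<delta> * ?x n powr (- \<alpha>))"
      using elim by (intro mult_left_mono mult_right_mono) auto
    finally have "real n * F n (?x n) \<le> real n * (3/2 * (?x n powr \<delta> * ?x n powr (- \<alpha>)))"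
      by (rule mult_left_mono) simp
    then show ?case using elim by linarith
  qed
qed

text \<open>Origin of \<open>K\<close>: it equals n * L (thr n) * thr n powr (-\<alpha>), the
  predicted number of vertices with Y at least \<open>thr n\<close>. Scaling the threshold by
  \<open>c\<close> changes only the power, since \<open>L\<close> varies slowly.\<close>

lemma high_count:
  assumes c: "c > 0"
  shows "((\<lambda>n. real n * F n (c * thr n) / K n) \<longlongrightarrow> c powr (- \<alpha>)) at_top"
proof -
  \<comment> \<open>The power-law condition asks for membership in the window at every
    \<open>n\<close>, whereas \<open>c * thr n\<close> is there only for large \<open>n\<close>;
    elsewhere the centre of the window stands in.\<close>
  define s where "s = (\<lambda>n. if real n powr (1/2 - \<epsilon>0) \<le> c * thr n \<and> c * thr n \<le> real n powr (1/2 + \<epsilon>0)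
     then c * thr n else real n powr (1/2))"
  have win: "real n powr (1/2 - \<epsilon>0) \<le> s n \<and> s n \<le> real n powr (1/2 + \<epsilon>0)" for n
    using eps0 by (cases "n = 0") (auto simp: s_def intro!: powr_mono)
  have "eventually (\<lambda>n. real n powr (1/2 - \<epsilon>0) \<le> c * thr n) at_top" "eventually (\<lambda>n. c * thr n \<le> real n powr (1/2 + \<epsilon>0)) at_top"
    unfolding thr_def using eps0 c by real_asymp+
  then have s_eq: "eventually (\<lambda>n. s n = c * thr n) at_top"
    by eventually_elim (simp add: s_def)
  have "(\<lambda>n. F n (s n)) \<sim>[at_top] (\<lambda>n. L (s n) * s n powr (- \<alpha>))"
    using PL win unfolding condPL_def F_def by blast
  then have l1: "((\<lambda>n. if F n (s n) = 0 \<and> L (s n) * s n powr (- \<alpha>) = 0 then 1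
      else F n (s n) / (L (s n) * s n powr (- \<alpha>))) \<longlongrightarrow> 1) at_top"
    unfolding asymp_equiv_def .
  have "((\<lambda>x. L (c * x) / L x) \<longlongrightarrow> 1) at_top" using L c by (auto simp: slowly_varying_def)
  then have l2: "((\<lambda>n. L (c * thr n) / L (thr n)) \<longlongrightarrow> 1) at_top"
    by (rule filterlim_compose[OF _ thr_at_top])
  have "((\<lambda>n. (if F n (s n) = 0 \<and> L (s n) * s n powr (- \<alpha>) = 0 then 1
      else F n (s n) / (L (s n) * s n powr (- \<alpha>))) * (L (c * thr n) / L (thr n)) * c powr (- \<alpha>)) \<longlongrightarrow> 1 * 1 * c powr (- \<alpha>)) at_top"
    by (intro tendsto_intros l1 l2)
  moreover have "eventually (\<lambda>n. thr n > 0) at_top" using thr_at_top filterlim_at_top_dense by blast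
  then have "eventually (\<lambda>n. (if F n (s n) = 0 \<and> L (s n) * s n powr (- \<alpha>) = 0 then 1
      else F n (s n) / (L (s n) * s n powr (- \<alpha>))) * (L (c * thr n) / L (thr n)) * c powr (- \<alpha>) = real n * F n (c * thr n) / K n) at_top"
    using s_eq eventually_gt_at_top[of 1]
  proof eventually_elim
    case (elim n)
    have ln: "ln (real n) > 0" using elim by simp
    have p: "L (c * thr n) > 0" "L (thr n) > 0" "(c * thr n) powr (- \<alpha>) > 0" using elim c by (auto intro!: L_pos)
    have thr_powr: "thr n powr (- \<alpha>) = real n powr (- \<alpha> / 2) * ln (real n) powr (- \<alpha> / 2)"
      using ln by (simp add: thr_def powr_half_sqrt[symmetric] powr_powr powr_mult)
    have "real n * F n (c * thr n) / K n = F n (c * thr n) / (L (thr n) * thr n powr (- \<alpha>))"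
    proof -
      have "K n = real n * (L (thr n) * thr n powr (- \<alpha>))"
        using powr_add[of "real n" 1 "- \<alpha> / 2"] elim(3) unfolding K_eq thr_powr \<kappa>_def by simp
      then show ?thesis using elim by simp
    qed
    moreover have "(c * thr n) powr (- \<alpha>) = c powr (- \<alpha>) * thr n powr (- \<alpha>)"
      by (simp add: powr_mult)
    moreover have "c powr (- \<alpha>) > 0" "thr n powr (- \<alpha>) > 0" using c elim by auto
    ultimately show ?case using p elim(2) by simp
  qed
  ultimately show ?thesis by (auto intro: Lim_transform_eventually)
qed

subsection \<open>High-degree vertices\<close>

definition G :: "nat \<Rightarrow> (nat \<Rightarrow> nat set) pmf" where "G n = rig_pmf n (m n) (P n)"

definition attr :: "nat \<Rightarrow> nat set pmf" where "attr n = attr_pmf (m n) (P n)"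

lemma G_eq: "G n = Pi_pmf {1..n} {} (\<lambda>_. attr n)"
  by (simp add: G_def rig_pmf_def attr_def)

text \<open>Stated for bad events, which are closed under finite unions and subsets; each statement
  with high probability then becomes a deterministic inclusion for large \<open>n\<close>.\<close>

definition vanishing :: "(nat \<Rightarrow> (nat \<Rightarrow> nat set) set) \<Rightarrow> bool" where
  "vanishing E \<longleftrightarrow> ((\<lambda>n. measure_pmf.prob (G n) (E n)) \<longlongrightarrow> 0) at_top"

lemma vanishing_bound:
  assumes "eventually (\<lambda>n. measure_pmf.prob (G n) (E n) \<le> b n) at_top" "(b \<longlongrightarrow> 0) at_top"
  shows "vanishing E"
  unfolding vanishing_def
  by (rule tendsto_sandwich[OF _ assms(1) tendsto_const assms(2)]) simp

lemma vanishing_mono: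
  assumes "vanishing E" "eventually (\<lambda>n. E' n \<subseteq> E n) at_top"
  shows "vanishing E'"
proof (rule vanishing_bound)
  show "eventually (\<lambda>n. measure_pmf.prob (G n) (E' n) \<le> measure_pmf.prob (G n) (E n)) at_top"
    using assms(2) by eventually_elim (auto intro: measure_pmf.finite_measure_mono)
  show "((\<lambda>n. measure_pmf.prob (G n) (E n)) \<longlongrightarrow> 0) at_top" using assms(1) by (simp add: vanishing_def)
qed

lemma vanishing_Un:
  assumes "vanishing E1" "vanishing E2"
  shows "vanishing (\<lambda>n. E1 n \<union> E2 n)"
proof (rule vanishing_bound)
  show "eventually (\<lambda>n. measure_pmf.prob (G n) (E1 n \<union> E2 n) \<le> measure_pmf.prob (G n) (E1 n) + measure_pmf.prob (G n) (E2 n)) at_top"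
    by (intro always_eventually allI measure_Un_le) auto
  show "((\<lambda>n. measure_pmf.prob (G n) (E1 n) + measure_pmf.prob (G n) (E2 n)) \<longlongrightarrow> 0) at_top"
    using tendsto_add[OF assms[unfolded vanishing_def]] by simp
qed

text \<open>Rewrites the exponent of \<open>miss_prob_le_exp\<close> in normalised sizes: two sets
  with Y \<ge> c * sqrt (n * ln n) give at least \<open>c\<^sup>2\<close> * ln n, whatever
  \<open>m\<close> is.\<close>

lemma Yval_prod: "real a * real k / real (m n) = Yval n (m n) a * Yval n (m n) k / real n" if "n > 0"
proof -
  have "Yval n (m n) a * Yval n (m n) k = (sqrt (real n / real (m n)) * sqrt (real n / real (m n))) * (real a * real k)"
    by (simp add: Yval_def mult_ac)
  also have "\<dots> = real n / real (m n) * (real a * real k)" by simp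
  finally show ?thesis using that by simp
qed

lemma Yval_nonneg: "0 \<le> Yval n k' k"
  by (simp add: Yval_def)

definition high_attr :: "nat \<Rightarrow> real \<Rightarrow> nat set set" where
  "high_attr n x = {T. T \<subseteq> {0..<m n} \<and> card T \<in> {k. Yval n (m n) k \<ge> x}}"

lemma prob_high_attr: "measure_pmf.prob (attr n) (high_attr n x) = F n x"
  unfolding attr_def high_attr_def F_def by (rule prob_attr_card[OF P_supp])

definition high :: "nat \<Rightarrow> real \<Rightarrow> (nat \<Rightarrow> nat set) \<Rightarrow> nat set" where
  "high n x S = {v \<in> {1..n}. S v \<in> high_attr n x}"

text \<open>Distinct vertices are independent, so only the diagonal of the covariance sum remains,
  and a variance is at most the probability \<open>F n x\<close>.\<close>

lemma high_deviation:
  assumes "a > 0"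
  shows "measure_pmf.prob (G n) {S. \<bar>real (card (high n x S)) - real n * F n x\<bar> \<ge> a} \<le> real n * F n x / a\<^sup>2"
proof -
  let ?R = "\<lambda>v S. S v \<in> high_attr n x"
  have one: "measure_pmf.prob (G n) {S. ?R v S} = F n x" if "v \<in> {1..n}" for v
    using prob_Pi_pmf_inj[of "{1..n}" "{v}" "\<lambda>v. v" "{}" "attr n" "\<lambda>_. high_attr n x"] that by (simp add: G_eq prob_high_attr)
  have two: "measure_pmf.prob (G n) {S. ?R u S \<and> ?R v S} = F n x * F n x" if "u \<in> {1..n}" "v \<in> {1..n}" "u \<noteq> v" for u v
    using prob_Pi_pmf_inj[of "{1..n}" "{u, v}" "\<lambda>v. v" "{}" "attr n" "\<lambda>_. high_attr n x"] that by (simp add: G_eq prob_high_attr)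
  have cnt: "(\<Sum>v\<in>{1..n}. 1 * of_bool (?R v S)) = real (card (high n x S))" for S
    by (simp add: high_def of_bool_def sum.If_cases Int_def)
  have mean: "(\<Sum>v\<in>{1..n}. 1 * measure_pmf.prob (G n) {S. ?R v S}) = real n * F n x" using one by simp
  have "measure_pmf.prob (G n) {S. \<bar>real (card (high n x S)) - real n * F n x\<bar> \<ge> a} \<le>
    (\<Sum>u\<in>{1..n}. \<Sum>v\<in>{1..n}. 1 * 1 * (measure_pmf.prob (G n) {S. ?R u S \<and> ?R v S} -
       measure_pmf.prob (G n) {S. ?R u S} * measure_pmf.prob (G n) {S. ?R v S})) / a\<^sup>2"
    using weighted_chebyshev[where I = "{1..n}" and a = a and c = "\<lambda>_. 1" and R = ?R and M = "G n"] assms unfolding cnt mean by simp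
  also have "(\<Sum>u\<in>{1..n}. \<Sum>v\<in>{1..n}. 1 * 1 * (measure_pmf.prob (G n) {S. ?R u S \<and> ?R v S} -
       measure_pmf.prob (G n) {S. ?R u S} * measure_pmf.prob (G n) {S. ?R v S}))
     \<le> (\<Sum>u\<in>{1..n}. \<Sum>v\<in>{1..n}. if v = u then F n x else 0)"
  proof (intro sum_mono)
    fix u v assume uv: "u \<in> {1..n}" "v \<in> {1..n}"
    show "1 * 1 * (measure_pmf.prob (G n) {S. ?R u S \<and> ?R v S} -
       measure_pmf.prob (G n) {S. ?R u S} * measure_pmf.prob (G n) {S. ?R v S}) \<le> (if v = u then F n x else 0)"
      using one[OF uv(1)] one[OF uv(2)] two[OF uv] F_nonneg[of n x] by auto
  qed
  also have "\<dots> = real n * F n x" by simp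
  finally show ?thesis by (simp add: divide_right_mono)
qed

lemma high_concentration:
  assumes c: "c > 0" and \<eta>: "\<eta> > 0"
  shows "vanishing (\<lambda>n. {S. \<bar>real (card (high n (c * thr n) S)) - c powr (- \<alpha>) * K n\<bar> \<ge> \<eta> * K n})"
proof (rule vanishing_bound)
  let ?f = "\<lambda>n. real n * F n (c * thr n)"
  have lim: "((\<lambda>n. ?f n / K n) \<longlongrightarrow> c powr (- \<alpha>)) at_top" by (rule high_count[OF c])
  have "eventually (\<lambda>n. \<bar>?f n / K n - c powr (- \<alpha>)\<bar> < \<eta> / 2) at_top"
    using tendstoD[OF lim, of "\<eta> / 2"] \<eta> by (simp add: dist_real_def)
  then show "eventually (\<lambda>n. measure_pmf.prob (G n) {S. \<bar>real (card (high n (c * thr n) S)) - c powr (- \<alpha>) * K n\<bar> \<ge> \<eta> * K n}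
     \<le> ?f n / K n * (4 / \<eta>\<^sup>2) * (1 / K n)) at_top"
    using K_pos
  proof eventually_elim
    case (elim n)
    have "\<bar>?f n - c powr (- \<alpha>) * K n\<bar> = \<bar>?f n / K n - c powr (- \<alpha>)\<bar> * \<bar>K n\<bar>"
    proof -
      have "?f n - c powr (- \<alpha>) * K n = (?f n / K n - c powr (- \<alpha>)) * K n" using elim(2) by (simp add: left_diff_distrib)
      then show ?thesis by (simp only: abs_mult)
    qed
    also have "\<dots> \<le> \<eta> / 2 * K n" using elim by (simp add: mult_right_mono)
    finally have d: "\<bar>?f n - c powr (- \<alpha>) * K n\<bar> \<le> \<eta> / 2 * K n" .
    have "measure_pmf.prob (G n) {S. \<bar>real (card (high n (c * thr n) S)) - c powr (- \<alpha>) * K n\<bar> \<ge> \<eta> * K n}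
      \<le> measure_pmf.prob (G n) {S. \<bar>real (card (high n (c * thr n) S)) - ?f n\<bar> \<ge> \<eta> / 2 * K n}"
    proof (intro measure_pmf.finite_measure_mono subsetI CollectI, unfold mem_Collect_eq)
      fix S assume "\<eta> * K n \<le> \<bar>real (card (high n (c * thr n) S)) - c powr (- \<alpha>) * K n\<bar>"
      then show "\<eta> / 2 * K n \<le> \<bar>real (card (high n (c * thr n) S)) - ?f n\<bar>" using d by linarith
    qed simp
    also have "\<dots> \<le> ?f n / (\<eta> / 2 * K n)\<^sup>2" using elim \<eta> by (intro high_deviation) simp
    also have "\<dots> = ?f n / K n * (4 / \<eta>\<^sup>2) * (1 / K n)" by (simp add: power2_eq_square)
    finally show ?case .
  qed
  have "((\<lambda>n. 1 / K n) \<longlongrightarrow> 0) at_top"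
    using tendsto_divide_0[OF tendsto_const] K_at_top filterlim_at_top_imp_at_infinity by blast
  from tendsto_mult[OF tendsto_mult[OF lim tendsto_const[of "4 / \<eta>\<^sup>2"]] this]
  show "((\<lambda>n. ?f n / K n * (4 / \<eta>\<^sup>2) * (1 / K n)) \<longlongrightarrow> 0) at_top" by simp
qed

definition nonadj :: "nat \<Rightarrow> real \<Rightarrow> (nat \<Rightarrow> nat set) \<Rightarrow> (nat \<times> nat) set" where
  "nonadj n x S = {(u, v) \<in> high n x S \<times> high n x S. u < v \<and> S u \<inter> S v = {}}"

lemma prob_nonadj_pair:
  assumes uv: "u \<in> {1..n}" "v \<in> {1..n}" "u \<noteq> v" and x: "x \<ge> 0"
  shows "measure_pmf.prob (G n) {S. S u \<in> high_attr n x \<and> S v \<in> high_attr n x \<and> S u \<inter> S v = {}}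
    \<le> (F n x)\<^sup>2 * exp (- (x\<^sup>2 / real n))"
proof -
  have n: "n > 0" using uv by simp
  let ?M = "\<lambda>f :: nat \<Rightarrow> nat set. {T. T \<subseteq> {0..<m n} \<and> card T \<in> {k. Yval n (m n) k \<ge> x} \<and> T \<in> {T. T \<inter> f u = {}}}"
  have bound: "measure_pmf.prob (attr n) (?M f) \<le> exp (- (x\<^sup>2 / real n)) * F n x" if f: "\<forall>i\<in>{u}. f i \<in> high_attr n x" for f
    unfolding attr_def F_def
  proof (rule prob_attr_le[OF P_supp])
    fix k assume k: "k \<in> {k. x \<le> Yval n (m n) k}" "k \<le> m n"
    have fu: "f u \<subseteq> {0..<m n}" "Yval n (m n) (card (f u)) \<ge> x" using f by (auto simp: high_attr_def)
    have cm: "card (f u) \<le> m n" using card_mono[OF _ fu(1)] by simp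
    have "measure_pmf.prob (ksub (m n) k) {T. T \<inter> f u = {}} = miss_prob (m n) k (card (f u))"
      using k fu by (intro prob_ksub_miss) auto
    also have "\<dots> \<le> exp (- (real (card (f u)) * real k / real (m n)))" by (rule miss_prob_le_exp[OF k(2) cm])
    also have "\<dots> \<le> exp (- (x\<^sup>2 / real n))"
    proof -
      have "x * x \<le> Yval n (m n) (card (f u)) * Yval n (m n) k" using fu k x by (intro mult_mono) auto
      then show ?thesis unfolding Yval_prod[OF n] by (simp add: power2_eq_square divide_right_mono)
    qed
    finally show "measure_pmf.prob (ksub (m n) k) {T. T \<inter> f u = {}} \<le> exp (- (x\<^sup>2 / real n))" .
  qed
  have "measure_pmf.prob (G n) {S. (\<forall>i\<in>{u}. S i \<in> high_attr n x) \<and> True \<and> (\<forall>j\<in>{v}. S j \<in> ?M S)} \<le>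
     measure_pmf.prob (attr n) (high_attr n x) ^ card {u} * (exp (- (x\<^sup>2 / real n)) * F n x) ^ card {v}"
    unfolding G_eq
  proof (rule two_block_bound)
    fix f g :: "nat \<Rightarrow> nat set" assume "\<forall>i\<in>{u}. f i = g i"
    then show "True = True \<and> ?M f = ?M g" by simp
  qed (use uv bound F_nonneg in auto)
  also have "{S. (\<forall>i\<in>{u}. S i \<in> high_attr n x) \<and> True \<and> (\<forall>j\<in>{v}. S j \<in> ?M S)} =
     {S. S u \<in> high_attr n x \<and> S v \<in> high_attr n x \<and> S u \<inter> S v = {}}"
    by (auto simp: high_attr_def)
  finally show ?thesis by (simp add: prob_high_attr power2_eq_square mult_ac)
qed

text \<open>The expected number of pairs is of order \<open>K n\<close>^2 * n powr
  (-\<open>c\<^sup>2\<close>). Markov's inequality at level \<eta> * \<open>K n\<close> leaves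
  \<open>K n\<close> * n powr (-\<open>c\<^sup>2\<close>), which tends to 0 because
  \<open>K n\<close> = n powr (\<kappa> + o(1)).\<close>

lemma nonadj_few:
  assumes c: "c > 0" "c\<^sup>2 > \<kappa>" and \<eta>: "\<eta> > 0"
  shows "vanishing (\<lambda>n. {S. real (card (nonadj n (c * thr n) S)) \<ge> \<eta> * K n})"
proof (rule vanishing_bound)
  let ?f = "\<lambda>n. real n * F n (c * thr n)"
  have lim: "((\<lambda>n. ?f n / K n) \<longlongrightarrow> c powr (- \<alpha>)) at_top" by (rule high_count[OF c(1)])
  show "eventually (\<lambda>n. measure_pmf.prob (G n) {S. real (card (nonadj n (c * thr n) S)) \<ge> \<eta> * K n}
      \<le> (?f n / K n)\<^sup>2 * (K n * real n powr (- (c\<^sup>2))) * (1 / \<eta>)) at_top"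
    using K_pos eventually_gt_at_top[of 1]
  proof eventually_elim
    case (elim n)
    let ?x = "c * thr n"
    let ?I = "{(u, v) \<in> {1..n} \<times> {1..n}. u < v}"
    let ?R = "\<lambda>(u, v) S. S u \<in> high_attr n ?x \<and> S v \<in> high_attr n ?x \<and> S u \<inter> S v = {}"
    have finI: "finite ?I" by (rule finite_subset[of _ "{1..n} \<times> {1..n}"]) auto
    have "card ?I \<le> card ({1..n} \<times> {1..n})" by (rule card_mono) auto
    then have cI: "card ?I \<le> n * n" by simp
    have x0: "?x \<ge> 0" using c elim by (simp add: thr_def)
    have ex: "exp (- (?x\<^sup>2 / real n)) = real n powr (- (c\<^sup>2))"
      using elim by (simp add: thr_def power_mult_distrib powr_def)
    have na: "nonadj n ?x S = {e \<in> ?I. ?R e S}" for S by (auto simp: nonadj_def high_def)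
    have "measure_pmf.prob (G n) {S. real (card (nonadj n ?x S)) \<ge> \<eta> * K n} \<le>
       (\<Sum>e\<in>?I. measure_pmf.prob (G n) {S. ?R e S}) / (\<eta> * K n)"
      unfolding na using finI elim \<eta> by (intro markov_count) auto
    also have "\<dots> \<le> (\<Sum>e\<in>?I. (F n ?x)\<^sup>2 * real n powr (- (c\<^sup>2))) / (\<eta> * K n)"
    proof (rule divide_right_mono[OF sum_mono])
      fix e assume "e \<in> ?I"
      then show "measure_pmf.prob (G n) {S. ?R e S} \<le> (F n ?x)\<^sup>2 * real n powr (- (c\<^sup>2))"
        using prob_nonadj_pair[OF _ _ _ x0, of "fst e" n "snd e"] unfolding ex by (cases e) auto
    qed (use elim \<eta> in simp)
    also have "\<dots> = real (card ?I) * ((F n ?x)\<^sup>2 * real n powr (- (c\<^sup>2))) / (\<eta> * K n)" by simp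
    also have "\<dots> \<le> real (n * n) * ((F n ?x)\<^sup>2 * real n powr (- (c\<^sup>2))) / (\<eta> * K n)"
      using cI elim \<eta> by (intro divide_right_mono mult_right_mono of_nat_mono) auto
    also have "\<dots> = (?f n / K n)\<^sup>2 * (K n * real n powr (- (c\<^sup>2))) * (1 / \<eta>)"
      using elim(1) by (simp add: power2_eq_square mult_ac)
    finally show ?case .
  qed
  define d where "d = (c\<^sup>2 - \<kappa>) / 2"
  have d: "d > 0" using c by (simp add: d_def)
  have z: "((\<lambda>n. K n * real n powr (- (c\<^sup>2))) \<longlongrightarrow> 0) at_top"
  proof (rule tendsto_sandwich[OF _ _ tendsto_const])
    show "eventually (\<lambda>n. 0 \<le> K n * real n powr (- (c\<^sup>2))) at_top" using K_pos by eventually_elim simp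
    show "eventually (\<lambda>n. K n * real n powr (- (c\<^sup>2)) \<le> real n powr (- d)) at_top"
      using K_upper[OF d]
    proof eventually_elim
      case (elim n)
      have "K n * real n powr (- (c\<^sup>2)) \<le> real n powr (\<kappa> + d) * real n powr (- (c\<^sup>2))"
        using elim by (intro mult_right_mono) auto
      also have "\<dots> = real n powr (\<kappa> + d - c\<^sup>2)" by (simp flip: powr_add)
      also have "\<kappa> + d - c\<^sup>2 = - d" by (simp add: d_def field_simps)
      finally show ?case .
    qed
    show "((\<lambda>n. real n powr (- d)) \<longlongrightarrow> 0) at_top" using d by real_asymp
  qed
  from tendsto_mult[OF tendsto_mult[OF tendsto_power[OF lim, of 2] z] tendsto_const[of "1 / \<eta>"]]
  show "((\<lambda>n. (?f n / K n)\<^sup>2 * (K n * real n powr (- (c\<^sup>2))) * (1 / \<eta>)) \<longlongrightarrow> 0) at_top" by simp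
qed

lemma clique_number_lower:
  assumes c: "c > 0" "c\<^sup>2 > \<kappa>" and \<eta>: "\<eta> > 0"
  shows "vanishing (\<lambda>n. {S. real (clique_number n S) \<le> (c powr (- \<alpha>) - \<eta>) * K n})"
proof (rule vanishing_mono[OF vanishing_Un])
  show "vanishing (\<lambda>n. {S. \<bar>real (card (high n (c * thr n) S)) - c powr (- \<alpha>) * K n\<bar> \<ge> \<eta> / 2 * K n})"
    using c \<eta> by (intro high_concentration) auto
  show "vanishing (\<lambda>n. {S. real (card (nonadj n (c * thr n) S)) \<ge> \<eta> / 2 * K n})"
    using c \<eta> by (intro nonadj_few) auto
  show "eventually (\<lambda>n. {S. real (clique_number n S) \<le> (c powr (- \<alpha>) - \<eta>) * K n} \<subseteq>
     {S. \<bar>real (card (high n (c * thr n) S)) - c powr (- \<alpha>) * K n\<bar> \<ge> \<eta> / 2 * K n} \<union>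
     {S. real (card (nonadj n (c * thr n) S)) \<ge> \<eta> / 2 * K n}) at_top"
  proof (intro always_eventually allI subsetI)
    fix n S assume S: "S \<in> {S. real (clique_number n S) \<le> (c powr (- \<alpha>) - \<eta>) * K n}"
    have "high n (c * thr n) S \<subseteq> {1..n}" by (auto simp: high_def)
    from clique_number_ge_delete[OF this, of S]
    have "real (card (high n (c * thr n) S)) \<le> real (clique_number n S) + real (card (nonadj n (c * thr n) S))"
      unfolding nonadj_def by (simp flip: of_nat_add)
    with S show "S \<in> {S. \<bar>real (card (high n (c * thr n) S)) - c powr (- \<alpha>) * K n\<bar> \<ge> \<eta> / 2 * K n} \<union>
     {S. real (card (nonadj n (c * thr n) S)) \<ge> \<eta> / 2 * K n}"
      by (auto simp: left_diff_distrib)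
  qed
qed

subsection \<open>Low-degree vertices\<close>

definition wf_attr :: "nat \<Rightarrow> (nat \<Rightarrow> nat set) set" where
  "wf_attr n = {S. \<forall>v\<in>{1..n}. S v \<subseteq> {0..<m n}}"

lemma vanishing_not_wf: "vanishing (\<lambda>n. - wf_attr n)"
proof -
  have "measure_pmf.prob (attr n) {T. T \<subseteq> {0..<m n}} = 1" for n
    using prob_attr_card[OF P_supp, of n UNIV] by (simp add: attr_def)
  then have "measure_pmf.prob (G n) (wf_attr n) = 1" for n
    using prob_Pi_pmf_inj[of "{1..n}" "{1..n}" "\<lambda>v. v" "{}" "attr n" "\<lambda>_. {T. T \<subseteq> {0..<m n}}"]
    by (simp add: G_eq wf_attr_def)
  then have "measure_pmf.prob (G n) (- wf_attr n) = 0" for n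
    using measure_pmf.prob_compl[of "wf_attr n" "G n"] by (simp add: Compl_eq_Diff_UNIV)
  then show ?thesis by (simp add: vanishing_def)
qed

lemma mean_bound:
  obtains C where "C > 0" "eventually (\<lambda>n. measure_pmf.expectation (P n) (\<lambda>k. Yval n (m n) k) \<le> C) at_top"
proof -
  from A obtain C where C: "C > 0" "eventually (\<lambda>n. norm (measure_pmf.expectation (P n) (\<lambda>k. Yval n (m n) k)) \<le> C * norm (1::real)) at_top"
    unfolding condA_def by (auto elim: landau_o.bigE)
  show ?thesis by (rule that[OF C(1)], use C(2) in eventually_elim) auto
qed

lemma m_lower:
  obtains c where "c > 0" "eventually (\<lambda>n. c * real n powr \<beta> \<le> real (m n)) at_top"
proof -
  from m_growth obtain c where c: "c > 0" "eventually (\<lambda>n. norm (real (m n)) \<ge> c * norm (real n powr \<beta>)) at_top"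
    by (auto elim: landau_omega.bigE)
  show ?thesis by (rule that[OF c(1)], use c(2) in eventually_elim) auto
qed

lemma ratio_Yval: "n > 0 \<Longrightarrow> real k / real (m n) = Yval n (m n) k / sqrt (real n * real (m n))"
  using m_pos[of n] by (simp add: Yval_def real_sqrt_divide real_sqrt_mult)

lemma integrable_P: "integrable (measure_pmf (P n)) (f :: nat \<Rightarrow> real)"
  using P_supp[of n] by (intro integrable_measure_pmf_finite) (auto intro: finite_subset)

text \<open>The truncation Y \<le> B trades all but one power of Y for powers of \<open>B\<close>,
  so a bound on the mean controls every truncated moment.\<close>

lemma moment_bound:
  assumes n: "n > 0" and r: "r \<ge> 1" and B: "\<And>k. k \<in> M \<Longrightarrow> Yval n (m n) k \<le> B" and B0: "B \<ge> 0"
    and C: "measure_pmf.expectation (P n) (\<lambda>k. Yval n (m n) k) \<le> C"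
  shows "measure_pmf.expectation (P n) (\<lambda>k. (real k / real (m n)) ^ r * indicator M k) \<le> C * B ^ (r - 1) / sqrt (real n * real (m n)) ^ r"
proof -
  let ?s = "sqrt (real n * real (m n))"
  have s: "?s > 0" using n m_pos[of n] by simp
  have "measure_pmf.expectation (P n) (\<lambda>k. (real k / real (m n)) ^ r * indicator M k) \<le>
      measure_pmf.expectation (P n) (\<lambda>k. B ^ (r - 1) / ?s ^ r * Yval n (m n) k)"
  proof (rule integral_mono[OF integrable_P integrable_P])
    fix k
    show "(real k / real (m n)) ^ r * indicator M k \<le> B ^ (r - 1) / ?s ^ r * Yval n (m n) k"
    proof (cases "k \<in> M")
      case True
      have "Yval n (m n) k ^ r = Yval n (m n) k ^ (r - 1) * Yval n (m n) k" using r by (cases r) auto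
      also have "\<dots> \<le> B ^ (r - 1) * Yval n (m n) k"
        using B[OF True] Yval_nonneg by (intro mult_right_mono power_mono) auto
      finally show ?thesis using True s by (simp add: ratio_Yval[OF n] power_divide divide_right_mono)
    next
      case False
      then show ?thesis using s B0 Yval_nonneg by simp
    qed
  qed
  also have "\<dots> = B ^ (r - 1) / ?s ^ r * measure_pmf.expectation (P n) (\<lambda>k. Yval n (m n) k)" by simp
  also have "\<dots> \<le> B ^ (r - 1) / ?s ^ r * C" using C B0 s by (intro mult_left_mono) auto
  finally show ?thesis by (simp add: mult_ac)
qed

text \<open>A quarter of \<beta> - (\<alpha> - 1). The mean number of owners of an attribute is at
  most of order n powr (\<kappa> - 2 * \<gamma>), so the level n powr (\<kappa> - \<gamma>) of
  \<open>heavy_size\<close> leaves a factor n powr \<gamma> both above this mean and, up to o(1) in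
  the exponent, below \<open>K n\<close>.\<close>

definition \<gamma> :: real where "\<gamma> = (1 - \<alpha> + \<beta>) / 4"

lemma \<gamma>: "0 < \<gamma>" "2 * \<gamma> \<le> \<kappa>" "(1 - \<beta>) / 2 = \<kappa> - 2 * \<gamma>"
  using beta alpha by (auto simp: \<gamma>_def \<kappa>_def field_simps)

definition heavy_size :: "nat \<Rightarrow> nat" where "heavy_size n = nat \<lceil>real n powr (\<kappa> - \<gamma>)\<rceil>"

definition heavy :: "nat \<Rightarrow> (nat \<Rightarrow> nat set) set" where
  "heavy n = {S. \<exists>w<m n. \<exists>T\<subseteq>{1..n}. card T = heavy_size n \<and> (\<forall>v\<in>T. w \<in> S v)}"

text \<open>Since E Y \<le> C, a set contains a given attribute with probability at most C / sqrt (n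
  * m); the bound is the union over attributes and over vertex sets of the critical size.\<close>

lemma prob_heavy:
  assumes n: "n > 0" and d: "heavy_size n > 0" and C: "measure_pmf.expectation (P n) (\<lambda>k. Yval n (m n) k) \<le> C"
  shows "measure_pmf.prob (G n) (heavy n) \<le> real (m n) * (exp 1 * C * sqrt (real n / real (m n)) / real (heavy_size n)) ^ heavy_size n"
proof -
  let ?d = "heavy_size n"
  let ?s = "sqrt (real n * real (m n))"
  let ?I = "{0..<m n} \<times> {T. T \<subseteq> {1..n} \<and> card T = ?d}"
  let ?R = "\<lambda>(w, T) S. \<forall>v\<in>T. w \<in> S v"
  have C0: "C \<ge> 0" by (rule order_trans[OF _ C]) (intro Bochner_Integration.integral_nonneg Yval_nonneg)
  have finI: "finite ?I" by (intro finite_cartesian_product) auto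
  have one: "measure_pmf.prob (attr n) {T. w \<in> T} \<le> C / ?s" if w: "w < m n" for w
  proof -
    have "measure_pmf.prob (attr n) {T. {w} \<subseteq> T \<and> card T \<in> UNIV} \<le>
       measure_pmf.expectation (P n) (\<lambda>k. (real k / real (m n)) ^ card {w} * indicator UNIV k)"
      unfolding attr_def using w by (intro prob_attr_contain P_supp) auto
    also have "\<dots> = measure_pmf.expectation (P n) (\<lambda>k. Yval n (m n) k / ?s)"
      by (simp add: ratio_Yval[OF n])
    also have "\<dots> = measure_pmf.expectation (P n) (\<lambda>k. Yval n (m n) k) / ?s" by simp
    also have "\<dots> \<le> C / ?s" using C by (intro divide_right_mono) auto
    finally show ?thesis by simp
  qed
  have "measure_pmf.prob (G n) (heavy n) \<le> measure_pmf.prob (G n) {S. \<exists>e\<in>?I. ?R e S}"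
  proof (rule measure_pmf.finite_measure_mono, rule subsetI)
    fix S assume "S \<in> heavy n"
    then obtain w T where "w < m n" "T \<subseteq> {1..n}" "card T = ?d" "\<forall>v\<in>T. w \<in> S v" unfolding heavy_def by blast
    then show "S \<in> {S. \<exists>e\<in>?I. ?R e S}" by (intro CollectI bexI[of _ "(w, T)"]) auto
  qed simp
  also have "\<dots> \<le> (\<Sum>e\<in>?I. measure_pmf.prob (G n) {S. ?R e S})" by (rule union_count[OF finI])
  also have "\<dots> \<le> (\<Sum>e\<in>?I. (C / ?s) ^ ?d)"
  proof (rule sum_mono)
    fix e assume "e \<in> ?I"
    then obtain w T where e: "e = (w, T)" "w < m n" "T \<subseteq> {1..n}" "card T = ?d" by auto
    have fT: "finite T" using finite_subset[OF e(3)] by simp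
    have "measure_pmf.prob (G n) {S. \<forall>v\<in>T. S v \<in> {T. w \<in> T}} = (\<Prod>v\<in>T. measure_pmf.prob (attr n) {T. w \<in> T})"
      unfolding G_eq by (rule prob_Pi_pmf_inj[where f="\<lambda>v. v"]) (use e fT in auto)
    also have "\<dots> \<le> (C / ?s) ^ ?d" using one[OF e(2)] e(4) by (simp add: power_mono)
    finally show "measure_pmf.prob (G n) {S. ?R e S} \<le> (C / ?s) ^ ?d" using e by simp
  qed
  also have "\<dots> = real (m n) * (real (n choose ?d) * (C / ?s) ^ ?d)"
    by (simp add: card_cartesian_product n_subsets)
  also have "\<dots> \<le> real (m n) * ((exp 1 * real n / real ?d) ^ ?d * (C / ?s) ^ ?d)"
    using C0 by (intro mult_left_mono mult_right_mono choose_le_exp_pow d) auto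
  also have "\<dots> = real (m n) * (exp 1 * C * (real n / ?s) / real ?d) ^ ?d"
    by (simp add: mult_ac flip: power_mult_distrib)
  also have "real n / ?s = sqrt (real n / real (m n))"
    using n m_pos[of n] by (simp add: real_sqrt_mult real_sqrt_divide field_simps)
  finally show ?thesis .
qed

lemma vanishing_heavy: "vanishing heavy"
proof -
  obtain C where C: "C > 0" "eventually (\<lambda>n. measure_pmf.expectation (P n) (\<lambda>k. Yval n (m n) k) \<le> C) at_top"
    by (rule mean_bound)
  obtain c where c: "c > 0" "eventually (\<lambda>n. c * real n powr \<beta> \<le> real (m n)) at_top" by (rule m_lower)
  \<comment> \<open>The base \<open>y\<close> below is at most n powr (-\<gamma>/2), so
    \<open>k\<close> factors of it give n powr (-2).\<close>
  define k where "k = nat \<lceil>4 / \<gamma>\<rceil>"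
  have k: "real k * \<gamma> \<ge> 4" using \<gamma>(1) unfolding k_def
    by (metis le_of_int_ceiling of_nat_nat pos_divide_le_eq real_nat_ceiling_ge)
  let ?b = "\<lambda>n. (exp 1 * C)\<^sup>2 * real n powr (- 1)"
  show ?thesis
  proof (rule vanishing_bound[of _ ?b])
    have e1: "eventually (\<lambda>n. exp 1 * C / sqrt c * real n powr (- \<gamma>) \<le> real n powr (- (\<gamma>/2))) at_top"
      using \<gamma>(1) C(1) c(1) by real_asymp
    have "\<kappa> - \<gamma> > 0" using \<gamma> by linarith
    then have e2: "eventually (\<lambda>n. real k + 2 \<le> real n powr (\<kappa> - \<gamma>)) at_top" by real_asymp
    show "eventually (\<lambda>n. measure_pmf.prob (G n) (heavy n) \<le> ?b n) at_top"
      using C(2) c(2) e1 e2 eventually_gt_at_top[of 1]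
    proof eventually_elim
      case (elim n)
      let ?d = "heavy_size n"
      define y where "y = exp 1 * C * sqrt (real n / real (m n)) / real ?d"
      have n: "real n > 1" using elim by simp
      have dge: "real ?d \<ge> real n powr (\<kappa> - \<gamma>)" unfolding heavy_size_def by linarith
      then have dk: "?d \<ge> k + 2" using elim(4) by linarith
      have y0: "y \<ge> 0" using C by (simp add: y_def)
      have "sqrt (real n / real (m n)) \<le> sqrt (real n / (c * real n powr \<beta>))"
        using elim n c m_pos[of n] by (intro real_sqrt_le_mono divide_left_mono) (auto intro!: mult_pos_pos)
      also have "\<dots> = real n powr ((1 - \<beta>) / 2) / sqrt c"
      proof -
        have "real n / (c * real n powr \<beta>) = real n powr (1 - \<beta>) / c" using n by (simp add: powr_diff)
        then show ?thesis by (simp add: real_sqrt_divide powr_half_sqrt_powr)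
      qed
      finally have "y \<le> exp 1 * C * (real n powr ((1 - \<beta>) / 2) / sqrt c) / real n powr (\<kappa> - \<gamma>)"
        unfolding y_def using dge C n c by (intro frac_le mult_left_mono) auto
      also have "\<dots> = exp 1 * C / sqrt c * real n powr (- \<gamma>)"
      proof -
        have "real n powr (\<kappa> - 2 * \<gamma>) = real n powr (- \<gamma>) * real n powr (\<kappa> - \<gamma>)" by (simp flip: powr_add)
        then show ?thesis unfolding \<gamma>(3) using n by simp
      qed
      finally have y1: "y \<le> real n powr (- (\<gamma>/2))" using elim(3) by linarith
      have y2: "y \<le> 1" using y1 n \<gamma>(1) powr_mono[of "- (\<gamma>/2)" 0 "real n"] by simp
      have "y ^ (?d - 2) \<le> y ^ k" using y0 y2 dk by (intro power_decreasing) auto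
      also have "\<dots> \<le> (real n powr (- (\<gamma>/2))) ^ k" using y0 y1 by (intro power_mono)
      also have "\<dots> = real n powr (- (\<gamma>/2) * real k)" using n by (simp add: powr_powr flip: powr_realpow)
      also have "\<dots> \<le> real n powr (- 2)" using n k by (intro powr_mono) (auto simp: mult.commute)
      finally have y3: "y ^ (?d - 2) \<le> real n powr (- 2)" .
      \<comment> \<open>There is no upper bound on \<open>m n\<close>, so the number of attributes
        in the union bound must be cancelled: \<open>y\<^sup>2\<close> carries a factor 1 / m. Two
        factors of \<open>y\<close> are set aside for this, hence the 2 in
        \<open>k + 2\<close>.\<close>
      have my: "real (m n) * y\<^sup>2 \<le> (exp 1 * C)\<^sup>2 * real n"
      proof -
        have "real (m n) * y\<^sup>2 = (exp 1 * C)\<^sup>2 * real n / (real ?d)\<^sup>2"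
          using m_pos[of n] by (simp add: y_def power_mult_distrib power_divide)
        also have "\<dots> \<le> (exp 1 * C)\<^sup>2 * real n / 1" using dk by (intro divide_left_mono) auto
        finally show ?thesis by simp
      qed
      have "measure_pmf.prob (G n) (heavy n) \<le> real (m n) * y ^ ?d"
        unfolding y_def using elim dk by (intro prob_heavy) auto
      also have "y ^ ?d = y\<^sup>2 * y ^ (?d - 2)"
      proof -
        have "?d = 2 + (?d - 2)" using dk by simp
        then show ?thesis by (metis power_add)
      qed
      also have "real (m n) * (y\<^sup>2 * y ^ (?d - 2)) = (real (m n) * y\<^sup>2) * y ^ (?d - 2)" by simp
      also have "\<dots> \<le> ((exp 1 * C)\<^sup>2 * real n) * real n powr (- 2)"
        by (rule mult_mono[OF my y3]) (use y0 in auto)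
      also have "\<dots> = (exp 1 * C)\<^sup>2 * (real n powr 1 * real n powr (- 2))" using n by simp
      also have "real n powr 1 * real n powr (- 2) = real n powr (- 1)" by (subst powr_add[symmetric]) simp
      finally show ?case .
    qed
    show "(?b \<longlongrightarrow> 0) at_top" by real_asymp
  qed
qed

section \<open>Rainbow cliques of small sets\<close>

definition small_sizes :: "nat \<Rightarrow> real \<Rightarrow> nat set" where
  "small_sizes n \<delta> = {k. Yval n (m n) k < real n powr (1/2 - \<delta>)}"

definition rainbow :: "real \<Rightarrow> nat \<Rightarrow> nat \<Rightarrow> (nat \<Rightarrow> nat set) set" where
  "rainbow \<delta> r n = {S. \<exists>f\<in>{..<r} \<rightarrow>\<^sub>E {1..n}. \<exists>c\<in>pairs r \<rightarrow>\<^sub>E {0..<m n}. inj_on f {..<r} \<and> inj_on c (pairs r) \<and>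
     (\<forall>(i, j)\<in>pairs r. c (i, j) \<in> S (f i) \<and> c (i, j) \<in> S (f j)) \<and> (\<forall>i<r. card (S (f i)) \<in> small_sizes n \<delta>)}"

text \<open>Distinct colours force each of the \<open>r\<close> independent sets to contain r - 1
  prescribed distinct attributes, at a cost of m powr (-(r - 1)/2) each. The product cancels exactly
  against the m^(r(r-1)/2) possible colourings, so the bound does not involve
  \<open>m\<close>.\<close>

lemma prob_rainbow:
  assumes n: "n > 0" and r: "r \<ge> 2" and C: "measure_pmf.expectation (P n) (\<lambda>k. Yval n (m n) k) \<le> C"
  shows "measure_pmf.prob (G n) (rainbow \<delta> r n) \<le> (C * real n * (real n powr (1/2 - \<delta>)) ^ (r - 2) / sqrt (real n) ^ (r - 1)) ^ r"
proof -
  let ?s = "sqrt (real n * real (m n))"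
  let ?B = "real n powr (1/2 - \<delta>)"
  let ?F = "{f \<in> {..<r} \<rightarrow>\<^sub>E {1..n}. inj_on f {..<r}}" and ?C = "{c \<in> pairs r \<rightarrow>\<^sub>E {0..<m n}. inj_on c (pairs r)}"
  let ?inc = "\<lambda>i. {e \<in> pairs r. i = fst e \<or> i = snd e}"
  let ?q = "C * ?B ^ (r - 2) / ?s ^ (r - 1)"
  let ?R = "\<lambda>(f, c) S. \<forall>i\<in>{..<r}. S (f i) \<in> {T. c ` ?inc i \<subseteq> T \<and> card T \<in> small_sizes n \<delta>}"
  have C0: "C \<ge> 0" by (rule order_trans[OF _ C]) (intro Bochner_Integration.integral_nonneg Yval_nonneg)
  have finI: "finite (?F \<times> ?C)"
    by (intro finite_cartesian_product finite_subset[of ?F "{..<r} \<rightarrow>\<^sub>E {1..n}"] finite_subset[of ?C "pairs r \<rightarrow>\<^sub>E {0..<m n}"] finite_PiE) auto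
  have cardF: "card ?F \<le> n ^ r"
  proof -
    have "card ?F \<le> card ({..<r} \<rightarrow>\<^sub>E {1..n})" by (intro card_mono finite_PiE) auto
    then show ?thesis by (simp add: card_PiE)
  qed
  have cardC: "card ?C \<le> m n ^ card (pairs r)"
  proof -
    have "card ?C \<le> card (pairs r \<rightarrow>\<^sub>E {0..<m n})" by (intro card_mono finite_PiE) auto
    then show ?thesis by (simp add: card_PiE)
  qed
  have one: "measure_pmf.prob (G n) {S. ?R e S} \<le> ?q ^ r" if e: "e \<in> ?F \<times> ?C" for e
  proof -
    obtain f c where fc: "e = (f, c)" "f \<in> {..<r} \<rightarrow>\<^sub>E {1..n}" "inj_on f {..<r}" "c \<in> pairs r \<rightarrow>\<^sub>E {0..<m n}" "inj_on c (pairs r)"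
      using e by auto
    have "measure_pmf.prob (G n) {S. \<forall>i\<in>{..<r}. S (f i) \<in> {T. c ` ?inc i \<subseteq> T \<and> card T \<in> small_sizes n \<delta>}} =
       (\<Prod>i\<in>{..<r}. measure_pmf.prob (attr n) {T. c ` ?inc i \<subseteq> T \<and> card T \<in> small_sizes n \<delta>})"
      unfolding G_eq using fc by (intro prob_Pi_pmf_inj) auto
    also have "\<dots> \<le> (\<Prod>i\<in>{..<r}. ?q)"
    proof (rule prod_mono, rule conjI)
      fix i assume i: "i \<in> {..<r}"
      have "inj_on c (?inc i)" using fc(5) by (rule inj_on_subset) auto
      then have card: "card (c ` ?inc i) = r - 1" using card_incident_pairs[of i r] i by (simp add: card_image)
      have "measure_pmf.prob (attr n) {T. c ` ?inc i \<subseteq> T \<and> card T \<in> small_sizes n \<delta>} \<le>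
         measure_pmf.expectation (P n) (\<lambda>k. (real k / real (m n)) ^ (r - 1) * indicator (small_sizes n \<delta>) k)"
        unfolding attr_def card[symmetric] using fc(4) by (intro prob_attr_contain P_supp) auto
      also have "\<dots> \<le> C * ?B ^ (r - 1 - 1) / ?s ^ (r - 1)"
        using r by (intro moment_bound n C) (auto simp: small_sizes_def)
      finally show "measure_pmf.prob (attr n) {T. c ` ?inc i \<subseteq> T \<and> card T \<in> small_sizes n \<delta>} \<le> ?q"
        by (simp add: numeral_2_eq_2)
    qed simp
    also have "\<dots> = ?q ^ r" by simp
    finally show ?thesis unfolding fc(1) by simp
  qed
  have "measure_pmf.prob (G n) (rainbow \<delta> r n) \<le> measure_pmf.prob (G n) {S. \<exists>e\<in>?F \<times> ?C. ?R e S}"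
  proof (rule measure_pmf.finite_measure_mono, rule subsetI)
    fix S assume "S \<in> rainbow \<delta> r n"
    then obtain f c where fc: "f \<in> {..<r} \<rightarrow>\<^sub>E {1..n}" "c \<in> pairs r \<rightarrow>\<^sub>E {0..<m n}" "inj_on f {..<r}" "inj_on c (pairs r)"
       "\<forall>(i, j)\<in>pairs r. c (i, j) \<in> S (f i) \<and> c (i, j) \<in> S (f j)" "\<forall>i<r. card (S (f i)) \<in> small_sizes n \<delta>"
      unfolding rainbow_def by blast
    have "?R (f, c) S"
    proof (simp only: prod.case, intro ballI CollectI conjI)
      fix i assume i: "i \<in> {..<r}"
      then show "card (S (f i)) \<in> small_sizes n \<delta>" using fc(6) by simp
      show "c ` ?inc i \<subseteq> S (f i)" using fc(5) by fastforce
    qed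
    moreover have "(f, c) \<in> ?F \<times> ?C" using fc(1-4) by simp
    ultimately show "S \<in> {S. \<exists>e\<in>?F \<times> ?C. ?R e S}" by (intro CollectI bexI[of _ "(f, c)"])
  qed simp
  also have "\<dots> \<le> (\<Sum>e\<in>?F \<times> ?C. measure_pmf.prob (G n) {S. ?R e S})" by (rule union_count[OF finI])
  also have "\<dots> \<le> (\<Sum>e\<in>?F \<times> ?C. ?q ^ r)" by (rule sum_mono) (rule one)
  also have "\<dots> = real (card ?F * card ?C) * ?q ^ r" by (simp add: card_cartesian_product)
  also have "\<dots> \<le> real (n ^ r * m n ^ card (pairs r)) * ?q ^ r"
    using C0 cardF cardC by (intro mult_right_mono of_nat_mono mult_mono) auto
  also have "\<dots> = (C * real n * ?B ^ (r - 2) / sqrt (real n) ^ (r - 1)) ^ r"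
  proof -
    have "sqrt (real (m n)) ^ ((r - 1) * r) = (sqrt (real (m n)) ^ 2) ^ card (pairs r)"
      unfolding power_mult[symmetric] card_pairs by (simp add: mult.commute)
    then have sm: "(sqrt (real (m n)) ^ (r - 1)) ^ r = real (m n) ^ card (pairs r)"
      by (simp flip: power_mult)
    have mp: "real (m n) ^ card (pairs r) > 0" using m_pos[of n] by simp
    have "real (n ^ r * m n ^ card (pairs r)) * ?q ^ r = real n ^ r * (C * ?B ^ (r - 2) / sqrt (real n) ^ (r - 1)) ^ r"
      using mp by (simp add: real_sqrt_mult power_mult_distrib power_divide sm[unfolded One_nat_def] m_pos[of n, THEN gr_implies_not0])
    then show ?thesis by (simp add: power_mult_distrib power_divide mult_ac)
  qed
  finally show ?thesis .
qed

lemma vanishing_rainbow: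
  assumes r: "r \<ge> 2" and \<delta>: "\<delta> * real (r - 2) \<ge> 1"
  shows "vanishing (rainbow \<delta> r)"
proof -
  obtain C where C: "C > 0" "eventually (\<lambda>n. measure_pmf.expectation (P n) (\<lambda>k. Yval n (m n) k) \<le> C) at_top"
    by (rule mean_bound)
  show ?thesis
  proof (rule vanishing_bound)
    show "eventually (\<lambda>n. measure_pmf.prob (G n) (rainbow \<delta> r n) \<le> (C * real n powr (- 1/2)) ^ r) at_top"
      using C(2) eventually_gt_at_top[of 0]
    proof eventually_elim
      case (elim n)
      have n: "real n \<ge> 1" using elim by simp
      have "real n * (real n powr (1/2 - \<delta>)) ^ (r - 2) / sqrt (real n) ^ (r - 1) =
         real n powr (1 + (1/2 - \<delta>) * real (r - 2) - 1/2 * real (r - 1))"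
      proof -
        have "(real n powr (1/2 - \<delta>)) ^ (r - 2) = real n powr ((1/2 - \<delta>) * real (r - 2))"
          using n by (simp add: powr_powr flip: powr_realpow)
        moreover have "sqrt (real n) ^ (r - 1) = real n powr (1/2 * real (r - 1))"
          using n by (simp add: powr_powr powr_half_sqrt[symmetric] flip: powr_realpow)
        ultimately show ?thesis using n by (simp add: powr_add powr_diff)
      qed
      \<comment> \<open>The exponent simplifies to 1/2 - \<delta> * (r - 2), which is where the
        requirement \<delta> * (r - 2) \<ge> 1 comes from.\<close>
      also have "\<dots> \<le> real n powr (- 1/2)"
      proof (rule powr_mono)
        define q where "q = real (r - 2)"
        have q: "real (r - 1) = q + 1" using r by (simp add: q_def of_nat_diff)
        have "1 + (1/2 - \<delta>) * q - 1/2 * (q + 1) = 1/2 - \<delta> * q" by (simp add: field_simps)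
        then show "1 + (1/2 - \<delta>) * real (r - 2) - 1/2 * real (r - 1) \<le> - 1/2"
          using \<delta> unfolding q q_def[symmetric] by linarith
      qed (use n in simp)
      finally have le: "C * (real n * (real n powr (1/2 - \<delta>)) ^ (r - 2) / sqrt (real n) ^ (r - 1)) \<le> C * real n powr (- 1/2)"
        using C(1) by (intro mult_left_mono) auto
      have "measure_pmf.prob (G n) (rainbow \<delta> r n) \<le> (C * real n * (real n powr (1/2 - \<delta>)) ^ (r - 2) / sqrt (real n) ^ (r - 1)) ^ r"
        using elim r by (intro prob_rainbow) auto
      also have "\<dots> \<le> (C * real n powr (- 1/2)) ^ r" using le C(1) by (intro power_mono) (auto simp: mult.assoc)
      finally show ?case .
    qed
    have "((\<lambda>n. C * real n powr (- 1/2)) \<longlongrightarrow> 0) at_top" by real_asymp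
    from tendsto_power[OF this, of r] show "((\<lambda>n. (C * real n powr (- 1/2)) ^ r) \<longlongrightarrow> 0) at_top"
      using r by (simp only: zero_power[of r])
  qed
qed

text \<open>The tuple length \<open>r\<close> depends on \<delta> alone. With
  \<open>D = heavy_size n\<close> the size required for extracting a rainbow clique is of order n
  powr (\<kappa> - \<gamma>), while \<eta> * \<open>K n\<close> is at least \<eta> * n powr
  (\<kappa> - \<gamma>/2); a large clique therefore forces a heavy attribute or a rainbow
  clique.\<close>

lemma small_cliques:
  assumes \<delta>: "\<delta> > 0" and \<eta>: "\<eta> > 0"
  shows "vanishing (\<lambda>n. {S. \<exists>A\<subseteq>{1..n}. (\<forall>v\<in>A. card (S v) \<in> small_sizes n \<delta>) \<and> is_clique S A \<and> real (card A) \<ge> \<eta> * K n})"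
proof -
  define r where "r = nat \<lceil>1 / \<delta>\<rceil> + 2"
  have r: "r \<ge> 2" "r > 0" by (auto simp: r_def)
  have "1 / \<delta> \<le> real (r - 2)" unfolding r_def by linarith
  then have rd: "\<delta> * real (r - 2) \<ge> 1"
    using pos_divide_le_eq[OF \<delta>, of 1 "real (r - 2)"] by (metis mult.commute)
  define R where "R = real (r ^ 2 + r ^ 4)"
  have R: "R > 0" using r by (simp add: R_def add_pos_pos)
  let ?E = "\<lambda>n. {S. \<exists>A\<subseteq>{1..n}. (\<forall>v\<in>A. card (S v) \<in> small_sizes n \<delta>) \<and> is_clique S A \<and> real (card A) \<ge> \<eta> * K n}"
  have \<kappa>\<gamma>: "\<kappa> - \<gamma> > 0" using \<gamma> by linarith
  have e1: "eventually (\<lambda>n. R * (real n powr (\<kappa> - \<gamma>) + 1) < \<eta> * real n powr (\<kappa> - \<gamma>/2)) at_top"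
    using \<gamma>(1) \<eta> R \<kappa>\<gamma> by real_asymp
  have e2: "eventually (\<lambda>n. real n powr (\<kappa> - \<gamma>/2) \<le> K n) at_top" using \<gamma> by (intro K_lower) simp
  show ?thesis
  proof (rule vanishing_mono[OF vanishing_Un[OF vanishing_not_wf vanishing_Un[OF vanishing_heavy vanishing_rainbow[OF r(1) rd]]]])
    show "eventually (\<lambda>n. ?E n \<subseteq> - wf_attr n \<union> (heavy n \<union> rainbow \<delta> r n)) at_top"
      using e1 e2 eventually_gt_at_top[of 0]
    proof eventually_elim
      case (elim n)
      show ?case
      proof (rule subsetI, rule ccontr)
        fix S assume S: "S \<in> ?E n" "S \<notin> - wf_attr n \<union> (heavy n \<union> rainbow \<delta> r n)"
        then obtain A where A: "A \<subseteq> {1..n}" "\<forall>v\<in>A. card (S v) \<in> small_sizes n \<delta>" "is_clique S A" "real (card A) \<ge> \<eta> * K n"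
          by blast
        have wf: "\<And>v. v \<in> A \<Longrightarrow> S v \<subseteq> {0..<m n}" using S(2) A(1) unfolding wf_attr_def by blast
        have finA: "finite A" using finite_subset[OF A(1)] by simp
        have d0: "heavy_size n > 0" using elim by (simp add: heavy_size_def)
        have deg: "card {v \<in> A. w \<in> S v} \<le> heavy_size n" for w
        proof (rule ccontr)
          assume "\<not> ?thesis"
          then have gt: "heavy_size n \<le> card {v \<in> A. w \<in> S v}" by simp
          then obtain T where T: "T \<subseteq> {v \<in> A. w \<in> S v}" "card T = heavy_size n" by (meson obtain_subset_with_card_n)
          then obtain v where "v \<in> A" "w \<in> S v" using d0 by (metis (no_types, lifting) card.empty all_not_in_conv less_irrefl mem_Collect_eq subsetD)
          then have "w < m n" using wf[of v] by auto
          moreover have "T \<subseteq> {1..n}" "\<forall>v\<in>T. w \<in> S v" using T A(1) by auto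
          ultimately have "S \<in> heavy n" unfolding heavy_def using T(2) by blast
          then show False using S(2) by blast
        qed
        have "real (heavy_size n) \<le> real n powr (\<kappa> - \<gamma>) + 1" unfolding heavy_size_def by (smt (verit) of_int_ceiling_le_add_one of_nat_nat powr_ge_zero zero_le_ceiling)
        then have "R * real (heavy_size n) \<le> R * (real n powr (\<kappa> - \<gamma>) + 1)" using R by (intro mult_left_mono) auto
        also have "\<dots> < \<eta> * real n powr (\<kappa> - \<gamma>/2)" using elim by simp
        also have "\<dots> \<le> \<eta> * K n" using elim \<eta> by (intro mult_left_mono) auto
        also have "\<dots> \<le> real (card A)" by (rule A(4))
        finally have "real ((r ^ 2 + r ^ 4) * heavy_size n) < real (card A)" by (simp add: R_def)
        then have big: "(r ^ 2 + r ^ 4) * heavy_size n < card A" by (simp only: of_nat_less_iff)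
        obtain f c where fc: "f \<in> {..<r} \<rightarrow>\<^sub>E A" "inj_on f {..<r}" "inj_on c (pairs r)" "c \<in> extensional (pairs r)"
           "\<forall>(i, j)\<in>pairs r. c (i, j) \<in> S (f i) \<and> c (i, j) \<in> S (f j)"
          using clique_contains_rainbow[OF finA A(3) deg d0 big r(2)] by blast
        have fA: "f i \<in> A" if "i < r" for i using fc(1) that by auto
        have "f \<in> {..<r} \<rightarrow>\<^sub>E {1..n}" using fc(1) A(1) by auto
        moreover have "c \<in> pairs r \<rightarrow>\<^sub>E {0..<m n}"
        proof (rule PiE_I)
          fix e assume e: "e \<in> pairs r"
          then have "c e \<in> S (f (fst e))" "fst e < r" using fc(5) by (auto simp: pairs_def)
          then show "c e \<in> {0..<m n}" using wf[OF fA] by blast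
        qed (use fc(4) in \<open>auto simp: extensional_def\<close>)
        moreover have "\<forall>i<r. card (S (f i)) \<in> small_sizes n \<delta>" using A(2) fA by blast
        ultimately have "S \<in> rainbow \<delta> r n" unfolding rainbow_def using fc(2,3,5) by blast
        then show False using S(2) by blast
      qed
    qed
  qed
qed

subsection \<open>Vertices of medium degree\<close>

definition medium_sizes :: "nat \<Rightarrow> real \<Rightarrow> real \<Rightarrow> nat set" where
  "medium_sizes n \<delta> c = {k. real n powr (1/2 - \<delta>) \<le> Yval n (m n) k \<and> Yval n (m n) k < c * thr n}"

definition medium_attr :: "nat \<Rightarrow> real \<Rightarrow> real \<Rightarrow> nat set set" where
  "medium_attr n \<delta> c = {T. T \<subseteq> {0..<m n} \<and> card T \<in> medium_sizes n \<delta> c}"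

definition medium_prob :: "nat \<Rightarrow> real \<Rightarrow> real \<Rightarrow> real" where
  "medium_prob n \<delta> c = measure_pmf.prob (P n) (medium_sizes n \<delta> c)"

lemma prob_medium_attr: "measure_pmf.prob (attr n) (medium_attr n \<delta> c) = medium_prob n \<delta> c"
  unfolding attr_def medium_attr_def medium_prob_def by (rule prob_attr_card[OF P_supp])

lemma medium_prob_le: "medium_prob n \<delta> c \<le> F n (real n powr (1/2 - \<delta>))" and medium_prob_nonneg: "0 \<le> medium_prob n \<delta> c"
  unfolding medium_prob_def F_def by (auto intro!: measure_pmf.finite_measure_mono simp: medium_sizes_def)

text \<open>The threshold \<open>c * thr n\<close> for Y, expressed as a number of
  attributes.\<close>

definition max_size :: "nat \<Rightarrow> real \<Rightarrow> nat" where "max_size n c = nat \<lfloor>c * sqrt (real (m n) * ln (real n))\<rfloor>"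

lemma max_size_le: "n > 0 \<Longrightarrow> c > 0 \<Longrightarrow> real (max_size n c) \<le> c * sqrt (real (m n) * ln (real n))"
  by (simp add: max_size_def)

lemma medium_sizes_le_max_size:
  assumes n: "n > 0" and c: "c > 0" and k: "k \<in> medium_sizes n \<delta> c"
  shows "k \<le> max_size n c"
proof -
  have "real k = Yval n (m n) k / sqrt (real n / real (m n))"
    using n m_pos[of n] by (simp add: Yval_def)
  also have "\<dots> \<le> c * thr n / sqrt (real n / real (m n))"
    using k by (intro divide_right_mono) (auto simp: medium_sizes_def)
  also have "\<dots> = c * sqrt (real (m n) * ln (real n))"
    using n by (simp add: thr_def real_sqrt_mult real_sqrt_divide)
  finally show ?thesis unfolding max_size_def by linarith
qed

text \<open>Its cardinality is the total overlap over ordered pairs of medium vertices. Being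
  global, it bounds the overlap inside every subset at once, with no union bound over
  subsets.\<close>

definition overlaps :: "nat \<Rightarrow> real \<Rightarrow> real \<Rightarrow> (nat \<Rightarrow> nat set) \<Rightarrow> (nat \<times> nat \<times> nat) set" where
  "overlaps n \<delta> c S = {(u, v, w) \<in> {1..n} \<times> {1..n} \<times> {0..<m n}. u \<noteq> v \<and>
     (S u \<in> medium_attr n \<delta> c \<and> w \<in> S u) \<and> (S v \<in> medium_attr n \<delta> c \<and> w \<in> S v)}"

text \<open>A set is medium and contains a given attribute with probability at most
  \<open>medium_prob\<close> * b / m, where b^2 = \<open>c\<^sup>2\<close> * m * ln n. Summed over
  n^2 * m triples, the square of this is free of \<open>m\<close>.\<close>

lemma prob_overlaps:
  assumes n: "n > 1" and c: "c > 0" and B: "B > 0"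
  shows "measure_pmf.prob (G n) {S. real (card (overlaps n \<delta> c S)) \<ge> B} \<le> (real n * medium_prob n \<delta> c)\<^sup>2 * (c\<^sup>2 * ln (real n)) / B"
proof -
  let ?b = "c * sqrt (real (m n) * ln (real n))"
  let ?I = "{(u, v, w) \<in> {1..n} \<times> {1..n} \<times> {0..<m n}. u \<noteq> v}"
  let ?Q = "\<lambda>w. {T. {w} \<subseteq> T \<and> T \<in> medium_attr n \<delta> c}"
  let ?R = "\<lambda>(u, v, w) S. S u \<in> ?Q w \<and> S v \<in> ?Q w"
  let ?p = "medium_prob n \<delta> c * ?b / real (m n)"
  have n0: "n > 0" using n by simp
  have finI: "finite ?I" by (rule finite_subset[of _ "{1..n} \<times> {1..n} \<times> {0..<m n}"]) auto
  have "card ?I \<le> card ({1..n} \<times> {1..n} \<times> {0..<m n})" by (rule card_mono) auto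
  then have cI: "card ?I \<le> n * (n * m n)" by simp
  have p0: "?p \<ge> 0" using medium_prob_nonneg c n by simp
  have one: "measure_pmf.prob (attr n) (?Q w) \<le> ?p" if w: "w < m n" for w
  proof -
    have "measure_pmf.prob (attr n) (?Q w) \<le> measure_pmf.prob (attr n) {T. {w} \<subseteq> T \<and> card T \<in> medium_sizes n \<delta> c}"
      by (rule measure_pmf.finite_measure_mono) (auto simp: medium_attr_def)
    also have "\<dots> \<le> measure_pmf.expectation (P n) (\<lambda>k. (real k / real (m n)) ^ card {w} * indicator (medium_sizes n \<delta> c) k)"
      unfolding attr_def using w by (intro prob_attr_contain P_supp) auto
    also have "\<dots> \<le> measure_pmf.expectation (P n) (\<lambda>k. ?b / real (m n) * indicator (medium_sizes n \<delta> c) k)"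
    proof (rule integral_mono[OF integrable_P integrable_P])
      fix k
      show "(real k / real (m n)) ^ card {w} * indicator (medium_sizes n \<delta> c) k \<le> ?b / real (m n) * indicator (medium_sizes n \<delta> c) k"
      proof (cases "k \<in> medium_sizes n \<delta> c")
        case True
        have "real k \<le> ?b" using medium_sizes_le_max_size[OF n0 c True] max_size_le[OF n0 c] by linarith
        then show ?thesis using True by (simp add: divide_right_mono)
      qed simp
    qed
    also have "\<dots> = ?p" by (simp add: medium_prob_def)
    finally show ?thesis .
  qed
  have ov: "overlaps n \<delta> c S = {e \<in> ?I. ?R e S}" for S by (auto simp: overlaps_def)
  have "measure_pmf.prob (G n) {S. real (card (overlaps n \<delta> c S)) \<ge> B} \<le> (\<Sum>e\<in>?I. measure_pmf.prob (G n) {S. ?R e S}) / B"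
    unfolding ov by (rule markov_count[OF finI B])
  also have "\<dots> \<le> (\<Sum>e\<in>?I. ?p\<^sup>2) / B"
  proof (rule divide_right_mono[OF sum_mono])
    fix e assume "e \<in> ?I"
    then obtain u v w where e: "e = (u, v, w)" "u \<in> {1..n}" "v \<in> {1..n}" "w < m n" "u \<noteq> v" by auto
    have "measure_pmf.prob (G n) {S. \<forall>i\<in>{u, v}. S i \<in> ?Q w} = (\<Prod>i\<in>{u, v}. measure_pmf.prob (attr n) (?Q w))"
      unfolding G_eq by (rule prob_Pi_pmf_inj[where f="\<lambda>v. v"]) (use e in auto)
    also have "\<dots> = (measure_pmf.prob (attr n) (?Q w))\<^sup>2" using e(5) by (simp add: power2_eq_square)
    also have "\<dots> \<le> ?p\<^sup>2" using one[OF e(4)] by (intro power_mono) auto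
    finally show "measure_pmf.prob (G n) {S. ?R e S} \<le> ?p\<^sup>2" unfolding e(1) by simp
  qed (use B in simp)
  also have "\<dots> = real (card ?I) * ?p\<^sup>2 / B" by simp
  also have "\<dots> \<le> real (n * (n * m n)) * ?p\<^sup>2 / B"
    using cI B by (intro divide_right_mono mult_right_mono of_nat_mono) auto
  also have "\<dots> = (real n * medium_prob n \<delta> c)\<^sup>2 * (c\<^sup>2 * ln (real n)) / B"
    using n m_pos[of n, THEN gr_implies_not0] by (simp add: power_mult_distrib power_divide power2_eq_square mult_ac)
  finally show ?thesis .
qed

text \<open>Retains from a medium clique only what two-block conditioning can use: adjacency between
  the halves, and an overlap bound that involves the first half alone.\<close>

definition split_clique :: "nat \<Rightarrow> real \<Rightarrow> real \<Rightarrow> real \<Rightarrow> nat \<Rightarrow> (nat \<Rightarrow> nat set) set" where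
  "split_clique n \<delta> c B h = {S. \<exists>A1 A2. A1 \<subseteq> {1..n} \<and> A2 \<subseteq> {1..n} \<and> A1 \<inter> A2 = {} \<and> card A1 = h \<and> card A2 = h \<and>
     (\<forall>v\<in>A1 \<union> A2. S v \<in> medium_attr n \<delta> c) \<and> (\<forall>u\<in>A1. \<forall>v\<in>A2. S v \<inter> S u \<noteq> {}) \<and>
     (\<Sum>i\<in>A1. \<Sum>l\<in>A1-{i}. real (card (S i \<inter> S l))) \<le> B}"

text \<open>For a fixed pair of halves each member of the second contributes
  \<open>medium_prob\<close> * \<rho>, each member of the first \<open>medium_prob\<close>. The two
  choices of \<open>h\<close> vertices cost (exp 1 * n / h)^(2 * h), so the base is small as soon as
  \<rho> beats the squared ratio of the mean number of medium vertices to \<open>h\<close>.\<close>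

lemma prob_split_clique:
  assumes n: "n > 1" and c: "c > 0" and h: "h > 0" and b8: "8 * max_size n c \<le> m n" and B: "B \<ge> 0"
    and q: "0 < q" "q \<le> exp (- (real (max_size n c) ^ 2 / (real (m n) - 2 * real (max_size n c))))"
  defines "\<rho> \<equiv> 1 / (real h * q) + 4 * real (max_size n c) * B / (real (m n) * q * real h ^ 2)"
  shows "measure_pmf.prob (G n) (split_clique n \<delta> c B h) \<le> ((exp 1 * (real n * medium_prob n \<delta> c) / real h)\<^sup>2 * \<rho>) ^ h"
proof -
  let ?U = "medium_attr n \<delta> c"
  let ?p = "medium_prob n \<delta> c"
  have n0: "n > 0" using n by simp
  have \<rho>: "\<rho> \<ge> 0" unfolding \<rho>_def using q h B by (intro add_nonneg_nonneg divide_nonneg_nonneg mult_nonneg_nonneg) auto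
  let ?I = "{(A1, A2). A1 \<subseteq> {1..n} \<and> A2 \<subseteq> {1..n} \<and> A1 \<inter> A2 = {} \<and> card A1 = h \<and> card A2 = h}"
  let ?Gd = "\<lambda>A1 S. (\<Sum>i\<in>A1. \<Sum>l\<in>A1-{i}. real (card (S i \<inter> S l))) \<le> B"
  let ?M = "\<lambda>A1 S. {T. T \<subseteq> {0..<m n} \<and> card T \<in> medium_sizes n \<delta> c \<and> T \<in> {T. \<forall>i\<in>A1. T \<inter> S i \<noteq> {}}}"
  let ?R = "\<lambda>(A1, A2) S. (\<forall>i\<in>A1. S i \<in> ?U) \<and> ?Gd A1 S \<and> (\<forall>j\<in>A2. S j \<in> ?M A1 S)"
  let ?J = "{A. A \<subseteq> {1..n} \<and> card A = h}"
  have IJ: "?I \<subseteq> ?J \<times> ?J" by auto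
  have finJ: "finite ?J" by simp
  have finI: "finite ?I" using IJ finJ by (meson finite_SigmaI finite_subset)
  have "card ?I \<le> card (?J \<times> ?J)" using IJ finJ by (intro card_mono finite_cartesian_product)
  also have "\<dots> = (n choose h)\<^sup>2" by (simp add: card_cartesian_product n_subsets power2_eq_square)
  finally have cI: "card ?I \<le> (n choose h)\<^sup>2" .
  have one: "measure_pmf.prob (G n) {S. ?R e S} \<le> ?p ^ h * (\<rho> * ?p) ^ h" if e0: "e \<in> ?I" for e
  proof -
    obtain A1 A2 where e: "e = (A1, A2)" "A1 \<subseteq> {1..n}" "A2 \<subseteq> {1..n}" "A1 \<inter> A2 = {}" "card A1 = h" "card A2 = h"
      using e0 by blast
    have finA: "finite A1" using finite_subset[OF e(2)] by simp
    have ne: "A1 \<noteq> {}" using e(5) h by auto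
    have bound: "measure_pmf.prob (attr n) (?M A1 f) \<le> \<rho> * ?p" if f: "\<forall>i\<in>A1. f i \<in> ?U" "?Gd A1 f" for f
      unfolding attr_def medium_prob_def
    proof (rule prob_attr_le[OF P_supp])
      fix k assume k: "k \<in> medium_sizes n \<delta> c" "k \<le> m n"
      show "measure_pmf.prob (ksub (m n) k) {T. \<forall>i\<in>A1. T \<inter> f i \<noteq> {}} \<le> \<rho>"
        unfolding \<rho>_def e(5)[symmetric]
      proof (rule prob_ksub_hit_all[OF finA ne _ _ b8 m_pos _ q])
        show "\<And>i. i \<in> A1 \<Longrightarrow> f i \<subseteq> {0..<m n} \<and> card (f i) \<le> max_size n c"
          using f(1) medium_sizes_le_max_size[OF n0 c] unfolding medium_attr_def by blast
        show "k \<le> max_size n c" by (rule medium_sizes_le_max_size[OF n0 c k(1)])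
        show "?Gd A1 f" by (rule f(2))
      qed
    qed
    have "measure_pmf.prob (G n) {S. (\<forall>i\<in>A1. S i \<in> ?U) \<and> ?Gd A1 S \<and> (\<forall>j\<in>A2. S j \<in> ?M A1 S)} \<le>
       measure_pmf.prob (attr n) ?U ^ card A1 * (\<rho> * ?p) ^ card A2"
      unfolding G_eq
    proof (rule two_block_bound)
      fix f g :: "nat \<Rightarrow> nat set" assume fg: "\<forall>i\<in>A1. f i = g i"
      then have "(\<Sum>i\<in>A1. \<Sum>l\<in>A1-{i}. real (card (f i \<inter> f l))) = (\<Sum>i\<in>A1. \<Sum>l\<in>A1-{i}. real (card (g i \<inter> g l)))"
        by (intro sum.cong refl) auto
      moreover have "?M A1 f = ?M A1 g" using fg by auto
      ultimately show "?Gd A1 f = ?Gd A1 g \<and> ?M A1 f = ?M A1 g" by simp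
    qed (use e bound \<rho> medium_prob_nonneg in auto)
    then show ?thesis unfolding e(1) prod.case e(5,6) prob_medium_attr .
  qed
  have "measure_pmf.prob (G n) (split_clique n \<delta> c B h) \<le> measure_pmf.prob (G n) {S. \<exists>e\<in>?I. ?R e S}"
  proof (rule measure_pmf.finite_measure_mono, rule subsetI)
    fix S assume "S \<in> split_clique n \<delta> c B h"
    then obtain A1 A2 where A12: "(A1, A2) \<in> ?I" "\<forall>v\<in>A1 \<union> A2. S v \<in> ?U" "\<forall>u\<in>A1. \<forall>v\<in>A2. S v \<inter> S u \<noteq> {}" "?Gd A1 S"
      unfolding split_clique_def by blast
    have "\<forall>j\<in>A2. S j \<in> ?M A1 S"
    proof (intro ballI CollectI conjI)
      fix j i assume j: "j \<in> A2"
      then show "S j \<subseteq> {0..<m n}" "card (S j) \<in> medium_sizes n \<delta> c" using A12(2) unfolding medium_attr_def by auto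
      assume "i \<in> A1"
      then show "S j \<inter> S i \<noteq> {}" using A12(3) j by blast
    qed
    then have "?R (A1, A2) S" unfolding prod.case using A12(2,4) by (intro conjI) (blast | assumption)+
    then show "S \<in> {S. \<exists>e\<in>?I. ?R e S}" by (intro CollectI bexI[OF _ A12(1)])
  qed simp
  also have "\<dots> \<le> (\<Sum>e\<in>?I. measure_pmf.prob (G n) {S. ?R e S})" by (rule union_count[OF finI])
  also have "\<dots> \<le> (\<Sum>e\<in>?I. ?p ^ h * (\<rho> * ?p) ^ h)" by (rule sum_mono) (rule one)
  also have "\<dots> = real (card ?I) * (?p ^ h * (\<rho> * ?p) ^ h)" by simp
  also have "\<dots> \<le> real ((n choose h)\<^sup>2) * (?p ^ h * (\<rho> * ?p) ^ h)"
    using cI \<rho> medium_prob_nonneg by (intro mult_right_mono of_nat_mono) auto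
  also have "\<dots> = (real (n choose h) * ?p ^ h)\<^sup>2 * \<rho> ^ h" by (simp add: power_mult_distrib power2_eq_square mult_ac)
  also have "\<dots> \<le> ((exp 1 * real n / real h) ^ h * ?p ^ h)\<^sup>2 * \<rho> ^ h"
    using \<rho> medium_prob_nonneg by (intro mult_right_mono power_mono choose_le_exp_pow h) auto
  also have "\<dots> = ((exp 1 * (real n * ?p) / real h)\<^sup>2 * \<rho>) ^ h"
    by (simp add: power_mult_distrib power_divide power_mult[symmetric] mult_ac)
  finally show ?thesis .
qed

lemma large_clique_split:
  assumes A: "A \<subseteq> {1..n}" "is_clique S A" "2 * h \<le> card A" and wf: "S \<in> wf_attr n"
    and md: "\<forall>v\<in>A. card (S v) \<in> medium_sizes n \<delta> c" and ov: "real (card (overlaps n \<delta> c S)) < B"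
  shows "S \<in> split_clique n \<delta> c B h"
proof -
  have finA: "finite A" using finite_subset[OF A(1)] by simp
  obtain A1 where A1: "A1 \<subseteq> A" "card A1 = h" "finite A1"
    using obtain_subset_with_card_n[of h A] A(3) finA by (metis finite_subset le_add1 mult_2 order_trans)
  have "h \<le> card (A - A1)" using A1 A(3) by (simp add: card_Diff_subset)
  then obtain A2 where A2: "A2 \<subseteq> A - A1" "card A2 = h" by (meson obtain_subset_with_card_n)
  have U: "S v \<in> medium_attr n \<delta> c" if "v \<in> A" for v
    using that md wf A(1) unfolding medium_attr_def wf_attr_def by blast
  have fS: "finite (S v)" if "v \<in> A" for v using U[OF that] unfolding medium_attr_def by (auto intro: finite_subset)
  have "(\<Sum>i\<in>A1. \<Sum>l\<in>A1-{i}. card (S i \<inter> S l)) = card (SIGMA i:A1. SIGMA l:A1-{i}. S i \<inter> S l)"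
    using A1 fS by (subst card_SigmaI) (auto intro!: sum.cong card_SigmaI[symmetric])
  also have "\<dots> \<le> card (overlaps n \<delta> c S)"
  proof (rule card_mono)
    show "finite (overlaps n \<delta> c S)"
      by (rule finite_subset[of _ "{1..n} \<times> {1..n} \<times> {0..<m n}"]) (auto simp: overlaps_def)
    show "(SIGMA i:A1. SIGMA l:A1-{i}. S i \<inter> S l) \<subseteq> overlaps n \<delta> c S"
    proof (rule subsetI)
      fix e assume "e \<in> (SIGMA i:A1. SIGMA l:A1-{i}. S i \<inter> S l)"
      then obtain i l w where e: "e = (i, l, w)" and ilw: "i \<in> A1" "l \<in> A1" "l \<noteq> i" "w \<in> S i" "w \<in> S l" by auto
      have "i \<in> A" "l \<in> A" using ilw A1 by auto
      moreover from this have "S i \<subseteq> {0..<m n}" using U unfolding medium_attr_def by blast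
      ultimately show "e \<in> overlaps n \<delta> c S" using ilw U A(1) unfolding e overlaps_def by auto
    qed
  qed
  finally have "real (\<Sum>i\<in>A1. \<Sum>l\<in>A1-{i}. card (S i \<inter> S l)) \<le> B" using ov by linarith
  then have "(\<Sum>i\<in>A1. \<Sum>l\<in>A1-{i}. real (card (S i \<inter> S l))) \<le> B" by simp
  moreover have "\<forall>u\<in>A1. \<forall>v\<in>A2. S v \<inter> S u \<noteq> {}"
  proof (intro ballI)
    fix u v assume "u \<in> A1" "v \<in> A2"
    then have "u \<in> A" "v \<in> A" "v \<noteq> u" using A1 A2 by auto
    then show "S v \<inter> S u \<noteq> {}" using A(2) by (simp add: is_clique_def rig_adj_def)
  qed
  moreover have "\<forall>v\<in>A1 \<union> A2. S v \<in> medium_attr n \<delta> c" using U A1 A2 by blast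
  moreover have "A1 \<subseteq> {1..n}" "A2 \<subseteq> {1..n}" "A1 \<inter> A2 = {}" using A1 A2 A(1) by auto
  ultimately show ?thesis unfolding split_clique_def using A1(2) A2(2) by blast
qed

lemma medium_scale:
  assumes c: "c > 0" and \<delta>: "\<delta> > 0"
  shows "eventually (\<lambda>n. 8 * max_size n c \<le> m n \<and> real (max_size n c) / real (m n) \<le> real n powr (- (\<beta>/2) + \<delta>) \<and>
     real n powr (- (c\<^sup>2 + \<delta>)) \<le> exp (- (real (max_size n c) ^ 2 / (real (m n) - 2 * real (max_size n c))))) at_top"
proof -
  obtain c0 where c0: "c0 > 0" "eventually (\<lambda>n. c0 * real n powr \<beta> \<le> real (m n)) at_top" by (rule m_lower)
  have \<beta>0: "\<beta> > 0" using beta alpha by linarith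
  \<comment> \<open>Chosen so that (\<open>c\<^sup>2\<close> + \<delta>) * (1 - 2 * \<theta>) =
    \<open>c\<^sup>2\<close>: once b \<le> \<theta> * M, replacing M - 2 * b by M in the exponent
    costs at most \<delta>.\<close>
  define \<theta> where "\<theta> = \<delta> / (2 * (c\<^sup>2 + \<delta>))"
  have cd: "c\<^sup>2 + \<delta> > 0" using c \<delta> by (simp add: add_pos_pos)
  have \<theta>: "\<theta> > 0" using cd \<delta> by (simp add: \<theta>_def)
  have e1: "eventually (\<lambda>n. c / sqrt c0 * sqrt (ln (real n)) * real n powr (- (\<beta>/2)) \<le> \<theta>) at_top"
    using \<beta>0 c c0(1) \<theta> by real_asymp
  have e2: "eventually (\<lambda>n. c / sqrt c0 * sqrt (ln (real n)) * real n powr (- (\<beta>/2)) \<le> 1/8) at_top"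
    using \<beta>0 c c0(1) by real_asymp
  have e3: "eventually (\<lambda>n. c / sqrt c0 * sqrt (ln (real n)) * real n powr (- (\<beta>/2)) \<le> real n powr (- (\<beta>/2) + \<delta>)) at_top"
    using \<beta>0 c c0(1) \<delta> by real_asymp
  show ?thesis
    using c0(2) e1 e2 e3 eventually_gt_at_top[of 1]
  proof eventually_elim
    case (elim n)
    define b where "b = real (max_size n c)"
    define M where "M = real (m n)"
    have n: "real n > 1" "n > 0" using elim by auto
    have ln: "ln (real n) > 0" using n by simp
    have M: "M > 0" using m_pos[of n] by (simp add: M_def)
    have b: "b \<le> c * sqrt (M * ln (real n))" "b \<ge> 0" using max_size_le[OF n(2) c] by (simp_all add: b_def M_def)
    have "b / M \<le> c * sqrt (M * ln (real n)) / M" using b M by (intro divide_right_mono) auto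
    also have "\<dots> = c * sqrt (ln (real n)) / sqrt M" using M by (simp add: real_sqrt_mult field_simps)
    also have "\<dots> \<le> c * sqrt (ln (real n)) / sqrt (c0 * real n powr \<beta>)"
      using c ln n c0 elim(1) by (intro divide_left_mono) (auto simp: M_def m_pos intro!: mult_pos_pos)
    also have "\<dots> = c / sqrt c0 * sqrt (ln (real n)) * real n powr (- (\<beta>/2))"
    proof -
      have "sqrt (c0 * real n powr \<beta>) = sqrt c0 * real n powr (\<beta>/2)"
        by (simp add: real_sqrt_mult powr_half_sqrt_powr)
      moreover have "real n powr (- (\<beta>/2)) = 1 / real n powr (\<beta>/2)" by (rule powr_minus_divide)
      ultimately show ?thesis by simp
    qed
    finally have bM: "b / M \<le> c / sqrt c0 * sqrt (ln (real n)) * real n powr (- (\<beta>/2))" .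
    have b8: "8 * b \<le> M" using order_trans[OF bM elim(3)] M by (simp add: field_simps)
    have "b / M \<le> \<theta>" using bM elim(2) by linarith
    then have b\<theta>: "b \<le> \<theta> * M" using M by (simp add: field_simps)
    have "b\<^sup>2 \<le> (c * sqrt (M * ln (real n)))\<^sup>2" using b by (intro power_mono) auto
    also have "\<dots> = c\<^sup>2 * (M * ln (real n))" using M ln by (simp add: power_mult_distrib)
    finally have b2: "b\<^sup>2 \<le> c\<^sup>2 * (M * ln (real n))" .
    have "b\<^sup>2 / (M - 2 * b) \<le> (c\<^sup>2 + \<delta>) * ln (real n)"
    proof -
      have "(c\<^sup>2 + \<delta>) * (M - 2 * b) \<ge> (c\<^sup>2 + \<delta>) * (M - 2 * (\<theta> * M))"
        using b\<theta> cd by (intro mult_left_mono) auto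
      also have "(c\<^sup>2 + \<delta>) * (M - 2 * (\<theta> * M)) = c\<^sup>2 * M" 
      proof -
        have "d * (2 * (\<delta> / (2 * d))) = \<delta>" if "d > 0" for d :: real using that by simp
        from this[OF cd] have "(c\<^sup>2 + \<delta>) * (2 * \<theta>) = \<delta>" unfolding \<theta>_def .
        then show ?thesis by (simp add: algebra_simps)
      qed
      finally have "c\<^sup>2 * M * ln (real n) \<le> (c\<^sup>2 + \<delta>) * (M - 2 * b) * ln (real n)" using ln by (intro mult_right_mono) auto
      then have "b\<^sup>2 \<le> (c\<^sup>2 + \<delta>) * ln (real n) * (M - 2 * b)" using b2 by (simp add: mult_ac)
      moreover have "M - 2 * b > 0" using b8 b M by linarith
      ultimately show ?thesis by (simp add: pos_divide_le_eq)
    qed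
    then have "exp (- ((c\<^sup>2 + \<delta>) * ln (real n))) \<le> exp (- (b\<^sup>2 / (M - 2 * b)))" by simp
    moreover have "exp (- ((c\<^sup>2 + \<delta>) * ln (real n))) = real n powr (- (c\<^sup>2 + \<delta>))" using n by (simp add: powr_def algebra_simps)
    moreover have "b / M \<le> real n powr (- (\<beta>/2) + \<delta>)" using bM elim(4) by linarith
    moreover have "8 * max_size n c \<le> m n" using b8 unfolding b_def M_def by linarith
    ultimately show ?case unfolding b_def M_def by simp
  qed
qed

lemma medium_cliques:
  assumes c: "c > 0" "c\<^sup>2 < \<kappa>"
  shows "\<exists>\<delta>>0. \<forall>\<eta>>0.
    vanishing (\<lambda>n. {S. \<exists>A\<subseteq>{1..n}. (\<forall>v\<in>A. card (S v) \<in> medium_sizes n \<delta> c) \<and> is_clique S A \<and> real (card A) \<ge> \<eta> * K n})"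
proof -
  \<comment> \<open>The first gap controls the diagonal part of the variance bound, the second the
    overlap part.\<close>
  define g where "g = min (\<kappa> - c\<^sup>2) (\<beta>/2 - \<kappa>)"
  have g: "g > 0" "g \<le> \<kappa> - c\<^sup>2" "g \<le> \<beta>/2 - \<kappa>" using c beta by (auto simp: g_def \<kappa>_def)
  \<comment> \<open>The estimates below lose 12 * \<delta> in \<rho> and 8 * \<delta> in the squared
    ratio of medium vertices to \<open>h\<close>; 20 * \<delta> \<le> g / 2 leaves the exponent -g /
    2. The other bound keeps n powr (1/2 - \<delta>) in the window of the power law.\<close>
  define \<delta> where "\<delta> = min (g / 40) (\<epsilon>0 / 2)"
  have \<delta>: "\<delta> > 0" "\<delta> < \<epsilon>0" "40 * \<delta> \<le> g" using g eps0 by (auto simp: \<delta>_def min_def)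
  \<comment> \<open>The mean overlap is at most n powr (2 * \<kappa> + 6 * \<delta>) up to a
    logarithm; the remaining 2 * \<delta> make Markov's inequality effective.\<close>
  define B where "B = (\<lambda>n. real n powr (2 * \<kappa> + 8 * \<delta>))"
  have van_ov: "vanishing (\<lambda>n. {S. real (card (overlaps n \<delta> c S)) \<ge> B n})"
  proof (rule vanishing_bound)
    show "eventually (\<lambda>n. measure_pmf.prob (G n) {S. real (card (overlaps n \<delta> c S)) \<ge> B n} \<le> c\<^sup>2 * ln (real n) * real n powr (- 2 * \<delta>)) at_top"
      using medium_count[OF \<delta>(1,2)] eventually_gt_at_top[of 1]
    proof eventually_elim
      case (elim n)
      have n: "real n > 1" using elim by simp
      have "real n * medium_prob n \<delta> c \<le> real n * F n (real n powr (1/2 - \<delta>))" by (intro mult_left_mono medium_prob_le) simp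
      then have np: "real n * medium_prob n \<delta> c \<le> real n powr (\<kappa> + 3 * \<delta>)" using elim by linarith
      have "measure_pmf.prob (G n) {S. real (card (overlaps n \<delta> c S)) \<ge> B n} \<le> (real n * medium_prob n \<delta> c)\<^sup>2 * (c\<^sup>2 * ln (real n)) / B n"
        using elim c n by (intro prob_overlaps) (auto simp: B_def)
      also have "\<dots> \<le> (real n powr (\<kappa> + 3 * \<delta>))\<^sup>2 * (c\<^sup>2 * ln (real n)) / B n"
        using np n medium_prob_nonneg by (intro divide_right_mono mult_right_mono power_mono) (auto simp: B_def)
      also have "\<dots> = c\<^sup>2 * ln (real n) * ((real n powr (\<kappa> + 3 * \<delta>))\<^sup>2 / B n)" by simp
      also have "(real n powr (\<kappa> + 3 * \<delta>))\<^sup>2 / B n = real n powr (- 2 * \<delta>)"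
        unfolding B_def power2_eq_square powr_add[symmetric] powr_diff[symmetric] by (simp add: algebra_simps)
      finally show ?case .
    qed
    show "((\<lambda>n. c\<^sup>2 * ln (real n) * real n powr (- 2 * \<delta>)) \<longlongrightarrow> 0) at_top" using \<delta>(1) c by real_asymp
  qed
  show ?thesis
  proof (intro exI[of _ \<delta>] conjI allI impI, rule \<delta>(1))
    fix \<eta> :: real assume \<eta>: "\<eta> > 0"
    define h where "h = (\<lambda>n. nat \<lfloor>\<eta> * K n / 2\<rfloor>)"
    have hK: "eventually (\<lambda>n. real n powr (\<kappa> - \<delta>) \<le> real (h n) \<and> 2 * real (h n) \<le> \<eta> * K n) at_top"
    proof -
      have "eventually (\<lambda>n. real n powr (\<kappa> - \<delta>) + 1 \<le> \<eta> * real n powr (\<kappa> - \<delta>/2) / 2) at_top"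
      proof -
        have "\<kappa> - \<delta> > 0" using \<delta> g c by (smt (verit) zero_less_power)
        then show ?thesis using \<delta>(1) \<eta> by real_asymp
      qed
      moreover have "eventually (\<lambda>n. real n powr (\<kappa> - \<delta>/2) \<le> K n) at_top" using \<delta> by (intro K_lower) simp
      ultimately show ?thesis
      proof eventually_elim
        case (elim n)
        have "\<eta> * real n powr (\<kappa> - \<delta>/2) / 2 \<le> \<eta> * K n / 2" using elim \<eta> by (intro divide_right_mono mult_left_mono) auto
        then have "real n powr (\<kappa> - \<delta>) + 1 \<le> \<eta> * K n / 2" using elim by linarith
        moreover have "0 \<le> real n powr (\<kappa> - \<delta>)" by simp
        ultimately have "real n powr (\<kappa> - \<delta>) \<le> real (h n)" "real (h n) \<le> \<eta> * K n / 2"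
          unfolding h_def by linarith+
        then show ?case by simp
      qed
    qed
    have van_split: "vanishing (\<lambda>n. split_clique n \<delta> c (B n) (h n))"
    proof (rule vanishing_bound)
      have e1: "eventually (\<lambda>n. (exp 1)\<^sup>2 * 5 * real n powr (- (g/2)) \<le> real n powr (- (g/4))) at_top"
        using g(1) by real_asymp
      show "eventually (\<lambda>n. measure_pmf.prob (G n) (split_clique n \<delta> c (B n) (h n)) \<le> real n powr (- (g/4))) at_top"
        using hK medium_count[OF \<delta>(1,2)] medium_scale[OF c(1) \<delta>(1)] e1 eventually_gt_at_top[of 1]
      proof eventually_elim
        case (elim n)
        define N where "N = real n"
        have N: "N > 1" using elim by (simp add: N_def)
        define q where "q = N powr (- (c\<^sup>2 + \<delta>))"
        define H where "H = real (h n)"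
        have q: "q > 0" using N by (simp add: q_def)
        have Hge: "N powr (\<kappa> - \<delta>) \<le> H" using elim(1) by (simp add: H_def N_def)
        have Hp: "N powr (\<kappa> - \<delta>) > 0" using N by simp
        then have H: "H > 0" using Hge by linarith
        then have hpos: "h n > 0" by (simp add: H_def)
        have "N * medium_prob n \<delta> c \<le> N * F n (N powr (1/2 - \<delta>))" unfolding N_def by (intro mult_left_mono medium_prob_le) simp
        then have np: "N * medium_prob n \<delta> c \<le> N powr (\<kappa> + 3 * \<delta>)" using elim(2) by (simp add: N_def)
        let ?\<rho> = "1 / (H * q) + 4 * real (max_size n c) * B n / (real (m n) * q * H ^ 2)"
        have r1: "1 / (H * q) \<le> N powr (- g + 12 * \<delta>)"
        proof -
          have "1 / (H * q) \<le> 1 / (N powr (\<kappa> - \<delta>) * q)" using Hge Hp q H by (intro divide_left_mono mult_right_mono) auto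
          also have "\<dots> = N powr (- (\<kappa> - \<delta>) + (c\<^sup>2 + \<delta>))"
            by (simp add: q_def powr_minus_divide[symmetric] powr_add[symmetric] algebra_simps)
          also have "\<dots> \<le> N powr (- g + 12 * \<delta>)" using g \<delta> N by (intro powr_mono) auto
          finally show ?thesis .
        qed
        \<comment> \<open>The 2 * \<kappa> in \<open>B\<close> cancels against the square of
          \<open>H\<close>, which leaves \<open>c\<^sup>2\<close> - \<beta>/2 + 12 * \<delta>; here
          \<open>c\<^sup>2\<close> < \<kappa> and the second gap in \<open>g\<close> are both
          used.\<close>
        have r2: "4 * real (max_size n c) * B n / (real (m n) * q * H ^ 2) \<le> 4 * N powr (- g + 12 * \<delta>)"
        proof -
          have "4 * real (max_size n c) * B n / (real (m n) * q * H ^ 2) = 4 * (real (max_size n c) / real (m n)) * (B n / (q * H\<^sup>2))" by simp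
          also have "\<dots> \<le> 4 * N powr (- (\<beta>/2) + \<delta>) * (B n / (q * (N powr (\<kappa> - \<delta>))\<^sup>2))"
          proof (rule mult_mono)
            show "4 * (real (max_size n c) / real (m n)) \<le> 4 * N powr (- (\<beta>/2) + \<delta>)" using elim(3) by (simp add: N_def)
            show "B n / (q * H\<^sup>2) \<le> B n / (q * (N powr (\<kappa> - \<delta>))\<^sup>2)"
              using Hge Hp q H by (intro divide_left_mono mult_left_mono power_mono mult_pos_pos) (auto simp: B_def)
          qed (use q in \<open>auto simp: B_def\<close>)
          also have "B n / (q * (N powr (\<kappa> - \<delta>))\<^sup>2) = N powr ((2 * \<kappa> + 8 * \<delta>) - (- (c\<^sup>2 + \<delta>) + ((\<kappa> - \<delta>) + (\<kappa> - \<delta>))))"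
            unfolding B_def q_def N_def power2_eq_square powr_add[symmetric] powr_diff[symmetric] ..
          also have "4 * N powr (- (\<beta>/2) + \<delta>) * \<dots> = 4 * N powr ((- (\<beta>/2) + \<delta>) + ((2 * \<kappa> + 8 * \<delta>) - (- (c\<^sup>2 + \<delta>) + ((\<kappa> - \<delta>) + (\<kappa> - \<delta>)))))"
            by (simp only: mult.assoc powr_add[symmetric])
          also have "\<dots> \<le> 4 * N powr (- g + 12 * \<delta>)" using g c(2) N by (intro mult_left_mono powr_mono) auto
          finally show ?thesis .
        qed
        have \<rho>: "?\<rho> \<le> 5 * N powr (- g + 12 * \<delta>)" using r1 r2 by linarith
        have \<rho>0: "?\<rho> \<ge> 0" using q H by (intro add_nonneg_nonneg divide_nonneg_nonneg mult_nonneg_nonneg) (auto simp: B_def)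
        have "exp 1 * (N * medium_prob n \<delta> c) / H \<le> exp 1 * N powr (\<kappa> + 3 * \<delta>) / N powr (\<kappa> - \<delta>)"
          using np Hge Hp by (intro frac_le mult_left_mono) auto
        also have "\<dots> = exp 1 * N powr (4 * \<delta>)" by (simp add: powr_diff[symmetric] flip: times_divide_eq_right)
        finally have f: "exp 1 * (N * medium_prob n \<delta> c) / H \<le> exp 1 * N powr (4 * \<delta>)" .
        have f0: "exp 1 * (N * medium_prob n \<delta> c) / H \<ge> 0" using H N medium_prob_nonneg by simp
        have "(exp 1 * (N * medium_prob n \<delta> c) / H)\<^sup>2 * ?\<rho> \<le> (exp 1 * N powr (4 * \<delta>))\<^sup>2 * (5 * N powr (- g + 12 * \<delta>))"
          using f f0 \<rho> \<rho>0 by (intro mult_mono power_mono) auto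
        also have "\<dots> = (exp 1)\<^sup>2 * 5 * (N powr (4 * \<delta>) * N powr (4 * \<delta>) * N powr (- g + 12 * \<delta>))"
          by (simp add: power2_eq_square mult_ac)
        also have "N powr (4 * \<delta>) * N powr (4 * \<delta>) * N powr (- g + 12 * \<delta>) = N powr (4 * \<delta> + 4 * \<delta> + (- g + 12 * \<delta>))"
          by (simp only: powr_add)
        also have "(exp 1)\<^sup>2 * 5 * \<dots> \<le> (exp 1)\<^sup>2 * 5 * N powr (- (g/2))"
          using \<delta>(3) N by (intro mult_left_mono powr_mono) auto
        also have "\<dots> \<le> N powr (- (g/4))" using elim(4) by (simp add: N_def)
        finally have main: "(exp 1 * (N * medium_prob n \<delta> c) / H)\<^sup>2 * ?\<rho> \<le> N powr (- (g/4))" .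
        have small: "N powr (- (g/4)) \<le> 1" using N g(1) powr_mono[of "- (g/4)" 0 N] by simp
        have "measure_pmf.prob (G n) (split_clique n \<delta> c (B n) (h n)) \<le> ((exp 1 * (N * medium_prob n \<delta> c) / H)\<^sup>2 * ?\<rho>) ^ h n"
          unfolding N_def H_def using elim c hpos q by (intro prob_split_clique) (auto simp: B_def q_def N_def)
        also have "\<dots> \<le> (N powr (- (g/4))) ^ h n" using main \<rho>0 by (intro power_mono mult_nonneg_nonneg) auto
        also have "\<dots> \<le> (N powr (- (g/4))) ^ 1" using small hpos by (intro power_decreasing) auto
        finally show ?case by (simp add: N_def)
      qed
      show "((\<lambda>n. real n powr (- (g/4))) \<longlongrightarrow> 0) at_top" using g(1) by real_asymp
    qed
    show "vanishing (\<lambda>n. {S. \<exists>A\<subseteq>{1..n}. (\<forall>v\<in>A. card (S v) \<in> medium_sizes n \<delta> c) \<and> is_clique S A \<and> real (card A) \<ge> \<eta> * K n})"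
    proof (rule vanishing_mono[OF vanishing_Un[OF vanishing_not_wf vanishing_Un[OF van_ov van_split]]])
      show "eventually (\<lambda>n. {S. \<exists>A\<subseteq>{1..n}. (\<forall>v\<in>A. card (S v) \<in> medium_sizes n \<delta> c) \<and> is_clique S A \<and> real (card A) \<ge> \<eta> * K n}
         \<subseteq> - wf_attr n \<union> ({S. real (card (overlaps n \<delta> c S)) \<ge> B n} \<union> split_clique n \<delta> c (B n) (h n))) at_top"
        using hK
      proof eventually_elim
        case (elim n)
        show ?case
        proof (rule subsetI, rule ccontr)
          fix S assume S: "S \<in> {S. \<exists>A\<subseteq>{1..n}. (\<forall>v\<in>A. card (S v) \<in> medium_sizes n \<delta> c) \<and> is_clique S A \<and> real (card A) \<ge> \<eta> * K n}"
            "S \<notin> - wf_attr n \<union> ({S. real (card (overlaps n \<delta> c S)) \<ge> B n} \<union> split_clique n \<delta> c (B n) (h n))"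
          then obtain A where A: "A \<subseteq> {1..n}" "\<forall>v\<in>A. card (S v) \<in> medium_sizes n \<delta> c" "is_clique S A" "real (card A) \<ge> \<eta> * K n"
            by blast
          have "2 * h n \<le> card A" using A(4) elim by linarith
          moreover have "S \<in> wf_attr n" using S(2) by blast
          moreover have "real (card (overlaps n \<delta> c S)) < B n" using S(2) by auto
          ultimately have "S \<in> split_clique n \<delta> c (B n) (h n)" using A(1-3) by (intro large_clique_split)
          then show False using S(2) by blast
        qed
      qed
    qed
  qed
qed

section \<open>Combining the degree ranges\<close>

lemma clique_number_upper:
  assumes c: "c > 0" "c\<^sup>2 < \<kappa>" and \<eta>: "\<eta> > 0"
  shows "vanishing (\<lambda>n. {S. real (clique_number n S) \<ge> (c powr (- \<alpha>) + \<eta>) * K n})"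
proof -
  \<comment> \<open>The medium range dictates how small \<delta> must be. The small range accepts
    every positive \<delta>, so the two can share a boundary and the three classes leave no
    gap.\<close>
  obtain \<delta> where \<delta>: "\<delta> > 0" and md: "\<And>\<eta>. \<eta> > 0 \<Longrightarrow>
    vanishing (\<lambda>n. {S. \<exists>A\<subseteq>{1..n}. (\<forall>v\<in>A. card (S v) \<in> medium_sizes n \<delta> c) \<and> is_clique S A \<and> real (card A) \<ge> \<eta> * K n})"
    using medium_cliques[OF c] by blast
  have \<eta>3: "\<eta> / 3 > 0" using \<eta> by simp
  let ?small = "\<lambda>n. {S. \<exists>A\<subseteq>{1..n}. (\<forall>v\<in>A. card (S v) \<in> small_sizes n \<delta>) \<and> is_clique S A \<and> real (card A) \<ge> \<eta> / 3 * K n}"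
  let ?med = "\<lambda>n. {S. \<exists>A\<subseteq>{1..n}. (\<forall>v\<in>A. card (S v) \<in> medium_sizes n \<delta> c) \<and> is_clique S A \<and> real (card A) \<ge> \<eta> / 3 * K n}"
  let ?high = "\<lambda>n. {S. \<bar>real (card (high n (c * thr n) S)) - c powr (- \<alpha>) * K n\<bar> \<ge> \<eta> / 3 * K n}"
  show ?thesis
  proof (rule vanishing_mono[OF vanishing_Un[OF vanishing_Un[OF vanishing_not_wf small_cliques[OF \<delta> \<eta>3]]
      vanishing_Un[OF md[OF \<eta>3] high_concentration[OF c(1) \<eta>3]]]], intro always_eventually allI subsetI, rule ccontr)
    fix n S assume S: "S \<in> {S. real (clique_number n S) \<ge> (c powr (- \<alpha>) + \<eta>) * K n}"
      and nS: "S \<notin> (- wf_attr n \<union> ?small n) \<union> (?med n \<union> ?high n)"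
    obtain A where A: "A \<subseteq> {1..n}" "is_clique S A" "card A = clique_number n S"
      using clique_number_attained by blast
    have finA: "finite A" using finite_subset[OF A(1)] by simp
    let ?A1 = "{v \<in> A. card (S v) \<in> small_sizes n \<delta>}" and ?A2 = "{v \<in> A. card (S v) \<in> medium_sizes n \<delta> c}"
      and ?A3 = "high n (c * thr n) S"
    have "S \<in> wf_attr n" using nS by blast
    then have "A \<subseteq> ?A1 \<union> ?A2 \<union> ?A3"
      using A(1) unfolding high_def high_attr_def small_sizes_def medium_sizes_def wf_attr_def by auto
    then have "card A \<le> card (?A1 \<union> ?A2 \<union> ?A3)" using finA by (intro card_mono) (auto simp: high_def)
    also have "\<dots> \<le> card ?A1 + card ?A2 + card ?A3"
      by (meson card_Un_le add_le_mono le_refl order_trans)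
    finally have le: "real (card A) \<le> real (card ?A1) + real (card ?A2) + real (card ?A3)" by linarith
    have "real (card ?A1) < \<eta> / 3 * K n"
    proof (rule ccontr)
      assume "\<not> ?thesis"
      then have "?A1 \<subseteq> {1..n} \<and> (\<forall>v\<in>?A1. card (S v) \<in> small_sizes n \<delta>) \<and> is_clique S ?A1 \<and> real (card ?A1) \<ge> \<eta> / 3 * K n"
        using A clique_subset[OF A(2), of ?A1] by auto
      then have "S \<in> ?small n" by blast
      then show False using nS by blast
    qed
    moreover have "real (card ?A2) < \<eta> / 3 * K n"
    proof (rule ccontr)
      assume "\<not> ?thesis"
      then have "?A2 \<subseteq> {1..n} \<and> (\<forall>v\<in>?A2. card (S v) \<in> medium_sizes n \<delta> c) \<and> is_clique S ?A2 \<and> real (card ?A2) \<ge> \<eta> / 3 * K n"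
        using A clique_subset[OF A(2), of ?A2] by auto
      then have "S \<in> ?med n" by blast
      then show False using nS by blast
    qed
    moreover have "real (card ?A3) < c powr (- \<alpha>) * K n + \<eta> / 3 * K n"
    proof -
      have "\<not> \<eta> / 3 * K n \<le> \<bar>real (card ?A3) - c powr (- \<alpha>) * K n\<bar>" using nS by blast
      then show ?thesis by linarith
    qed
    ultimately have "real (card A) < (c powr (- \<alpha>) + \<eta>) * K n" using le by (simp add: distrib_right)
    then show False using S A(3) by simp
  qed
qed

lemma clique_number_asymptotics:
  assumes \<epsilon>: "\<epsilon> > 0"
  shows "vanishing (\<lambda>n. {S. \<bar>real (clique_number n S) / (\<kappa> powr (- \<alpha> / 2) * K n) - 1\<bar> > \<epsilon>})"
proof -
  define V where "V = \<kappa> powr (- \<alpha> / 2)"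
  have V: "V > 0" using \<kappa> by (simp add: V_def)
  \<comment> \<open>Capped at 1 so that 1 - e/2 is positive. Half of \<open>e\<close> goes into the
    choice of \<open>c\<close>, the other half into the slack \<eta>.\<close>
  define e where "e = min \<epsilon> 1"
  have e: "0 < e" "e \<le> 1" "e \<le> \<epsilon>" using \<epsilon> by (auto simp: e_def)
  \<comment> \<open>The constant c = sqrt \<kappa> * s x solves c powr (-\<alpha>) = V * x, and
    \<open>c\<^sup>2\<close> is below \<kappa> for x > 1 and above it for x < 1. Letting
    \<open>x\<close> approach 1 from either side makes both bounds meet at V.\<close>
  define s where "s = (\<lambda>x::real. x powr (- 1 / \<alpha>))"
  have scale: "(sqrt \<kappa> * s x) powr (- \<alpha>) = V * x" "sqrt \<kappa> * s x > 0" "(sqrt \<kappa> * s x)\<^sup>2 = \<kappa> * (s x)\<^sup>2" if "x > 0" for x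
  proof -
    have "(sqrt \<kappa> * s x) powr (- \<alpha>) = (\<kappa> powr (1/2)) powr (- \<alpha>) * (x powr (- 1 / \<alpha>)) powr (- \<alpha>)"
      using \<kappa> by (simp add: s_def powr_mult powr_half_sqrt)
    also have "\<dots> = V * x" using alpha that by (simp add: powr_powr V_def)
    finally show "(sqrt \<kappa> * s x) powr (- \<alpha>) = V * x" .
    show "sqrt \<kappa> * s x > 0" using \<kappa> that by (simp add: s_def)
    show "(sqrt \<kappa> * s x)\<^sup>2 = \<kappa> * (s x)\<^sup>2" using \<kappa> by (simp add: power_mult_distrib)
  qed
  have s2: "(s x)\<^sup>2 = x powr (- 2 / \<alpha>)" if "x > 0" for x
    using that by (simp add: s_def power2_eq_square flip: powr_add)
  have up: "vanishing (\<lambda>n. {S. real (clique_number n S) \<ge> (V * (1 + e/2) + V * e / 2) * K n})"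
  proof -
    have x: "1 + e/2 > 0" using e by simp
    have "(1 + e/2) powr (- 2 / \<alpha>) < (1 + e/2) powr 0" using e alpha by (intro powr_less_mono) auto
    then have "(sqrt \<kappa> * s (1 + e/2))\<^sup>2 < \<kappa>" unfolding scale(3)[OF x] s2[OF x] using \<kappa> x by simp
    from clique_number_upper[OF scale(2)[OF x] this, of "V * e / 2"] show ?thesis
      unfolding scale(1)[OF x] using V e by simp
  qed
  have lo: "vanishing (\<lambda>n. {S. real (clique_number n S) \<le> (V * (1 - e/2) - V * e / 2) * K n})"
  proof -
    have x: "1 - e/2 > 0" using e by simp
    have "(1 - e/2) powr (- 2 / \<alpha>) > 1"
      using e alpha powr_less_mono2_neg[of "- 2 / \<alpha>" "1 - e/2" 1] by simp
    then have "(sqrt \<kappa> * s (1 - e/2))\<^sup>2 > \<kappa>" unfolding scale(3)[OF x] s2[OF x] using \<kappa> by simp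
    from clique_number_lower[OF scale(2)[OF x] this, of "V * e / 2"] show ?thesis
      unfolding scale(1)[OF x] using V e by simp
  qed
  show ?thesis
  proof (rule vanishing_mono[OF vanishing_Un[OF up lo]])
    show "eventually (\<lambda>n. {S. \<bar>real (clique_number n S) / (\<kappa> powr (- \<alpha> / 2) * K n) - 1\<bar> > \<epsilon>} \<subseteq>
      {S. real (clique_number n S) \<ge> (V * (1 + e/2) + V * e / 2) * K n} \<union>
      {S. real (clique_number n S) \<le> (V * (1 - e/2) - V * e / 2) * K n}) at_top"
      using K_pos
    proof eventually_elim
      case (elim n)
      have VK: "V * K n > 0" using V elim by simp
      show ?case
      proof (rule subsetI)
        fix S assume "S \<in> {S. \<bar>real (clique_number n S) / (\<kappa> powr (- \<alpha> / 2) * K n) - 1\<bar> > \<epsilon>}"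
        then have "\<bar>real (clique_number n S) / (V * K n) - 1\<bar> > e" using e by (simp add: V_def)
        then have "real (clique_number n S) / (V * K n) > 1 + e \<or> real (clique_number n S) / (V * K n) < 1 - e" by linarith
        then have "real (clique_number n S) > (1 + e) * (V * K n) \<or> real (clique_number n S) < (1 - e) * (V * K n)"
          using VK by (simp add: pos_less_divide_eq pos_divide_less_eq)
        moreover have "(1 + e) * (V * K n) = (V * (1 + e/2) + V * e / 2) * K n"
          "(1 - e) * (V * K n) = (V * (1 - e/2) - V * e / 2) * K n" by (simp_all add: algebra_simps)
        ultimately show "S \<in> {S. real (clique_number n S) \<ge> (V * (1 + e/2) + V * e / 2) * K n} \<union>
          {S. real (clique_number n S) \<le> (V * (1 - e/2) - V * e / 2) * K n}" by auto
      qed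
    qed
  qed
qed

end

theorem theorem1:
  fixes \<alpha> \<beta> \<epsilon>0 :: real and L :: "real \<Rightarrow> real"
    and m :: "nat \<Rightarrow> nat" and P :: "nat \<Rightarrow> nat pmf"
  assumes alpha: "1 < \<alpha>" "\<alpha> < 2"
    and m_pos: "\<forall>n. 0 < m n"
    and m_inf: "filterlim m at_top at_top"
    and P_supp: "\<forall>n. set_pmf (P n) \<subseteq> {0..m n}"
    and A: "condA m P"
    and L: "slowly_varying L"
    and eps0: "0 < \<epsilon>0" "\<epsilon>0 < 1/2"
    and PL: "condPL m P \<alpha> L \<epsilon>0"
    and beta: "\<beta> > max (2 - \<alpha>) (\<alpha> - 1)"
    and m_growth: "(\<lambda>n. real (m n)) \<in> \<Omega>(\<lambda>n. real n powr \<beta>)"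
  shows "\<forall>\<epsilon>>0. ((\<lambda>n. measure_pmf.prob (rig_pmf n (m n) (P n))
            {S. \<bar>real (clique_number n S) / ((1 - \<alpha>/2) powr (- \<alpha>/2) * Kfun L \<alpha> n) - 1\<bar> > \<epsilon>})
          \<longlongrightarrow> 0) at_top"
proof -
  \<comment> \<open>Normalises the growth exponent; as 1 < \<alpha> < 2, the truncated exponent
    still exceeds 2 - \<alpha> and \<alpha> - 1.\<close>
  have "(\<lambda>n. real n powr \<beta>) \<in> \<Omega>(\<lambda>n. real n powr min \<beta> 1)"
  proof (rule landau_omega.bigI[of 1])
    show "eventually (\<lambda>n. norm (real n powr \<beta>) \<ge> 1 * norm (real n powr min \<beta> 1)) at_top"
      using eventually_gt_at_top[of 0] by eventually_elim (auto intro!: powr_mono)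
  qed simp
  then have m_growth': "(\<lambda>n. real (m n)) \<in> \<Omega>(\<lambda>n. real n powr min \<beta> 1)"
    using m_growth landau_omega.big_trans by blast
  interpret rig_sequence \<alpha> "min \<beta> 1" \<epsilon>0 L m P
    using assms m_growth' by unfold_locales auto
  show ?thesis
    using clique_number_asymptotics unfolding vanishing_def G_def \<kappa>_def by blast
qed

end
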